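(* Fix $\beta\in\ell^2\cap(0,1]^{\mathbb{N}}$, $h_0\in\mathcal{H}$ and $\alpha\in(0,1)$. Suppose $\nu$ is pathwise differentiable at $P_0$, $\nu(P_0)=h_0$, $\widetilde{\nu}_n^\beta$ is an asymptotically linear estimator of $\nu^\beta(P_0)$ with influence function $\phi_0^\beta$ (i.e. $\widetilde{\nu}_n^\beta-\nu^\beta(P_0)=n^{-1}\sum_{i=1}^n\phi_0^\beta(Z_i)+o_p(n^{-1/2})$ under iid sampling from $P_0$), and $\widehat{\zeta}_n$ is a consistent estimator of the $(1-\alpha)$-quantile $\zeta_{1-\alpha}$ of $\|\mathbb{H}^\beta\|_{\mathcal{H}}^2$. Fix a score $s$ in the tangent set at $P_0$ and $\{P_\epsilon:\epsilon\}\in\mathscr{P}(P_0,\mathcal{P},s)$ such that $\|\dot{\nu}_0(s)\|_{\mathcal{H}}>0$. Let $\mathcal{A}_n=\{h\in\mathcal{H}:\|\widetilde{\nu}_n^\beta-\Gamma_\beta(h)\|_{\mathcal{H}}^2\le\widehat{\zeta}_n/n\}$. Then $$P^n_{\epsilon=n^{-1/2}}\{h_0\notin\mathcal{A}_n\}\xrightarrow{n\to\infty}\Pr\{\|\mathbb{H}^\beta+\dot{\nu}_0^\beta(s)\|_{\mathcal{H}}^2>\zeta_{1-\alpha}\}>\alpha,$$ where $P^n_{\epsilon=n^{-1/2}}$ denotes probability when $Z_1,\dots,Z_n$ are iid from $P_{\epsilon}$ with $\epsilon=n^{-1/2}$. Also, $h_n:=\nu(P_{\epsilon=n^{-1/2}})$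 satisfies $\|h_n-h_0\|_{\mathcal{H}}=O(n^{-1/2})$.
   Context: Let $(\mathcal{Z},\mathbf{B})$ be a Polish space, $\mathcal{P}$ a model of distributions dominated by a $\sigma$-finite measure $\lambda$, $\mathcal{H}$ a real separable Hilbert space with orthonormal basis $(h_k)_{k\ge1}$ (padded with zeros if finite-dimensional), $\nu:\mathcal{P}\to\mathcal{H}$. For $P\in\mathcal{P}$, $s\in L^2(P)$, $\mathscr{P}(P,\mathcal{P},s)$ is the set of submodels $\{P_\epsilon:\epsilon\in[0,\delta)\}\subset\mathcal{P}$ with $\|p_\epsilon^{1/2}-p^{1/2}-\epsilon sp^{1/2}/2\|_{L^2(\lambda)}=o(\epsilon)$; tangent set $\{s:\mathscr{P}(P,\mathcal{P},s)\ne\emptyset\}$, tangent space $\dot{\mathcal{P}}_P$ its closed linear span. $\nu$ is pathwise differentiable at $P$ if there is a continuous linear $\dot{\nu}_P:\dot{\mathcal{P}}_P\to\mathcal{H}$ with $\|\nu(P_\epsilon)-\nu(P)-\epsilon\dot{\nu}_P(s)\|_{\mathcal{H}}=o(\epsilon)$ for every tangent-set $s$ and every submodel in $\mathscr{P}(P,\mathcal{P},s)$; $\dot{\nu}_P^*$ is its adjoint. Subscript $0$ means at $P_0\in\mathcal{P}$; $Z_1,Z_2,\dots$ are observations. $\Gamma_\beta(h)=\sum_k\beta_k\langle h,h_k\rangle_{\mathcal{H}}h_k$, $\nu^\beta=\Gamma_\beta\circ\nu$, $\dot{\nu}_0^\beta=\Gamma_\beta\circ\dot{\nu}_0$, $\phi_0^\beta(z)=\sum_k\beta_k\dot{\nu}_0^*(h_k)(z)h_k$.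 $\mathbb{H}^\beta$ is a tight $\mathcal{H}$-valued Gaussian random variable with $\langle\mathbb{H}^\beta,h\rangle_{\mathcal{H}}\sim N(0,E_0[\langle\phi_0^\beta(Z),h\rangle_{\mathcal{H}}^2])$ for each $h\in\mathcal{H}$. $\widetilde{\nu}_n^\beta$ and $\widehat{\zeta}_n$ are measurable functions of $Z_1,\dots,Z_n$. *)

theory Defs
  imports "HOL-Probability.Probability" "HOL-Library.Landau_Symbols"
begin

text \<open>Orthonormal basis indexed by the naturals, padded with zeros when the
  space is finite-dimensional (the nonzero vectors come first).\<close>
definition padded_onb :: "(nat \<Rightarrow> 'h::real_inner) \<Rightarrow> bool" where
  "padded_onb hb \<longleftrightarrow>
     (\<forall>j k. j \<noteq> k \<longrightarrow> inner (hb j) (hb k) = 0) \<and>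
     (\<forall>k. norm (hb k) = 1 \<or> hb k = 0) \<and>
     (\<forall>k. hb k = 0 \<longrightarrow> hb (Suc k) = 0) \<and>
     (\<forall>x. (\<lambda>k. inner x (hb k) *\<^sub>R hb k) sums x)"

definition Gamma :: "(nat \<Rightarrow> real) \<Rightarrow> (nat \<Rightarrow> 'h::real_inner) \<Rightarrow> 'h \<Rightarrow> 'h" where
  "Gamma \<beta> hb h = (\<Sum>k. (\<beta> k * inner h (hb k)) *\<^sub>R hb k)"

definition L2 :: "'z measure \<Rightarrow> ('z \<Rightarrow> real) \<Rightarrow> bool" where
  "L2 P s \<longleftrightarrow> s \<in> borel_measurable P \<and> integrable P (\<lambda>z. (s z)\<^sup>2)"

definition L2_norm_P :: "'z measure \<Rightarrow> ('z \<Rightarrow> real) \<Rightarrow> real" where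
  "L2_norm_P P s = sqrt (\<integral>z. (s z)\<^sup>2 \<partial>P)"

definition dens :: "'z measure \<Rightarrow> 'z measure \<Rightarrow> 'z \<Rightarrow> real" where
  "dens lam P = (\<lambda>z. enn2real (RN_deriv lam P z))"

definition dominated_model :: "'z::polish_space measure \<Rightarrow> 'z measure set \<Rightarrow> bool" where
  "dominated_model lam Pm \<longleftrightarrow>
     sets lam = sets borel \<and> sigma_finite_measure lam \<and>
     (\<forall>P\<in>Pm. prob_space P \<and> sets P = sets borel \<and> absolutely_continuous lam P)"

text \<open>Quadratic-mean differentiable submodels
  {P_eps : eps in [0,delta)} through P with score s
  (the condition ||p_eps^(1/2) - p^(1/2) - eps s p^(1/2)/2||_{L2(lam)} = o(eps)
  is written in squared form).\<close>
definition submodels ::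
  "'z measure \<Rightarrow> 'z measure set \<Rightarrow> 'z measure \<Rightarrow> ('z \<Rightarrow> real) \<Rightarrow> (real \<Rightarrow> 'z measure) set" where
  "submodels lam Pm P s = {Pe. \<exists>\<delta>>0. (\<forall>\<epsilon>\<in>{0..<\<delta>}. Pe \<epsilon> \<in> Pm) \<and> Pe 0 = P \<and>
      ((\<lambda>\<epsilon>. (\<integral>\<^sup>+ z. ennreal ((sqrt (dens lam (Pe \<epsilon>) z) - sqrt (dens lam P z)
                 - \<epsilon> * s z * sqrt (dens lam P z) / 2)\<^sup>2) \<partial>lam) / ennreal (\<epsilon>\<^sup>2))
        \<longlongrightarrow> 0) (at_right 0)}"

definition tangent_set :: "'z measure \<Rightarrow> 'z measure set \<Rightarrow> 'z measure \<Rightarrow> ('z \<Rightarrow> real) set" where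
  "tangent_set lam Pm P = {s. L2 P s \<and> submodels lam Pm P s \<noteq> {}}"

definition tangent_space :: "'z measure \<Rightarrow> 'z measure set \<Rightarrow> 'z measure \<Rightarrow> ('z \<Rightarrow> real) set" where
  "tangent_space lam Pm P = {s. L2 P s \<and> (\<forall>e>0. \<exists>(n::nat) (c::nat \<Rightarrow> real) f. (\<forall>i<n. f i \<in> tangent_set lam Pm P) \<and>
        L2_norm_P P (\<lambda>z. s z - (\<Sum>i<n. c i * f i z)) < e)}"

definition pathwise_derivative ::
  "'z measure \<Rightarrow> 'z measure set \<Rightarrow> ('z measure \<Rightarrow> 'h::real_normed_vector) \<Rightarrow> 'z measure
     \<Rightarrow> (('z \<Rightarrow> real) \<Rightarrow> 'h) \<Rightarrow> bool" where
  "pathwise_derivative lam Pm \<nu> P D \<longleftrightarrow>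
     (\<forall>s\<in>tangent_space lam Pm P. \<forall>t\<in>tangent_space lam Pm P. \<forall>a b.
         D (\<lambda>z. a * s z + b * t z) = a *\<^sub>R D s + b *\<^sub>R D t) \<and>
     (\<exists>C. \<forall>s\<in>tangent_space lam Pm P. norm (D s) \<le> C * L2_norm_P P s) \<and>
     (\<forall>s\<in>tangent_set lam Pm P. \<forall>Pe\<in>submodels lam Pm P s.
         ((\<lambda>\<epsilon>. norm (\<nu> (Pe \<epsilon>) - \<nu> P - \<epsilon> *\<^sub>R D s) / \<epsilon>) \<longlongrightarrow> 0) (at_right 0))"

definition pathwise_differentiable ::
  "'z measure \<Rightarrow> 'z measure set \<Rightarrow> ('z measure \<Rightarrow> 'h::real_normed_vector) \<Rightarrow> 'z measure \<Rightarrow> bool" where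
  "pathwise_differentiable lam Pm \<nu> P \<longleftrightarrow> (\<exists>D. pathwise_derivative lam Pm \<nu> P D)"

definition is_adjoint ::
  "'z measure \<Rightarrow> 'z measure set \<Rightarrow> 'z measure \<Rightarrow> (('z \<Rightarrow> real) \<Rightarrow> 'h::real_inner)
     \<Rightarrow> ('h \<Rightarrow> 'z \<Rightarrow> real) \<Rightarrow> bool" where
  "is_adjoint lam Pm P D Dstar \<longleftrightarrow>
     (\<forall>h. Dstar h \<in> tangent_space lam Pm P) \<and>
     (\<forall>h. \<forall>s\<in>tangent_space lam Pm P. inner (D s) h = (\<integral>z. s z * Dstar h z \<partial>P))"

text \<open>phi_0^beta(z) = sum_k beta_k Dstar(h_k)(z) h_k  (set to 0 where the series diverges,
  which happens only on a P_0-null set).\<close>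
definition phi_beta :: "(nat \<Rightarrow> real) \<Rightarrow> (nat \<Rightarrow> 'h::real_normed_vector) \<Rightarrow> ('h \<Rightarrow> 'z \<Rightarrow> real) \<Rightarrow> 'z \<Rightarrow> 'h" where
  "phi_beta \<beta> hb Dstar z =
     (if summable (\<lambda>k. (\<beta> k * Dstar (hb k) z) *\<^sub>R hb k)
      then (\<Sum>k. (\<beta> k * Dstar (hb k) z) *\<^sub>R hb k) else 0)"

definition gauss :: "real \<Rightarrow> real measure" where
  "gauss v = (if v = 0 then return borel 0 else density lborel (normal_density 0 (sqrt v)))"

definition tight :: "'a::topological_space measure \<Rightarrow> bool" where
  "tight G \<longleftrightarrow> (\<forall>e>0. \<exists>K. compact K \<and> K \<in> sets G \<and> measure G K \<ge> 1 - e)"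

definition gaussian_law_of :: "'h::real_inner measure \<Rightarrow> 'z measure \<Rightarrow> ('z \<Rightarrow> 'h) \<Rightarrow> bool" where
  "gaussian_law_of G P0 \<phi> \<longleftrightarrow> prob_space G \<and> sets G = sets borel \<and> tight G \<and>
     (\<forall>h. distr G borel (\<lambda>x. inner x h) = gauss (\<integral>z. (inner (\<phi> z) h)\<^sup>2 \<partial>P0))"

definition quantile :: "'a measure \<Rightarrow> ('a \<Rightarrow> real) \<Rightarrow> real \<Rightarrow> real" where
  "quantile M f q = Inf {t. measure M {x\<in>space M. f x \<le> t} \<ge> q}"

abbreviation sample :: "nat \<Rightarrow> 'z measure \<Rightarrow> (nat \<Rightarrow> 'z) measure" where
  "sample n P \<equiv> PiM {..<n} (\<lambda>_. P)"

end

(*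
  Let S_n = n^(-1/2) sum_i phi(Z_i). Expanding the square-root densities in n^(-1/2) and passing to the
  limit in n (E exp(i n^(-1/2) f(Z)) - 1), for f a finite combination of coordinates of phi, shows that
  under the local alternatives the finite-dimensional marginals of S_n converge to those of H + delta,
  where delta = Gamma (D s) and <delta, w> = E_0 [s <phi, w>].

  Since exp(-m |x|^2) is an average of characters over Gaussian frequencies, the Laplace transforms of
  the truncated squared norms converge. The remainders (truncation, asymptotic linearity, estimated
  quantile) are controlled under P_0 and transferred by contiguity: comparing with the tilted densities
  p (1 + t / sqrt n), t bounded, the Hellinger distance of the n-fold products is small, and the
  likelihood ratio of the tilted law is bounded in L^2(P_0).

  For the strict inequality, split delta along eigenvectors of the covariance operator C, obtained by
  power iteration. If e is an eigenvector, then <H, e> is independent of the orthogonal part of H, and a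
  one-dimensional comparison shows that deleting the e-component of delta increases
  Pr(|H + delta|^2 <= zeta), strictly if this component is nonzero and the increased probability is
  positive. Deletion of all components leads to delta = 0, because delta is orthogonal to the kernel of C.
*)
theory Submission
  imports Defs
begin

section \<open>Laplace transforms and characteristic functions\<close>

text \<open>Convergence in law on the Hilbert space is never established. The rejection event
  compares a squared norm with a threshold, so it is enough to control the Laplace transform of that
  scalar at the integers, that is, the moments of a [0,1]-valued variable. Two Gaussian vectors are
  likewise compared only through the law of a squared norm.

  The assumptions on the estimator hold under \<open>P0\<close>, while the conclusion concerns a
  moving sequence of laws. As the score is merely square integrable, the likelihood ratio along the
  path may have no second moment; hence the detour through bounded tilts.

  Anderson's inequality alone yields only \<open>\<ge> \<alpha>\<close>. Strictness needs a
  direction in which the limit law is nondegenerate and the shift is nonzero. Along an eigenvector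
  of the covariance the Gaussian measure factorizes, and the comparison becomes one about intervals
  on the line.

  \<open>D\<close> and \<open>Dstar\<close> act on functions, not on classes modulo null sets, so
  identities between them are used in integrated form or almost everywhere; linearity of the
  covariance operator is read off from its symmetry.\<close>

lemma moment_convergence_imp_continuous:
  fixes Y :: "nat \<Rightarrow> 'a \<Rightarrow> real" and X :: "'b \<Rightarrow> real" and g :: "real \<Rightarrow> real"
  assumes M: "\<And>n. prob_space (M n)" and N: "prob_space N"
    and Y [measurable]: "\<And>n. Y n \<in> borel_measurable (M n)" and X [measurable]: "X \<in> borel_measurable N"
    and Y01: "\<And>n x. Y n x \<in> {0..1}" and X01: "\<And>x. X x \<in> {0..1}"
    and lim: "\<And>m. (\<lambda>n. \<integral>x. Y n x ^ m \<partial>M n) \<longlonglongrightarrow> (\<integral>x. X x ^ m \<partial>N)"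
    and g: "continuous_on UNIV g"
  shows "(\<lambda>n. \<integral>x. g (Y n x) \<partial>M n) \<longlonglongrightarrow> (\<integral>x. g (X x) \<partial>N)"
proof (rule LIMSEQ_I)
  fix e :: real assume e: "0 < e"
  \<comment> \<open>By Weierstrass, \<open>g\<close> is replaced on [0,1] by a polynomial, whose
    integral is a combination of moments. Two approximation errors and one convergence error, each
    at most \<open>e/4\<close>, stay below \<open>e\<close>.\<close>
  have g01: "continuous_on {0..1} g" using g continuous_on_subset by blast
  then obtain p where p: "real_polynomial_function p" "\<And>x. x \<in> {0..1} \<Longrightarrow> \<bar>g x - p x\<bar> < e/4"
    using Stone_Weierstrass_real_polynomial_function[of "{0..1::real}" g "e/4"] e by auto
  then obtain a d where pa: "p = (\<lambda>x. \<Sum>i\<le>d. a i * x ^ i)"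
    using real_polynomial_function_iff_sum by auto
  have [measurable]: "g \<in> borel_measurable borel" using g by (rule borel_measurable_continuous_onI)
  obtain B where B: "\<And>x. x \<in> {0..1} \<Longrightarrow> \<bar>g x\<bar> \<le> B"
    using compact_continuous_image[OF g01] compact_imp_bounded bounded_iff
    by (metis compact_Icc imageI real_norm_def)
  have intg: "integrable K (\<lambda>x. g (Z x))" and intp: "integrable K (\<lambda>x. p (Z x))"
     and intpw: "integrable K (\<lambda>x. Z x ^ m)"
     and close: "\<bar>(\<integral>x. g (Z x) \<partial>K) - (\<integral>x. p (Z x) \<partial>K)\<bar> \<le> e/4"
     and expand: "(\<integral>x. p (Z x) \<partial>K) = (\<Sum>i\<le>d. a i * (\<integral>x. Z x ^ i \<partial>K))"
    if K: "prob_space K" and Z [measurable]: "Z \<in> borel_measurable K" and Z01: "\<And>x. Z x \<in> {0..1}"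
    for K :: "'c measure" and Z m
  proof -
    interpret K: prob_space K by fact
    have pw: "integrable K (\<lambda>x. Z x ^ m)" for m
      by (rule K.integrable_const_bound[where B=1]) (use Z01 in \<open>auto intro!: AE_I2 power_le_one\<close>)
    show "integrable K (\<lambda>x. Z x ^ m)" by (rule pw)
    show ig: "integrable K (\<lambda>x. g (Z x))"
      by (rule K.integrable_const_bound[where B=B]) (use B Z01 in \<open>auto intro!: AE_I2\<close>)
    show ip: "integrable K (\<lambda>x. p (Z x))" using pw by (auto simp: pa)
    show "(\<integral>x. p (Z x) \<partial>K) = (\<Sum>i\<le>d. a i * (\<integral>x. Z x ^ i \<partial>K))"
      using pw by (simp add: pa)
    have "\<bar>(\<integral>x. g (Z x) \<partial>K) - (\<integral>x. p (Z x) \<partial>K)\<bar> = \<bar>\<integral>x. g (Z x) - p (Z x) \<partial>K\<bar>"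
      using ig ip by simp
    also have "\<dots> \<le> (\<integral>x. \<bar>g (Z x) - p (Z x)\<bar> \<partial>K)" by (rule integral_abs_bound)
    also have "\<dots> \<le> (\<integral>x. e/4 \<partial>K)"
      by (rule integral_mono) (use ig ip p(2)[OF Z01] in \<open>auto intro: less_imp_le\<close>)
    finally show "\<bar>(\<integral>x. g (Z x) \<partial>K) - (\<integral>x. p (Z x) \<partial>K)\<bar> \<le> e/4" by (simp add: K.prob_space)
  qed
  have "(\<lambda>n. \<integral>x. p (Y n x) \<partial>M n) \<longlonglongrightarrow> (\<integral>x. p (X x) \<partial>N)"
    unfolding expand[OF N X X01] expand[OF M Y Y01] by (intro tendsto_intros lim)
  from LIMSEQ_D[OF this, of "e/4"] e
  obtain n0 where n0: "\<And>n. n \<ge> n0 \<Longrightarrow> \<bar>(\<integral>x. p (Y n x) \<partial>M n) - (\<integral>x. p (X x) \<partial>N)\<bar> < e/4"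
    by auto
  have "norm ((\<integral>x. g (Y n x) \<partial>M n) - (\<integral>x. g (X x) \<partial>N)) < e" if "n \<ge> n0" for n
    using n0[OF that] close[OF M Y Y01, of n] close[OF N X X01] e unfolding real_norm_def by linarith
  then show "\<exists>n0. \<forall>n\<ge>n0. norm ((\<integral>x. g (Y n x) \<partial>M n) - (\<integral>x. g (X x) \<partial>N)) < e" by blast
qed

text \<open>The moments of \<open>exp (- Y n x)\<close> are the Laplace transforms at integers, so
  the integral of a continuous ramp between \<open>a\<close> and \<open>b\<close> converges. The gap
  \<open>a < b\<close> takes the place of continuity points of the limit law, and one pair
  \<open>c\<close>, \<open>l\<close> carries the bounds for the sequence and for the limit.\<close>

lemma laplace_convergence_sandwich:
  fixes Y :: "nat \<Rightarrow> 'a \<Rightarrow> real" and X :: "'b \<Rightarrow> real"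
  assumes M: "\<And>n. prob_space (M n)" and N: "prob_space N"
    and Y [measurable]: "\<And>n. Y n \<in> borel_measurable (M n)" and X [measurable]: "X \<in> borel_measurable N"
    and Y0: "\<And>n x. Y n x \<ge> 0" and X0: "\<And>x. X x \<ge> 0"
    and lim: "\<And>m::nat. (\<lambda>n. \<integral>x. exp (- (real m * Y n x)) \<partial>M n) \<longlonglongrightarrow> (\<integral>x. exp (- (real m * X x)) \<partial>N)"
    and ab: "a < b"
  obtains c l where "c \<longlonglongrightarrow> l"
    "\<And>n. measure (M n) {x \<in> space (M n). Y n x \<le> a} \<le> c n"
    "\<And>n. c n \<le> measure (M n) {x \<in> space (M n). Y n x \<le> b}"
    "measure N {x \<in> space N. X x \<le> a} \<le> l"
    "l \<le> measure N {x \<in> space N. X x \<le> b}"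
proof -
  \<comment> \<open>A clipped linear function of \<open>y = exp (-x)\<close>: it is 1 when
    \<open>x \<le> a\<close> and 0 when \<open>x > b\<close>, so it lies between the two
    indicators.\<close>
  define g where "g y = max 0 (min 1 ((y - exp (-b)) / (exp (-a) - exp (-b))))" for y :: real
  have pos: "exp (-a) - exp (-b) > 0" using ab by simp
  have g: "continuous_on UNIV g" unfolding g_def by (intro continuous_intros) (use pos in auto)
  have [measurable]: "g \<in> borel_measurable borel" using g by (rule borel_measurable_continuous_onI)
  have g01: "0 \<le> g y" "g y \<le> 1" for y by (auto simp: g_def)
  have g1: "g (exp (-y)) = 1" if "y \<le> a" for y
  proof -
    have "exp (-y) - exp (-b) \<ge> exp (-a) - exp (-b)" using that by simp
    then have "(exp (-y) - exp (-b)) / (exp (-a) - exp (-b)) \<ge> 1" using pos by simp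
    then show ?thesis by (simp add: g_def)
  qed
  have g0: "g (exp (-y)) = 0" if "b < y" for y
  proof -
    have "exp (-y) - exp (-b) \<le> 0" using that by simp
    then have "(exp (-y) - exp (-b)) / (exp (-a) - exp (-b)) \<le> 0" using pos by (simp add: divide_le_0_iff)
    then show ?thesis by (simp add: g_def)
  qed
  have pw: "exp (-y) ^ m = exp (-(real m * y))" for y :: real and m
    by (simp add: exp_of_nat_mult[symmetric])
  have lo: "measure K {x \<in> space K. Z x \<le> a} \<le> (\<integral>x. g (exp (- Z x)) \<partial>K)"
    and hi: "(\<integral>x. g (exp (- Z x)) \<partial>K) \<le> measure K {x \<in> space K. Z x \<le> b}"
    if K: "prob_space K" and Z [measurable]: "Z \<in> borel_measurable K" for K :: "'c measure" and Z
  proof -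
    interpret K: prob_space K by fact
    have ig: "integrable K (\<lambda>x. g (exp (- Z x)))"
      by (rule K.integrable_const_bound[where B=1]) (use g01 in \<open>auto intro!: AE_I2\<close>)
    have eq: "(\<integral>x. indicator {x \<in> space K. Z x \<le> t} x \<partial>K) = measure K {x \<in> space K. Z x \<le> t}" for t
      by (simp add: Int_absorb1 Collect_mono_iff)
    have ii: "integrable K (indicator {x \<in> space K. Z x \<le> t} :: 'c \<Rightarrow> real)" for t
      by (rule integrable_real_indicator) (auto simp: K.emeasure_eq_measure)
    show "measure K {x \<in> space K. Z x \<le> a} \<le> (\<integral>x. g (exp (- Z x)) \<partial>K)"
      unfolding eq[symmetric]
      by (rule integral_mono[OF ii ig]) (use g1 g01 in \<open>auto simp: indicator_def\<close>)
    show "(\<integral>x. g (exp (- Z x)) \<partial>K) \<le> measure K {x \<in> space K. Z x \<le> b}"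
      unfolding eq[symmetric]
      by (rule integral_mono[OF ig ii]) (use g0 g01 in \<open>force simp: indicator_def\<close>)
  qed
  have "(\<lambda>n. \<integral>x. g (exp (- Y n x)) \<partial>M n) \<longlonglongrightarrow> (\<integral>x. g (exp (- X x)) \<partial>N)"
    by (rule moment_convergence_imp_continuous[OF M N _ _ _ _ _ g])
       (use Y0 X0 lim in \<open>auto simp: pw\<close>)
  from that[OF this lo[OF M Y] hi[OF M Y] lo[OF N X] hi[OF N X]] show ?thesis .
qed

text \<open>The sandwich is applied to a constant sequence with thresholds \<open>a\<close> and
  \<open>a + 1 / Suc n\<close>. Right continuity of distribution functions closes the gap, and
  symmetry gives the reverse inequality.\<close>

lemma laplace_eq_imp_cdf_eq:
  fixes Y :: "'a \<Rightarrow> real" and X :: "'b \<Rightarrow> real"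
  assumes M: "prob_space M" and N: "prob_space N"
    and Y [measurable]: "Y \<in> borel_measurable M" and X [measurable]: "X \<in> borel_measurable N"
    and Y0: "\<And>x. Y x \<ge> 0" and X0: "\<And>x. X x \<ge> 0"
    and eq: "\<And>m::nat. (\<integral>x. exp (- (real m * Y x)) \<partial>M) = (\<integral>x. exp (- (real m * X x)) \<partial>N)"
  shows "measure M {x \<in> space M. Y x \<le> a} = measure N {x \<in> space N. X x \<le> a}"
proof -
  have rc: "(\<lambda>n. measure K {x \<in> space K. Z x \<le> a + 1 / real (Suc n)}) \<longlonglongrightarrow> measure K {x \<in> space K. Z x \<le> a}"
    if K: "prob_space K" and Z [measurable]: "Z \<in> borel_measurable K" for K :: "'c measure" and Z
  proof -
    interpret K: prob_space K by fact
    have *: "(\<Inter>n. {x \<in> space K. Z x \<le> a + 1 / real (Suc n)}) = {x \<in> space K. Z x \<le> a}"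
    proof (intro set_eqI iffI)
      fix x assume x: "x \<in> (\<Inter>n. {x \<in> space K. Z x \<le> a + 1 / real (Suc n)})"
      have "(\<lambda>n. a + 1 / real (Suc n)) \<longlonglongrightarrow> a + 0"
        by (intro tendsto_add tendsto_const LIMSEQ_Suc[OF lim_1_over_n])
      then have "Z x \<le> a" using x by (intro LIMSEQ_le_const) auto
      then show "x \<in> {x \<in> space K. Z x \<le> a}" using x by auto
    next
      fix x assume "x \<in> {x \<in> space K. Z x \<le> a}"
      then show "x \<in> (\<Inter>n. {x \<in> space K. Z x \<le> a + 1 / real (Suc n)})"
        by (auto intro: order_trans)
    qed
    have "decseq (\<lambda>n. {x \<in> space K. Z x \<le> a + 1 / real (Suc n)})"
    proof (intro decseq_SucI subsetI)
      fix n x assume "x \<in> {x \<in> space K. Z x \<le> a + 1 / real (Suc (Suc n))}"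
      moreover have "1 / real (Suc (Suc n)) \<le> 1 / real (Suc n)" by (simp add: frac_le)
      ultimately show "x \<in> {x \<in> space K. Z x \<le> a + 1 / real (Suc n)}" by auto
    qed
    then show ?thesis unfolding *[symmetric]
      by (intro K.finite_Lim_measure_decseq) auto
  qed
  have le: "measure K {x \<in> space K. Z x \<le> a} \<le> measure L {x \<in> space L. W x \<le> a}"
    if K: "prob_space K" and Z: "Z \<in> borel_measurable K" "\<And>x. Z x \<ge> 0"
      and L: "prob_space L" and W: "W \<in> borel_measurable L" "\<And>x. W x \<ge> 0"
      and eq: "\<And>m::nat. (\<integral>x. exp (- (real m * Z x)) \<partial>K) = (\<integral>x. exp (- (real m * W x)) \<partial>L)"
    for K :: "'c measure" and Z and L :: "'d measure" and W
  proof (rule LIMSEQ_le_const[OF rc[OF L W(1)]], intro exI allI impI)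
    fix n :: nat
    have lt: "a < a + 1 / real (Suc n)" by simp
    obtain c l where c: "(c :: nat \<Rightarrow> real) \<longlonglongrightarrow> l"
      "\<And>n. measure K {x \<in> space K. Z x \<le> a} \<le> c n"
      "l \<le> measure L {x \<in> space L. W x \<le> a + 1 / real (Suc n)}"
      by (rule laplace_convergence_sandwich[where M="\<lambda>_. K" and Y="\<lambda>_. Z", OF K L Z(1) W(1) Z(2) W(2) _ lt])
         (auto simp: eq)
    have "measure K {x \<in> space K. Z x \<le> a} \<le> l"
      by (rule LIMSEQ_le_const[OF c(1)]) (use c(2) in auto)
    with c(3) show "measure K {x \<in> space K. Z x \<le> a} \<le> measure L {x \<in> space L. W x \<le> a + 1 / real (Suc n)}"
      by linarith
  qed
  show ?thesis
    by (rule antisym) (rule le[OF M Y Y0 N X X0 eq], rule le[OF N X X0 M Y Y0 eq[symmetric]])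
qed

lemma gaussian_randomization:
  fixes x :: "nat \<Rightarrow> real"
  shows "complex_of_real (exp (- (a\<^sup>2 / 2 * (\<Sum>k<K. (x k)\<^sup>2)))) =
    (\<integral>w. iexp (a * (\<Sum>k<K. w k * x k)) \<partial>(PiM {..<K} (\<lambda>_. std_normal_distribution)))"
proof -
  interpret N: prob_space std_normal_distribution
    by (rule prob_space_normal_density) simp
  interpret P: product_sigma_finite "\<lambda>_::nat. std_normal_distribution"
    by unfold_locales
  have int: "integrable std_normal_distribution (\<lambda>u. iexp (a * x k * u))" for k
    by (rule N.integrable_const_bound[where B=1]) auto
  have "(\<integral>w. iexp (a * (\<Sum>k<K. w k * x k)) \<partial>(PiM {..<K} (\<lambda>_. std_normal_distribution)))
      = (\<integral>w. (\<Prod>k<K. iexp (a * x k * w k)) \<partial>(PiM {..<K} (\<lambda>_. std_normal_distribution)))"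
    by (simp add: exp_sum[symmetric] sum_distrib_left mult_ac)
  also have "\<dots> = (\<Prod>k<K. char std_normal_distribution (a * x k))"
    unfolding char_def by (rule P.product_integral_prod) (use int in auto)
  also have "\<dots> = complex_of_real (\<Prod>k<K. exp (- ((a * x k)\<^sup>2) / 2))"
    by (simp add: char_std_normal_distribution)
  also have "(\<Prod>k<K. exp (- ((a * x k)\<^sup>2) / 2)) = exp (- (a\<^sup>2 / 2 * (\<Sum>k<K. (x k)\<^sup>2)))"
    by (simp add: exp_sum[symmetric] sum_distrib_left power_mult_distrib sum_negf)
  finally show ?thesis by simp
qed

text \<open>After Fubini each Laplace transform is a Gaussian average of characteristic functions,
  which are bounded by 1. Dominated convergence in the frequency therefore needs only their
  pointwise convergence, and no tightness argument in \<open>K\<close> dimensions is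
  involved.\<close>

lemma char_convergence_imp_laplace_convergence:
  fixes U :: "nat \<Rightarrow> nat \<Rightarrow> 'a \<Rightarrow> real" and V :: "nat \<Rightarrow> 'b \<Rightarrow> real"
  assumes M: "\<And>n. prob_space (M n)" and N: "prob_space N"
    and U [measurable]: "\<And>n k. U n k \<in> borel_measurable (M n)"
    and V [measurable]: "\<And>k. V k \<in> borel_measurable N"
    and lim: "\<And>w. (\<lambda>n. \<integral>x. iexp (\<Sum>k<K. w k * U n k x) \<partial>M n) \<longlonglongrightarrow> (\<integral>x. iexp (\<Sum>k<K. w k * V k x) \<partial>N)"
  shows "(\<lambda>n. \<integral>x. exp (- (real m * (\<Sum>k<K. (U n k x)\<^sup>2))) \<partial>M n)
    \<longlonglongrightarrow> (\<integral>x. exp (- (real m * (\<Sum>k<K. (V k x)\<^sup>2))) \<partial>N)"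
proof -
  let ?W = "PiM {..<K} (\<lambda>_. std_normal_distribution)"
  \<comment> \<open>The frequency scale for which the Gaussian exponent \<open>a\<^sup>2 / 2\<close>
    equals \<open>m\<close>.\<close>
  define a where "a = sqrt (2 * real m)"
  have a2: "a\<^sup>2 / 2 = real m" by (simp add: a_def)
  interpret S: prob_space std_normal_distribution
    by (rule prob_space_normal_density) simp
  interpret W: prob_space ?W by (rule prob_space_PiM) unfold_locales
  have swap: "complex_of_real (\<integral>x. exp (- (real m * (\<Sum>k<K. (Z k x)\<^sup>2))) \<partial>L)
      = (\<integral>w. (\<integral>x. iexp (\<Sum>k<K. (a * w k) * Z k x) \<partial>L) \<partial>?W)"
    and meas: "(\<lambda>w. \<integral>x. iexp (\<Sum>k<K. (a * w k) * Z k x) \<partial>L) \<in> borel_measurable ?W"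
    if L: "prob_space L" and Z [measurable]: "\<And>k. Z k \<in> borel_measurable L" for L :: "'c measure" and Z
  proof -
    interpret L: prob_space L by fact
    interpret WL: pair_prob_space ?W L by unfold_locales
    have [measurable]: "(\<lambda>(w, x). iexp (\<Sum>k<K. (a * w k) * Z k x)) \<in> borel_measurable (?W \<Otimes>\<^sub>M L)"
    proof -
      have eq: "?W \<rightarrow>\<^sub>M std_normal_distribution = ?W \<rightarrow>\<^sub>M borel"
        by (rule measurable_cong_sets) auto
      have "(\<lambda>p. fst p k) \<in> borel_measurable (?W \<Otimes>\<^sub>M L)" if "k < K" for k
        using measurable_compose[OF measurable_fst, of "\<lambda>w. w k" ?W borel L]
          measurable_component_singleton[of k "{..<K}" "\<lambda>_. std_normal_distribution"] that
        unfolding eq by auto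
      then have [measurable]: "(\<lambda>p. fst p k) \<in> borel_measurable (?W \<Otimes>\<^sub>M L)" if "k \<in> {..<K}" for k
        using that by auto
      show ?thesis unfolding split_beta by measurable
    qed
    show "(\<lambda>w. \<integral>x. iexp (\<Sum>k<K. (a * w k) * Z k x) \<partial>L) \<in> borel_measurable ?W"
      by measurable
    have "integrable (?W \<Otimes>\<^sub>M L) (\<lambda>(w, x). iexp (\<Sum>k<K. (a * w k) * Z k x))"
      by (rule WL.integrable_const_bound[where B=1]) (auto simp: split_beta)
    from WL.Fubini_integral[OF this]
    have "(\<integral>w. (\<integral>x. iexp (\<Sum>k<K. (a * w k) * Z k x) \<partial>L) \<partial>?W)
       = (\<integral>x. (\<integral>w. iexp (\<Sum>k<K. (a * w k) * Z k x) \<partial>?W) \<partial>L)" by simp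
    also have "\<dots> = (\<integral>x. complex_of_real (exp (- (a\<^sup>2 / 2 * (\<Sum>k<K. (Z k x)\<^sup>2)))) \<partial>L)"
      unfolding gaussian_randomization by (simp add: sum_distrib_left mult_ac)
    finally show "complex_of_real (\<integral>x. exp (- (real m * (\<Sum>k<K. (Z k x)\<^sup>2))) \<partial>L)
      = (\<integral>w. (\<integral>x. iexp (\<Sum>k<K. (a * w k) * Z k x) \<partial>L) \<partial>?W)" by (simp add: a2)
  qed
  have bound: "norm (\<integral>x. iexp (h x) \<partial>L) \<le> 1" if L: "prob_space L" and [measurable]: "h \<in> borel_measurable L"
    for L :: "'c measure" and h
  proof -
    interpret L: prob_space L by fact
    have "norm (\<integral>x. iexp (h x) \<partial>L) \<le> (\<integral>x. norm (iexp (h x)) \<partial>L)" by (rule integral_norm_bound)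
    then show ?thesis by (simp add: L.prob_space)
  qed
  have "(\<lambda>n. \<integral>w. (\<integral>x. iexp (\<Sum>k<K. (a * w k) * U n k x) \<partial>M n) \<partial>?W)
     \<longlonglongrightarrow> (\<integral>w. (\<integral>x. iexp (\<Sum>k<K. (a * w k) * V k x) \<partial>N) \<partial>?W)"
  proof (rule integral_dominated_convergence[where w="\<lambda>_. 1"])
    show "AE w in ?W. (\<lambda>n. \<integral>x. iexp (\<Sum>k<K. (a * w k) * U n k x) \<partial>M n)
        \<longlonglongrightarrow> (\<integral>x. iexp (\<Sum>k<K. (a * w k) * V k x) \<partial>N)"
      by (intro AE_I2 lim)
    show "AE w in ?W. norm (\<integral>x. iexp (\<Sum>k<K. (a * w k) * U n k x) \<partial>M n) \<le> 1" for n
      by (intro AE_I2 bound M) measurable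
  qed (rule meas[OF N V] meas[OF M U] | simp)+
  then show ?thesis
    unfolding swap[OF M U, symmetric] swap[OF N V, symmetric] by (simp only: tendsto_of_real_iff)
qed

section \<open>Orthonormal expansions and compact operators\<close>

lemma square_summable_tail:
  assumes "summable (\<lambda>k. (a k)\<^sup>2 :: real)" "0 < e"
  shows "\<exists>N. \<forall>m\<ge>N. \<forall>n. (\<Sum>k\<in>{m..<n}. (a k)\<^sup>2) < e"
proof -
  obtain N where N: "\<And>m n. m \<ge> N \<Longrightarrow> norm (sum (\<lambda>k. (a k)\<^sup>2) {m..<n}) < e"
    using assms unfolding summable_Cauchy by blast
  then show ?thesis by (intro exI[of _ N]) (auto simp: abs_less_iff)
qed

context
  fixes hb :: "nat \<Rightarrow> 'h::{real_inner,complete_space}"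
  assumes onb: "padded_onb hb"
begin

lemma padded_onb_orthogonal: "j \<noteq> k \<Longrightarrow> inner (hb j) (hb k) = 0"
  and padded_onb_unit_or_zero: "norm (hb k) = 1 \<or> hb k = 0"
  and padded_onb_expansion: "(\<lambda>k. inner x (hb k) *\<^sub>R hb k) sums x"
  using onb by (auto simp: padded_onb_def)

text \<open>Treats unit vectors and padding uniformly: the factor is 1 at a unit vector, and at a
  padding zero the coefficient of \<open>x\<close> vanishes as well.\<close>

lemma padded_onb_inner_self: "inner x (hb k) * inner (hb k) (hb k) = inner x (hb k)"
  using padded_onb_unit_or_zero[of k] by (auto simp: norm_eq_1)

lemma padded_onb_norm_le_1: "norm (hb k) \<le> 1"
  using padded_onb_unit_or_zero[of k] by auto

lemma padded_onb_inner_sums: "(\<lambda>k. inner x (hb k) * inner y (hb k)) sums inner x y"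
  using bounded_linear.sums[OF bounded_linear_inner_right padded_onb_expansion, of y x]
  by (simp add: mult.commute inner_commute)

lemma padded_onb_parseval: "(\<lambda>k. (inner x (hb k))\<^sup>2) sums (norm x)\<^sup>2"
  using padded_onb_inner_sums[of x x] by (simp only: power2_eq_square[symmetric] power2_norm_eq_inner)

lemma padded_onb_eqI:
  assumes "\<And>k. inner x (hb k) = inner y (hb k)" shows "x = y"
  using padded_onb_expansion[of x] padded_onb_expansion[of y] assms sums_unique2 by auto

lemma padded_onb_inner_sum:
  "inner (\<Sum>k\<in>I. a k *\<^sub>R hb k) (hb j) = (if finite I \<and> j \<in> I then a j * inner (hb j) (hb j) else 0)"
proof (cases "finite I")
  case True
  have "inner (\<Sum>k\<in>I. a k *\<^sub>R hb k) (hb j) = (\<Sum>k\<in>I. if k = j then a j * inner (hb j) (hb j) else 0)"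
    unfolding inner_sum_left by (rule sum.cong) (auto simp: padded_onb_orthogonal)
  then show ?thesis using True by simp
qed simp

text \<open>Only an inequality, because a coefficient that sits on a padding zero contributes to the
  right side alone.\<close>

lemma padded_onb_norm_sum_le:
  assumes "finite I" shows "(norm (\<Sum>k\<in>I. a k *\<^sub>R hb k))\<^sup>2 \<le> (\<Sum>k\<in>I. (a k)\<^sup>2)"
proof -
  have "(norm (\<Sum>k\<in>I. a k *\<^sub>R hb k))\<^sup>2 = (\<Sum>j\<in>I. a j * inner (\<Sum>k\<in>I. a k *\<^sub>R hb k) (hb j))"
    by (simp add: power2_norm_eq_inner inner_sum_right)
  also have "\<dots> = (\<Sum>j\<in>I. (a j)\<^sup>2 * (norm (hb j))\<^sup>2)"
    unfolding padded_onb_inner_sum using assms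
    by (intro sum.cong) (auto simp: power2_norm_eq_inner power2_eq_square[of "a _"])
  also have "\<dots> \<le> (\<Sum>j\<in>I. (a j)\<^sup>2 * 1)"
    by (intro sum_mono mult_left_mono) (auto intro: power_le_one padded_onb_norm_le_1)
  finally show ?thesis by simp
qed

lemma padded_onb_summable:
  assumes "summable (\<lambda>k. (a k)\<^sup>2)" shows "summable (\<lambda>k. a k *\<^sub>R hb k)"
proof -
  have "Cauchy (\<lambda>n. \<Sum>k<n. a k *\<^sub>R hb k)"
  proof (rule metric_CauchyI)
    fix e :: real assume e: "0 < e"
    then obtain N where N: "\<And>m n. m \<ge> N \<Longrightarrow> (\<Sum>k\<in>{m..<n}. (a k)\<^sup>2) < e\<^sup>2"
      using square_summable_tail[OF assms, of "e\<^sup>2"] by auto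
    have *: "dist (\<Sum>k<m. a k *\<^sub>R hb k) (\<Sum>k<n. a k *\<^sub>R hb k) < e" if "N \<le> m" "m \<le> n" for m n
    proof -
      have "(\<Sum>k<n. a k *\<^sub>R hb k) - (\<Sum>k<m. a k *\<^sub>R hb k) = (\<Sum>k\<in>{m..<n}. a k *\<^sub>R hb k)"
        using sum_diff_nat_ivl[of 0 m n "\<lambda>k. a k *\<^sub>R hb k"] that by (simp add: lessThan_atLeast0)
      then have "(dist (\<Sum>k<m. a k *\<^sub>R hb k) (\<Sum>k<n. a k *\<^sub>R hb k))\<^sup>2 = (norm (\<Sum>k\<in>{m..<n}. a k *\<^sub>R hb k))\<^sup>2"
        by (metis dist_norm dist_commute)
      also have "\<dots> < e\<^sup>2" using padded_onb_norm_sum_le[of "{m..<n}" a] N[of m n] that by simp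
      finally show ?thesis using e by (simp add: power2_less_imp_less)
    qed
    show "\<exists>M. \<forall>m\<ge>M. \<forall>n\<ge>M. dist (\<Sum>k<m. a k *\<^sub>R hb k) (\<Sum>k<n. a k *\<^sub>R hb k) < e"
    proof (intro exI[of _ N] allI impI)
      fix m n assume mn: "N \<le> m" "N \<le> n"
      show "dist (\<Sum>k<m. a k *\<^sub>R hb k) (\<Sum>k<n. a k *\<^sub>R hb k) < e"
        using *[OF mn(1), of n] *[OF mn(2), of m] by (cases "m \<le> n") (auto simp: dist_commute)
    qed
  qed
  then have "convergent (\<lambda>n. \<Sum>k<n. a k *\<^sub>R hb k)" by (rule Cauchy_convergent)
  then show ?thesis by (simp add: summable_iff_convergent)
qed

lemma padded_onb_inner_suminf:
  assumes "summable (\<lambda>k. a k *\<^sub>R hb k)"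
  shows "inner (\<Sum>k. a k *\<^sub>R hb k) (hb j) = a j * inner (hb j) (hb j)"
proof -
  have "(\<lambda>k. a k *\<^sub>R hb k) sums (\<Sum>k. a k *\<^sub>R hb k)" using assms by (rule summable_sums)
  from bounded_linear.sums[OF bounded_linear_inner_left this, of "hb j"]
  have "(\<lambda>k. a k * inner (hb k) (hb j)) sums inner (\<Sum>k. a k *\<^sub>R hb k) (hb j)" by simp
  moreover have "(\<lambda>k. a k * inner (hb k) (hb j)) = (\<lambda>k. if k = j then a k * inner (hb k) (hb j) else 0)"
    by (auto simp: padded_onb_orthogonal)
  then have "(\<lambda>k. a k * inner (hb k) (hb j)) sums (a j * inner (hb j) (hb j))"
    using sums_single[of j "\<lambda>k. a k * inner (hb k) (hb j)"] by simp
  ultimately show ?thesis by (rule sums_unique2)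
qed

lemma padded_onb_norm_tail:
  "(\<lambda>K. \<Sum>k<K. inner x (hb k) *\<^sub>R hb k) \<longlonglongrightarrow> x"
  using padded_onb_expansion[of x] by (simp add: sums_def)

context
  fixes \<beta> :: "nat \<Rightarrow> real"
  assumes beta: "\<And>k. 0 < \<beta> k" "\<And>k. \<beta> k \<le> 1"
begin

lemma Gamma_coeff_le: "(\<beta> k * inner h (hb k))\<^sup>2 \<le> (inner h (hb k))\<^sup>2"
  unfolding power_mult_distrib using beta[of k]
  by (intro mult_left_le_one_le) (auto intro: power_le_one)

lemma Gamma_summable: "summable (\<lambda>k. (\<beta> k * inner h (hb k)) *\<^sub>R hb k)"
  by (rule padded_onb_summable, rule summable_comparison_test'[OF sums_summable[OF padded_onb_parseval[of h]], of 0])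
     (use Gamma_coeff_le in auto)

lemma inner_Gamma_hb [simp]: "inner (Gamma \<beta> hb h) (hb k) = \<beta> k * inner h (hb k)"
  unfolding Gamma_def padded_onb_inner_suminf[OF Gamma_summable]
  using padded_onb_inner_self[of h k] by (simp add: mult.assoc)

lemma inner_Gamma_commute: "inner (Gamma \<beta> hb x) y = inner x (Gamma \<beta> hb y)"
proof -
  have "(\<lambda>k. inner (Gamma \<beta> hb x) (hb k) * inner y (hb k)) sums inner (Gamma \<beta> hb x) y"
    by (rule padded_onb_inner_sums)
  moreover have "(\<lambda>k. inner x (hb k) * inner (Gamma \<beta> hb y) (hb k)) sums inner x (Gamma \<beta> hb y)"
    by (rule padded_onb_inner_sums)
  ultimately show ?thesis by (intro sums_unique2) (simp_all add: mult_ac)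
qed

lemma norm_Gamma_le: "norm (Gamma \<beta> hb h) \<le> norm h"
proof -
  have "(norm (Gamma \<beta> hb h))\<^sup>2 \<le> (norm h)\<^sup>2"
    by (rule sums_le[OF _ padded_onb_parseval padded_onb_parseval]) (use Gamma_coeff_le in simp)
  then show ?thesis by (rule power2_le_imp_le) simp
qed

text \<open>Every weight is positive, so no coordinate is lost. This is what keeps the shift of the
  limit law nonzero when the pathwise derivative is nonzero.\<close>

lemma Gamma_eq_0: "Gamma \<beta> hb h = 0 \<Longrightarrow> h = 0"
  by (rule padded_onb_eqI) (metis beta(1) inner_Gamma_hb inner_zero_left less_irrefl mult_eq_0_iff)

end

end

text \<open>A Hilbert cube. It is closed, and it is totally bounded because the tails of its points
  are uniformly small while the truncations lie in a finite-dimensional compact set. It will contain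
  the image of the unit ball under the covariance operator.\<close>

lemma compact_coordinate_box:
  fixes hb :: "nat \<Rightarrow> 'h::{real_inner,complete_space}"
  assumes onb: "padded_onb hb" and B: "summable (\<lambda>k. (B k)\<^sup>2)"
  shows "compact {x. \<forall>k. \<bar>inner x (hb k)\<bar> \<le> B k}" (is "compact ?Q")
proof -
  define S where "S N = {\<Sum>k<N. c k *\<^sub>R hb k |c. \<forall>k. \<bar>c k\<bar> \<le> B k}" for N :: nat
  have compS: "\<exists>T. compact T \<and> S N \<subseteq> T" for N
  proof (induction N)
    case 0
    show ?case by (intro exI[of _ "{0}"]) (auto simp: S_def)
  next
    case (Suc N)
    then obtain T where T: "compact T" "S N \<subseteq> T" by blast
    have "compact ((\<lambda>t. t *\<^sub>R hb N) ` {- B N..B N})"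
      by (intro compact_continuous_image continuous_intros) auto
    from compact_sums[OF T(1) this]
    have "compact {x + y |x y. x \<in> T \<and> y \<in> (\<lambda>t. t *\<^sub>R hb N) ` {- B N..B N}}" .
    moreover have "S (Suc N) \<subseteq> {x + y |x y. x \<in> T \<and> y \<in> (\<lambda>t. t *\<^sub>R hb N) ` {- B N..B N}}"
    proof
      fix z assume "z \<in> S (Suc N)"
      then obtain c where c: "z = (\<Sum>k<N. c k *\<^sub>R hb k) + c N *\<^sub>R hb N" "\<forall>k. \<bar>c k\<bar> \<le> B k"
        by (auto simp: S_def)
      have "(\<Sum>k<N. c k *\<^sub>R hb k) \<in> T" using T(2) c(2) by (auto simp: S_def)
      moreover have "c N \<in> {- B N..B N}" using c(2) by (auto simp: abs_le_iff minus_le_iff)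
      ultimately show "z \<in> {x + y |x y. x \<in> T \<and> y \<in> (\<lambda>t. t *\<^sub>R hb N) ` {- B N..B N}}"
        using c(1) by blast
    qed
    ultimately show ?case by blast
  qed
  have "closed ?Q"
    by (intro closed_Collect_all closed_Collect_le continuous_intros)
  moreover have "\<exists>F. finite F \<and> ?Q \<subseteq> (\<Union>x\<in>F. ball x e)" if e: "e > 0" for e :: real
  proof -
    \<comment> \<open>A tail of norm at most \<open>e/4\<close> and a net of radius
      \<open>e/2\<close> for the truncated points together stay below \<open>e\<close>.\<close>
    obtain N where N: "\<And>n. (\<Sum>k\<in>{N..<n}. (B k)\<^sup>2) < (e/4)\<^sup>2"
      using square_summable_tail[OF B, of "(e/4)\<^sup>2"] e by auto
    obtain T where T: "compact T" "S N \<subseteq> T" using compS by blast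
    obtain F where F: "finite F" "T \<subseteq> (\<Union>x\<in>F. ball x (e/2))"
      using T(1) e unfolding compact_eq_totally_bounded by (meson half_gt_zero)
    have "?Q \<subseteq> (\<Union>x\<in>F. ball x e)"
    proof
      fix x assume x: "x \<in> ?Q"
      let ?p = "\<lambda>n. \<Sum>k<n. inner x (hb k) *\<^sub>R hb k"
      have "?p N \<in> T" using T(2) x by (auto simp: S_def)
      then obtain y where y: "y \<in> F" "dist y (?p N) < e/2" using F(2) by auto
      have "dist (?p n) (?p N) \<le> e/4" if n: "n \<ge> N" for n
      proof -
        have "?p n - ?p N = (\<Sum>k\<in>{N..<n}. inner x (hb k) *\<^sub>R hb k)"
          using sum_diff_nat_ivl[of 0 N n "\<lambda>k. inner x (hb k) *\<^sub>R hb k"] n by (simp add: lessThan_atLeast0)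
        then have "(dist (?p n) (?p N))\<^sup>2 \<le> (\<Sum>k\<in>{N..<n}. (inner x (hb k))\<^sup>2)"
          using padded_onb_norm_sum_le[OF onb, of "{N..<n}" "\<lambda>k. inner x (hb k)"] by (simp add: dist_norm)
        also have "\<dots> \<le> (\<Sum>k\<in>{N..<n}. (B k)\<^sup>2)"
          by (rule sum_mono) (use x in \<open>auto intro: abs_le_square_iff[THEN iffD1] order_trans[OF _ abs_ge_self]\<close>)
        also have "\<dots> \<le> (e/4)\<^sup>2" using N[of n] by simp
        finally show ?thesis by (rule power2_le_imp_le) (use e in simp)
      qed
      then have "dist x (?p N) \<le> e/4"
        by (intro LIMSEQ_le_const2[OF tendsto_dist[OF padded_onb_norm_tail[OF onb, of x] tendsto_const]]) auto
      then have "dist y x < e" using y(2) dist_triangle[of y x "?p N"] dist_commute[of x "?p N"] e by linarith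
      then show "x \<in> (\<Union>x\<in>F. ball x e)" using y(1) by auto
    qed
    then show ?thesis using F(1) by blast
  qed
  ultimately show ?thesis unfolding compact_eq_totally_bounded complete_eq_closed by blast
qed

text \<open>Linearity is not assumed: testing against all vectors, it follows from symmetry
  (\<open>C_add\<close>, \<open>C_scaleR\<close>). Compactness is encoded by one compact set that
  contains the image of the unit ball, the form in which convergent subsequences are
  extracted.\<close>

locale compact_positive_operator =
  fixes C :: "'h::{real_inner,complete_space} \<Rightarrow> 'h" and Q :: "'h set" and c :: real
  assumes selfadj: "inner (C x) y = inner x (C y)"
    and pos: "0 \<le> inner (C x) x"
    and bounded: "norm (C x) \<le> c * norm x"
    and compact_Q: "compact Q"
    and ball_into_Q: "norm x \<le> 1 \<Longrightarrow> C x \<in> Q"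
begin

lemma C_add: "C (x + y) = C x + C y"
proof -
  have "inner (C (x + y)) z = inner (C x + C y) z" for z
    by (simp only: selfadj inner_add_left)
  then show ?thesis by (metis vector_eq_ldot inner_commute)
qed

lemma C_scaleR: "C (t *\<^sub>R x) = t *\<^sub>R C x"
proof -
  have "inner (C (t *\<^sub>R x)) z = inner (t *\<^sub>R C x) z" for z
    by (simp only: selfadj inner_scaleR_left)
  then show ?thesis by (metis vector_eq_ldot inner_commute)
qed

lemma bounded_linear_C: "bounded_linear C"
  by (rule bounded_linear_intro[where K=c]) (use bounded in \<open>auto simp: C_add C_scaleR mult.commute\<close>)

lemma C_0 [simp]: "C 0 = 0"
  using C_scaleR[of 0 0] by simp

lemma C_diff: "C (x - y) = C x - C y"
  by (rule linear_diff[OF bounded_linear.linear[OF bounded_linear_C]])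

text \<open>Power iteration: the normalized iterates of \<open>C\<close> on \<open>d\<close> accumulate at an eigenvector.\<close>
lemma ex_eigenvector:
  assumes Cd: "C d \<noteq> 0"
  shows "\<exists>e r. norm e = 1 \<and> 0 < r \<and> C e = r *\<^sub>R e \<and> inner d e \<noteq> 0 \<and> norm (C d) \<le> r * norm d \<and>
    (\<forall>w \<mu>. C w = \<mu> *\<^sub>R w \<longrightarrow> inner d w = 0 \<longrightarrow> inner e w = 0)"
proof -
  define v where "v n = (C ^^ n) d" for n
  have v0: "v 0 = d" and vS: "v (Suc n) = C (v n)" for n by (simp_all add: v_def)
  have vv: "inner (v (Suc (Suc n))) (v n) = (norm (v (Suc n)))\<^sup>2" for n
    by (simp add: vS selfadj power2_norm_eq_inner)
  have v1: "v (Suc n) \<noteq> 0" for n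
  proof (induction n)
    case 0 then show ?case using Cd by (simp add: vS v0)
  next
    case (Suc n) then show ?case using vv[of n] by auto
  qed
  have vn0: "v n \<noteq> 0" for n using v1[of n] by (auto simp: vS)
  define a where "a n = norm (v n)" for n
  have a: "a n > 0" for n using vn0 by (simp add: a_def)
  \<comment> \<open>By symmetry and Cauchy-Schwarz the norms of the iterates are log-convex. The
    growth ratios \<open>r\<close> therefore increase; being bounded by \<open>c\<close>, they
    converge.\<close>
  have a2: "(a (Suc n))\<^sup>2 \<le> a n * a (Suc (Suc n))" for n
    using vv[of n] norm_cauchy_schwarz[of "v (Suc (Suc n))" "v n"] by (simp add: a_def mult.commute)
  define r where "r n = a (Suc n) / a n" for n
  have r: "r n > 0" for n using a by (simp add: r_def)
  have rinc: "r n \<le> r (Suc n)" for n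
    using a2[of n] a[of n] a[of "Suc n"] by (simp add: r_def frac_le_eq divide_simps power2_eq_square mult.commute)
  have rc: "r n \<le> c" for n
    using bounded[of "v n"] a[of n] by (simp add: r_def a_def vS divide_simps)
  obtain R where R: "r \<longlonglongrightarrow> R" "\<And>n. r n \<le> R"
    using incseq_convergent[of r c] rinc rc by (auto intro: incseq_SucI)
  have R0: "R > 0" using r[of 0] R(2)[of 0] by simp
  define u where "u n = (1 / a n) *\<^sub>R v n" for n
  have nu: "norm (u n) = 1" for n using a[of n] by (simp add: u_def a_def)
  have Cu: "C (u n) = r n *\<^sub>R u (Suc n)" for n
    using a[of n] a[of "Suc n"] by (simp add: u_def C_scaleR vS r_def)
  \<comment> \<open>Normalized iterates two steps apart have inner product
    \<open>r n / r (Suc n)\<close>, which tends to 1. Hence \<open>u (n+2) - u n\<close> tends to 0,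
    and a limit point of \<open>u\<close> is fixed, up to the factor \<open>R * R\<close>, by the
    square of \<open>C\<close>.\<close>
  have uu: "(norm (u (Suc (Suc n)) - u n))\<^sup>2 = 2 - 2 * (r n / r (Suc n))" for n
  proof -
    have "inner (u (Suc (Suc n))) (u n) = (a (Suc n))\<^sup>2 / (a (Suc (Suc n)) * a n)"
      using vv[of n] by (simp add: u_def a_def)
    also have "\<dots> = r n / r (Suc n)"
      using a[of n] a[of "Suc n"] a[of "Suc (Suc n)"] by (simp add: r_def power2_eq_square)
    finally have *: "inner (u (Suc (Suc n))) (u n) = r n / r (Suc n)" .
    have **: "inner (u k) (u k) = 1" for k using nu[of k] by (simp add: norm_eq_1)
    have "(norm (u (Suc (Suc n)) - u n))\<^sup>2 = 2 - 2 * inner (u (Suc (Suc n))) (u n)"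
      by (simp add: power2_norm_eq_inner inner_diff_left inner_diff_right ** inner_commute)
    then show ?thesis by (simp add: *)
  qed
  have "(\<lambda>n. 2 - 2 * (r n / r (Suc n))) \<longlonglongrightarrow> 2 - 2 * (R / R)"
    by (intro tendsto_intros R(1) LIMSEQ_Suc) (use R0 in auto)
  then have "(\<lambda>n. (norm (u (Suc (Suc n)) - u n))\<^sup>2) \<longlonglongrightarrow> 0" using R0 by (simp add: uu)
  then have "(\<lambda>n. sqrt ((norm (u (Suc (Suc n)) - u n))\<^sup>2)) \<longlonglongrightarrow> sqrt 0" by (rule tendsto_real_sqrt)
  then have ud: "(\<lambda>n. u (Suc (Suc n)) - u n) \<longlonglongrightarrow> 0" by (simp add: tendsto_norm_zero_iff)
  have "C (u n) \<in> Q" for n using ball_into_Q nu by simp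
  then obtain l f where f: "strict_mono f" and l: "(\<lambda>n. C (u (f n))) \<longlonglongrightarrow> l"
    using compact_Q[unfolded compact_def, rule_format, of "\<lambda>n. C (u n)"] by (auto simp: o_def)
  define e where "e = (1 / R) *\<^sub>R l"
  define g where "g n = Suc (f n)" for n
  have gm: "strict_mono g" using f by (simp add: strict_mono_def g_def)
  have sub: "X \<longlonglongrightarrow> x \<Longrightarrow> (\<lambda>n. X (g n)) \<longlonglongrightarrow> x" for X :: "nat \<Rightarrow> 'x::topological_space" and x
    using LIMSEQ_subseq_LIMSEQ[OF _ gm, of X x] by (simp add: o_def)
  have "(\<lambda>n. (1 / r (f n)) *\<^sub>R C (u (f n))) \<longlonglongrightarrow> e"
    unfolding e_def using LIMSEQ_subseq_LIMSEQ[OF R(1) f] R0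
    by (intro tendsto_intros l) (auto simp: o_def)
  moreover have "(1 / r (f n)) *\<^sub>R C (u (f n)) = u (g n)" for n using r[of "f n"] by (simp add: Cu g_def)
  ultimately have ue: "(\<lambda>n. u (g n)) \<longlonglongrightarrow> e" by simp
  have ne: "norm e = 1" using tendsto_norm[OF ue] LIMSEQ_unique[OF _ tendsto_const] nu by simp
  have "(\<lambda>n. C (C (u (g n)))) \<longlonglongrightarrow> C (C e)"
    by (intro bounded_linear.tendsto[OF bounded_linear_C] ue)
  moreover have "(\<lambda>n. C (C (u (g n)))) \<longlonglongrightarrow> (R * R) *\<^sub>R e"
  proof -
    have "C (C (u n)) = (r n * r (Suc n)) *\<^sub>R ((u (Suc (Suc n)) - u n) + u n)" for n
      by (simp add: Cu C_scaleR)
    moreover have "(\<lambda>n. (r (g n) * r (Suc (g n))) *\<^sub>R ((u (Suc (Suc (g n))) - u (g n)) + u (g n)))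
       \<longlonglongrightarrow> (R * R) *\<^sub>R (0 + e)"
      by (intro tendsto_intros ue sub[OF R(1)] sub[OF LIMSEQ_Suc[OF R(1)]] sub[OF ud])
    ultimately show ?thesis by simp
  qed
  ultimately have CCe: "C (C e) = (R * R) *\<^sub>R e" by (rule LIMSEQ_unique)
  \<comment> \<open>Positivity passes from the square to \<open>C\<close> itself:
    \<open>C e - R *\<^sub>R e\<close> is an eigenvector for the eigenvalue \<open>-R\<close> or
    zero, and a negative eigenvalue is impossible.\<close>
  have Ce: "C e = R *\<^sub>R e"
  proof -
    define h where "h = C e - R *\<^sub>R e"
    have "C h = - R *\<^sub>R h" by (simp add: h_def C_diff C_scaleR CCe algebra_simps)
    then have "0 \<le> - R * inner h h" using pos[of h] by simp
    then have "inner h h = 0" using R0 inner_ge_zero[of h] by (simp add: mult_le_0_iff order_antisym)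
    then show ?thesis by (simp add: h_def)
  qed
  \<comment> \<open>Against an eigenvector \<open>w\<close> the iterates only rescale the number
    \<open>inner d w\<close>. So orthogonality of \<open>d\<close> to \<open>w\<close> is inherited
    by \<open>e\<close>, while \<open>inner d e = 0\<close> would contradict
    \<open>inner e e = 1\<close>.\<close>
  have iv: "inner (v n) w = \<mu> ^ n * inner d w" if "C w = \<mu> *\<^sub>R w" for n w \<mu>
    by (induction n) (simp_all add: v0 vS selfadj that)
  have "(\<lambda>n. inner (u (g n)) e) \<longlonglongrightarrow> inner e e" by (intro tendsto_intros ue)
  then have lim: "(\<lambda>n. inner (u (g n)) e) \<longlonglongrightarrow> 1" using ne by (simp add: norm_eq_1)
  have de: "inner d e \<noteq> 0"
  proof
    assume "inner d e = 0"
    then have "inner (u n) e = 0" for n using iv[OF Ce, of n] by (simp add: u_def)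
    then show False using lim LIMSEQ_unique[OF tendsto_const] by fastforce
  qed
  have "inner e w = 0" if "C w = \<mu> *\<^sub>R w" "inner d w = 0" for w \<mu>
  proof -
    have "inner (u n) w = 0" for n using iv[OF that(1), of n] that(2) by (simp add: u_def)
    moreover have "(\<lambda>n. inner (u (g n)) w) \<longlonglongrightarrow> inner e w" by (intro tendsto_intros ue)
    ultimately show ?thesis by (simp add: LIMSEQ_const_iff)
  qed
  moreover have "norm (C d) \<le> R * norm d"
    using R(2)[of 0] a[of 0] by (simp add: r_def a_def vS v0 divide_simps)
  ultimately show ?thesis using ne R0 Ce de by blast
qed

text \<open>Each step removes from the residual its component along an eigenvector found by power
  iteration from that residual. The Krylov clause of \<open>ex_eigenvector\<close> makes these
  eigenvectors mutually orthogonal, so the residuals form a Cauchy sequence by Pythagoras. If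
  \<open>C\<close> did not vanish at their limit, the eigenvalues would stay away from 0, and the
  images of orthonormal vectors would be uniformly separated inside a compact set.\<close>

lemma deflation:
  fixes d0 :: 'h
  shows "\<exists>d d'. d 0 = d0 \<and> d \<longlonglongrightarrow> d' \<and> C d' = 0 \<and>
    (\<forall>j. if C (d j) = 0 then d (Suc j) = d j
       else \<exists>e r. norm e = 1 \<and> 0 < r \<and> C e = r *\<^sub>R e \<and> inner (d j) e \<noteq> 0 \<and> d (Suc j) = d j - inner (d j) e *\<^sub>R e)"
proof -
  \<comment> \<open>Once \<open>C x = 0\<close>, the pair (0, 0) is prescribed. The choice is then
    total and the recursion stands still from that index on.\<close>
  define P where "P x p \<longleftrightarrow> (case p of (e, r) \<Rightarrow> if C x = 0 then e = 0 \<and> r = 0 else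
      norm e = 1 \<and> 0 < r \<and> C e = r *\<^sub>R e \<and> inner x e \<noteq> 0 \<and> norm (C x) \<le> r * norm x \<and>
    (\<forall>w \<mu>. C w = \<mu> *\<^sub>R w \<longrightarrow> inner x w = 0 \<longrightarrow> inner e w = 0))" for x and p :: "'h \<times> real"
  have "\<exists>p. P x p" for x
    using ex_eigenvector[of x] unfolding P_def by (cases "C x = 0") auto
  then obtain F where F: "\<And>x. P x (F x)" by metis
  define d where "d = rec_nat d0 (\<lambda>_ x. x - inner x (fst (F x)) *\<^sub>R fst (F x))"
  define e where "e j = fst (F (d j))" for j
  define r where "r j = snd (F (d j))" for j
  have d0: "d 0 = d0" and dS: "d (Suc j) = d j - inner (d j) (e j) *\<^sub>R e j" for j
    by (simp_all add: d_def e_def)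
  have P: "P (d j) (e j, r j)" for j using F[of "d j"] by (simp add: e_def r_def)
  have stop: "e j = 0" "r j = 0" if "C (d j) = 0" for j using P[of j] that by (auto simp: P_def)
  have go: "norm (e j) = 1" "0 < r j" "inner (d j) (e j) \<noteq> 0" "norm (C (d j)) \<le> r j * norm (d j)"
    if "C (d j) \<noteq> 0" for j using P[of j] that by (auto simp: P_def)
  have eig: "C (e j) = r j *\<^sub>R e j" for j using P[of j] by (auto simp: P_def split: if_splits)
  have kry: "inner (e j) w = 0" if "C w = \<mu> *\<^sub>R w" "inner (d j) w = 0" for j w \<mu>
    using P[of j] that by (auto simp: P_def split: if_splits)
  have self: "inner (d j) (e j) * inner (e j) (e j) = inner (d j) (e j)" for j
    using stop(1)[of j] go(1)[of j] by (cases "C (d j) = 0") (auto simp: norm_eq_1)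
  have orth: "\<forall>i<j. inner (d j) (e i) = 0" for j
  proof (induction j)
    case (Suc j)
    have "inner (e j) (e i) = 0" if "i < j" for i using kry[OF eig] Suc that by blast
    with Suc show ?case by (auto simp: dS inner_diff_left less_Suc_eq self)
  qed simp
  have orthe: "inner (e j) (e i) = 0" if "i < j" for i j using kry[OF eig] orth that by blast
  \<comment> \<open>Later residuals arise from earlier ones by removing components to which they are
    orthogonal, so they are orthogonal projections of the earlier ones. Hence distances are
    differences of squared norms.\<close>
  have dd: "inner (d n) (d m) = (norm (d n))\<^sup>2" if "m \<le> n" for m n
    using that
  proof (induction m rule: inc_induct)
    case (step m)
    have "inner (d n) (d (Suc m)) = inner (d n) (d m)" using orth[of n] step(2) by (simp add: dS inner_diff_right)
    then show ?case using step by simp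
  qed (simp add: power2_norm_eq_inner)
  have dist2: "(dist (d m) (d n))\<^sup>2 = (norm (d m))\<^sup>2 - (norm (d n))\<^sup>2" if "m \<le> n" for m n
  proof -
    have "(dist (d m) (d n))\<^sup>2 = (norm (d m))\<^sup>2 - 2 * inner (d n) (d m) + (norm (d n))\<^sup>2"
      by (simp add: dist_norm power2_norm_eq_inner inner_diff_left inner_diff_right inner_commute[of "d m" "d n"])
    then show ?thesis using dd[OF that] by simp
  qed
  have dec: "(norm (d n))\<^sup>2 \<le> (norm (d m))\<^sup>2" if "m \<le> n" for m n
    using dist2[OF that] zero_le_power2[of "dist (d m) (d n)"] by linarith
  have "convergent (\<lambda>n. (norm (d n))\<^sup>2)"
  proof -
    have "decseq (\<lambda>n. (norm (d n))\<^sup>2)" using dec by (auto simp: decseq_def)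
    then show ?thesis by (rule decseq_convergent[of _ 0]) (auto intro: convergentI)
  qed
  then have cau: "Cauchy (\<lambda>n. (norm (d n))\<^sup>2)" by (rule convergent_Cauchy)
  have "Cauchy d"
  proof (rule metric_CauchyI)
    fix \<epsilon> :: real assume ep: "0 < \<epsilon>"
    then obtain N where N: "\<And>m n. m \<ge> N \<Longrightarrow> n \<ge> N \<Longrightarrow> dist ((norm (d m))\<^sup>2) ((norm (d n))\<^sup>2) < \<epsilon>\<^sup>2"
      using metric_CauchyD[OF cau, of "\<epsilon>\<^sup>2"] by auto
    have *: "dist (d m) (d n) < \<epsilon>" if "N \<le> m" "m \<le> n" for m n
    proof -
      have "(dist (d m) (d n))\<^sup>2 < \<epsilon>\<^sup>2" using N[of m n] that unfolding dist2[OF that(2)] dist_real_def by linarith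
      then show ?thesis using ep by (simp add: power2_less_imp_less)
    qed
    show "\<exists>M. \<forall>m\<ge>M. \<forall>n\<ge>M. dist (d m) (d n) < \<epsilon>"
    proof (intro exI[of _ N] allI impI)
      fix m n assume mn: "N \<le> m" "N \<le> n"
      show "dist (d m) (d n) < \<epsilon>"
        using *[OF mn(1), of n] *[OF mn(2), of m] by (cases "m \<le> n") (auto simp: dist_commute)
    qed
  qed
  then obtain d' where d': "d \<longlonglongrightarrow> d'" using Cauchy_convergent convergent_def by blast
  have "C d' = 0"
  proof (rule ccontr)
    assume nz: "C d' \<noteq> 0"
    have "(\<lambda>j. norm (C (d j))) \<longlonglongrightarrow> norm (C d')"
      by (intro tendsto_norm bounded_linear.tendsto[OF bounded_linear_C] d')
    from order_tendstoD(1)[OF this, of "norm (C d') / 2"] nz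
    obtain J where J: "\<And>j. j \<ge> J \<Longrightarrow> norm (C (d j)) > norm (C d') / 2"
      unfolding eventually_sequentially by auto
    have nzj: "C (d j) \<noteq> 0" if "j \<ge> J" for j using J[OF that] by auto
    \<comment> \<open>For large \<open>j\<close>, \<open>norm (C (d j))\<close> exceeds half of
      \<open>norm (C d')\<close>. It is at most \<open>r j * norm (d j)\<close>, and
      \<open>norm (d j) \<le> norm (d 0)\<close>; so \<open>\<kappa>\<close> is a lower bound for
      the eigenvalues.\<close>
    define \<kappa> where "\<kappa> = norm (C d') / 2 / norm (d 0)"
    have d00: "norm (d 0) > 0"
    proof (rule ccontr)
      assume "\<not> norm (d 0) > 0"
      then have "(norm (d J))\<^sup>2 \<le> 0" using dec[of 0 J] by simp
      then have "d J = 0" by simp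
      then show False using nzj[of J] by simp
    qed
    have kpos: "\<kappa> > 0" using nz d00 by (simp add: \<kappa>_def)
    have rk: "r j > \<kappa>" if "j \<ge> J" for j
    proof -
      have "norm (d j) \<le> norm (d 0)" by (rule power2_le_imp_le[OF dec[OF le0] norm_ge_zero])
      then have "r j * norm (d j) \<le> r j * norm (d 0)" using go(2)[OF nzj[OF that]] by simp
      then have "norm (C d') / 2 < r j * norm (d 0)" using go(4)[OF nzj[OF that]] J[OF that] by linarith
      then show ?thesis using d00 by (simp add: \<kappa>_def divide_simps mult.commute)
    qed
    have "C (e (J + j)) \<in> Q" for j using ball_into_Q go(1)[OF nzj] by simp
    then obtain l f where f: "strict_mono f" and l: "(\<lambda>n. C (e (J + f n))) \<longlonglongrightarrow> l"
      using compact_Q[unfolded compact_def, rule_format, of "\<lambda>n. C (e (J + n))"] by (auto simp: o_def)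
    from metric_CauchyD[OF LIMSEQ_imp_Cauchy[OF l] kpos]
    obtain n where n: "dist (C (e (J + f n))) (C (e (J + f (Suc n)))) < \<kappa>" using le_SucI[OF order_refl] by blast
    have lt: "J + f n < J + f (Suc n)" using f by (simp add: strict_mono_Suc_iff)
    let ?i = "J + f n" and ?j = "J + f (Suc n)"
    \<comment> \<open>Orthonormal eigenvectors have orthogonal images of lengths \<open>r ?i\<close>
      and \<open>r ?j\<close>, so the images are at least \<open>\<kappa>\<close> apart and no
      subsequence of them is Cauchy.\<close>
    have "(dist (C (e ?i)) (C (e ?j)))\<^sup>2 = (r ?i)\<^sup>2 * inner (e ?i) (e ?i) + (r ?j)\<^sup>2 * inner (e ?j) (e ?j)"
      using orthe[OF lt] unfolding dist_norm power2_norm_eq_inner eig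
      by (simp add: inner_diff_left inner_diff_right inner_commute power2_eq_square)
    also have "\<dots> = (r ?i)\<^sup>2 + (r ?j)\<^sup>2" using go(1)[OF nzj, of ?i] go(1)[OF nzj, of ?j] by (simp add: norm_eq_1)
    also have "\<dots> \<ge> \<kappa>\<^sup>2" using rk[of ?i] kpos by (auto intro: add_increasing2 power_mono)
    finally have "\<kappa> \<le> dist (C (e ?i)) (C (e ?j))" by (rule power2_le_imp_le) simp
    then show False using n by simp
  qed
  moreover have "\<forall>j. if C (d j) = 0 then d (Suc j) = d j
       else \<exists>e r. norm e = 1 \<and> 0 < r \<and> C e = r *\<^sub>R e \<and> inner (d j) e \<noteq> 0 \<and> d (Suc j) = d j - inner (d j) e *\<^sub>R e"
    proof (intro allI)
    fix j
    show "if C (d j) = 0 then d (Suc j) = d j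
       else \<exists>e r. norm e = 1 \<and> 0 < r \<and> C e = r *\<^sub>R e \<and> inner (d j) e \<noteq> 0 \<and> d (Suc j) = d j - inner (d j) e *\<^sub>R e"
      using stop[of j] go[of j] eig[of j] dS[of j] by (cases "C (d j) = 0") auto
  qed
  ultimately show ?thesis using d0 d' by blast
qed

end

section \<open>Products of densities\<close>

lemma integrable_mult_square:
  fixes f g :: "'a \<Rightarrow> real"
  assumes [measurable]: "f \<in> borel_measurable M" "g \<in> borel_measurable M"
    and i: "integrable M (\<lambda>x. (f x)\<^sup>2)" "integrable M (\<lambda>x. (g x)\<^sup>2)"
  shows "integrable M (\<lambda>x. f x * g x)"
proof (rule Bochner_Integration.integrable_bound[where f="\<lambda>x. (f x)\<^sup>2 + (g x)\<^sup>2"])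
  have "\<bar>a * b\<bar> \<le> a\<^sup>2 + b\<^sup>2" for a b :: real
  proof -
    have "2 * \<bar>a * b\<bar> \<le> \<bar>a\<bar>\<^sup>2 + \<bar>b\<bar>\<^sup>2" using sum_squares_bound[of "\<bar>a\<bar>" "\<bar>b\<bar>"] by (simp add: abs_mult)
    then show ?thesis by simp
  qed
  then show "AE x in M. norm (f x * g x) \<le> norm ((f x)\<^sup>2 + (g x)\<^sup>2)" by simp
qed (use i in auto)

lemma integrable_add_square:
  fixes f g :: "'a \<Rightarrow> real"
  assumes [measurable]: "f \<in> borel_measurable M" "g \<in> borel_measurable M"
    and i: "integrable M (\<lambda>x. (f x)\<^sup>2)" "integrable M (\<lambda>x. (g x)\<^sup>2)"
  shows "integrable M (\<lambda>x. (f x + g x)\<^sup>2)"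
  unfolding power2_sum using i integrable_mult_square[OF assms] by (simp add: mult.assoc)

lemma integral_cauchy_schwarz:
  fixes f g :: "'a \<Rightarrow> real"
  assumes [measurable]: "f \<in> borel_measurable M" "g \<in> borel_measurable M"
    and i: "integrable M (\<lambda>x. (f x)\<^sup>2)" "integrable M (\<lambda>x. (g x)\<^sup>2)"
  shows "(\<integral>x. \<bar>f x * g x\<bar> \<partial>M) \<le> sqrt (\<integral>x. (f x)\<^sup>2 \<partial>M) * sqrt (\<integral>x. (g x)\<^sup>2 \<partial>M)"
proof -
  define A B I where "A = (\<integral>x. (f x)\<^sup>2 \<partial>M)" and "B = (\<integral>x. (g x)\<^sup>2 \<partial>M)" and "I = (\<integral>x. \<bar>f x * g x\<bar> \<partial>M)"
  have ifg: "integrable M (\<lambda>x. \<bar>f x * g x\<bar>)" using integrable_mult_square[OF assms] by simp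
  have A: "A \<ge> 0" and B: "B \<ge> 0" and I: "I \<ge> 0" by (simp_all add: A_def B_def I_def)
  have quad: "0 \<le> t\<^sup>2 * A - 2 * t * I + B" for t
  proof -
    have "0 \<le> (\<integral>x. (t * \<bar>f x\<bar> - \<bar>g x\<bar>)\<^sup>2 \<partial>M)" by simp
    also have "(\<lambda>x. (t * \<bar>f x\<bar> - \<bar>g x\<bar>)\<^sup>2) = (\<lambda>x. t\<^sup>2 * (f x)\<^sup>2 - 2 * t * \<bar>f x * g x\<bar> + (g x)\<^sup>2)"
      by (simp add: power2_diff power_mult_distrib abs_mult algebra_simps)
    also have "(\<integral>x. t\<^sup>2 * (f x)\<^sup>2 - 2 * t * \<bar>f x * g x\<bar> + (g x)\<^sup>2 \<partial>M) = t\<^sup>2 * A - 2 * t * I + B"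
      unfolding A_def B_def I_def using i ifg by (simp add: mult.assoc)
    finally show ?thesis .
  qed
  have "I\<^sup>2 \<le> A * B"
  proof (cases "A = 0")
    case True
    have "I = 0"
    proof (rule ccontr)
      assume "I \<noteq> 0"
      \<comment> \<open>With \<open>A = 0\<close> the quadratic is affine in \<open>t\<close>, and
        this choice gives it the value -1. For \<open>A\<close> nonzero the minimizer
        \<open>I / A\<close> is used below.\<close>
      then show False using quad[of "(B + 1) / (2 * I)"] True by simp
    qed
    then show ?thesis using True by simp
  next
    case False
    then show ?thesis using quad[of "I / A"] A
      by (simp add: power2_eq_square field_simps)
  qed
  then have "I \<le> sqrt (A * B)" by (rule real_le_rsqrt)
  then show ?thesis by (simp add: A_def B_def I_def real_sqrt_mult)
qed

lemma PiM_density: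
  fixes M :: "'a measure"
  assumes M: "sigma_finite_measure M" and I: "finite I" and f [measurable]: "f \<in> borel_measurable M"
    and P: "prob_space (density M f)"
  shows "PiM I (\<lambda>_. density M f) = density (PiM I (\<lambda>_. M)) (\<lambda>\<omega>. \<Prod>i\<in>I. f (\<omega> i))"
proof -
  interpret M: product_sigma_finite "\<lambda>_. M" using M by (simp add: product_sigma_finite_def)
  interpret P: prob_space "density M f" by fact
  interpret P: product_sigma_finite "\<lambda>_. density M f" by unfold_locales
  have "density (PiM I (\<lambda>_. M)) (\<lambda>\<omega>. \<Prod>i\<in>I. f (\<omega> i)) = PiM I (\<lambda>_. density M f)"
  proof (rule P.PiM_eqI[OF I])
    show "sets (density (PiM I (\<lambda>_. M)) (\<lambda>\<omega>. \<Prod>i\<in>I. f (\<omega> i))) = sets (PiM I (\<lambda>_. density M f))"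
      by (simp cong: sets_PiM_cong)
  next
    fix A assume A: "\<And>i. i \<in> I \<Longrightarrow> A i \<in> sets (density M f)"
    have [measurable]: "A i \<in> sets M" if "i \<in> I" for i using A[OF that] by simp
    have "emeasure (density (PiM I (\<lambda>_. M)) (\<lambda>\<omega>. \<Prod>i\<in>I. f (\<omega> i))) (Pi\<^sub>E I A)
       = (\<integral>\<^sup>+\<omega>. (\<Prod>i\<in>I. f (\<omega> i)) * indicator (Pi\<^sub>E I A) \<omega> \<partial>PiM I (\<lambda>_. M))"
      by (rule emeasure_density) (use I A in \<open>auto intro!: sets_PiM_I_finite\<close>)
    also have "\<dots> = (\<integral>\<^sup>+\<omega>. (\<Prod>i\<in>I. f (\<omega> i) * indicator (A i) (\<omega> i)) \<partial>PiM I (\<lambda>_. M))"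
    proof (rule nn_integral_cong)
      fix \<omega> assume "\<omega> \<in> space (PiM I (\<lambda>_. M))"
      then have ext: "\<omega> \<in> extensional I" by (simp add: space_PiM PiE_def)
      have "indicator (Pi\<^sub>E I A) \<omega> = (\<Prod>i\<in>I. indicator (A i) (\<omega> i) :: ennreal)"
      proof (cases "\<omega> \<in> Pi\<^sub>E I A")
        case True then show ?thesis by (auto simp: indicator_def PiE_def Pi_def intro!: prod.neutral[symmetric])
      next
        case False
        then obtain i where "i \<in> I" "\<omega> i \<notin> A i" using ext by (auto simp: PiE_def Pi_def)
        then have "(\<Prod>i\<in>I. indicator (A i) (\<omega> i) :: ennreal) = 0" using I by (intro prod_zero bexI[of _ i]) auto
        then show ?thesis using False by simp
      qed
      then show "(\<Prod>i\<in>I. f (\<omega> i)) * indicator (Pi\<^sub>E I A) \<omega> = (\<Prod>i\<in>I. f (\<omega> i) * indicator (A i) (\<omega> i))"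
        by (simp add: prod.distrib)
    qed
    also have "\<dots> = (\<Prod>i\<in>I. \<integral>\<^sup>+x. f x * indicator (A i) x \<partial>M)"
      by (rule M.product_nn_integral_prod) (use I in auto)
    also have "\<dots> = (\<Prod>i\<in>I. emeasure (density M f) (A i))"
      by (intro prod.cong refl) (simp add: emeasure_density)
    finally show "emeasure (density (PiM I (\<lambda>_. M)) (\<lambda>\<omega>. \<Prod>i\<in>I. f (\<omega> i))) (Pi\<^sub>E I A)
       = (\<Prod>i\<in>I. emeasure (density M f) (A i))" .
  qed
  then show ?thesis by simp
qed

section \<open>Comparison of n-fold product measures through their densities\<close>

context sigma_finite_measure
begin

lemma prob_density_integrable:
  assumes [measurable]: "p \<in> borel_measurable M" and p: "\<And>x. 0 \<le> p x" and P: "prob_space (density M p)"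
  shows "integrable M p" "(\<integral>x. p x \<partial>M) = 1"
proof -
  interpret P: prob_space "density M p" by fact
  have 1: "(\<integral>\<^sup>+x. ennreal (p x) \<partial>M) = 1"
    using P.emeasure_space_1 by (simp add: emeasure_density cong: nn_integral_cong)
  show i: "integrable M p" by (rule integrableI_nn_integral_finite[where x=1]) (use p 1 in auto)
  show "(\<integral>x. p x \<partial>M) = 1" using p 1 by (subst integral_eq_nn_integral) auto
qed

lemma product_density_integral:
  fixes F :: "(nat \<Rightarrow> 'a) \<Rightarrow> real"
  assumes p [measurable]: "p \<in> borel_measurable M" and p0: "\<And>x. 0 \<le> p x" and P: "prob_space (density M p)"
    and F [measurable]: "F \<in> borel_measurable (PiM {..<n} (\<lambda>_. M))"
  shows "(\<integral>\<omega>. F \<omega> \<partial>PiM {..<n} (\<lambda>_. density M p)) = (\<integral>\<omega>. (\<Prod>i<n. p (\<omega> i)) * F \<omega> \<partial>PiM {..<n} (\<lambda>_. M))"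
    "integrable (PiM {..<n} (\<lambda>_. M)) (\<lambda>\<omega>. \<Prod>i<n. p (\<omega> i))"
    "(\<integral>\<omega>. (\<Prod>i<n. p (\<omega> i)) \<partial>PiM {..<n} (\<lambda>_. M)) = 1"
proof -
  interpret M: product_sigma_finite "\<lambda>_. M" by unfold_locales
  have "PiM {..<n} (\<lambda>_. density M p) = density (PiM {..<n} (\<lambda>_. M)) (\<lambda>\<omega>. \<Prod>i<n. ennreal (p (\<omega> i)))"
    by (rule PiM_density) (use P sigma_finite_measure_axioms in auto)
  also have "(\<lambda>\<omega>. \<Prod>i<n. ennreal (p (\<omega> i))) = (\<lambda>\<omega>. ennreal (\<Prod>i<n. p (\<omega> i)))"
    using p0 by (simp add: prod_ennreal)
  finally have eq: "PiM {..<n} (\<lambda>_. density M p) = density (PiM {..<n} (\<lambda>_. M)) (\<lambda>\<omega>. ennreal (\<Prod>i<n. p (\<omega> i)))" .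
  have [measurable]: "(\<lambda>\<omega>. \<Prod>i<n. p (\<omega> i)) \<in> borel_measurable (PiM {..<n} (\<lambda>_. M))"
    by measurable
  show "(\<integral>\<omega>. F \<omega> \<partial>PiM {..<n} (\<lambda>_. density M p)) = (\<integral>\<omega>. (\<Prod>i<n. p (\<omega> i)) * F \<omega> \<partial>PiM {..<n} (\<lambda>_. M))"
    unfolding eq by (subst integral_density) (use p0 in \<open>auto intro!: prod_nonneg\<close>)
  note ip = prob_density_integrable[OF p p0 P]
  show "integrable (PiM {..<n} (\<lambda>_. M)) (\<lambda>\<omega>. \<Prod>i<n. p (\<omega> i))"
    by (rule M.product_integrable_prod) (use ip in auto)
  show "(\<integral>\<omega>. (\<Prod>i<n. p (\<omega> i)) \<partial>PiM {..<n} (\<lambda>_. M)) = 1"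
    by (subst M.product_integral_prod) (use ip in auto)
qed

text \<open>The Hellinger affinity \<open>\<integral> sqrt (p q)\<close> tensorizes, which bounds the total variation distance of
  the \<open>n\<close>-fold products by \<open>n\<close> times the squared Hellinger distance of the factors.\<close>
lemma product_hellinger_bound:
  fixes F :: "(nat \<Rightarrow> 'a) \<Rightarrow> real"
  assumes p [measurable]: "p \<in> borel_measurable M" and p0: "\<And>x. 0 \<le> p x" and P: "prob_space (density M p)"
    and q [measurable]: "q \<in> borel_measurable M" and q0: "\<And>x. 0 \<le> q x" and Q: "prob_space (density M q)"
    and F [measurable]: "F \<in> borel_measurable (PiM {..<n} (\<lambda>_. M))" and F01: "\<And>\<omega>. 0 \<le> F \<omega>" "\<And>\<omega>. F \<omega> \<le> 1"
    and \<kappa>: "0 < \<kappa>"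
  shows "(\<integral>\<omega>. F \<omega> \<partial>PiM {..<n} (\<lambda>_. density M p)) \<le> (\<integral>\<omega>. F \<omega> \<partial>PiM {..<n} (\<lambda>_. density M q))
     + real n * (\<integral>x. (sqrt (p x) - sqrt (q x))\<^sup>2 \<partial>M) / (2 * \<kappa>) + 2 * \<kappa>"
proof -
  interpret S: product_sigma_finite "\<lambda>_. M" by unfold_locales
  let ?N = "PiM {..<n} (\<lambda>_. M)"
  define a b where "a \<omega> = sqrt (\<Prod>i<n. p (\<omega> i))" and "b \<omega> = sqrt (\<Prod>i<n. q (\<omega> i))" for \<omega> :: "nat \<Rightarrow> 'a"
  have [measurable]: "a \<in> borel_measurable ?N" "b \<in> borel_measurable ?N" unfolding a_def b_def by measurable
  have a2: "(a \<omega>)\<^sup>2 = (\<Prod>i<n. p (\<omega> i))" and b2: "(b \<omega>)\<^sup>2 = (\<Prod>i<n. q (\<omega> i))" for \<omega>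
    using p0 q0 by (simp_all add: a_def b_def prod_nonneg)
  note ip = product_density_integral[OF p p0 P F] and iq = product_density_integral[OF q q0 Q F]
  have ia: "integrable ?N (\<lambda>\<omega>. (a \<omega>)\<^sup>2)" "(\<integral>\<omega>. (a \<omega>)\<^sup>2 \<partial>?N) = 1" using ip by (simp_all add: a2)
  have ib: "integrable ?N (\<lambda>\<omega>. (b \<omega>)\<^sup>2)" "(\<integral>\<omega>. (b \<omega>)\<^sup>2 \<partial>?N) = 1" using iq by (simp_all add: b2)
  have iab: "integrable ?N (\<lambda>\<omega>. a \<omega> * b \<omega>)" by (rule integrable_mult_square) (use ia ib in auto)
  note jp = prob_density_integrable[OF p p0 P] and jq = prob_density_integrable[OF q q0 Q]
  have jpq: "integrable M (\<lambda>x. sqrt (p x) * sqrt (q x))"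
    by (rule integrable_mult_square) (use jp jq p0 q0 in auto)
  define h where "h = (\<integral>x. (sqrt (p x) - sqrt (q x))\<^sup>2 \<partial>M)"
  have h: "(\<integral>x. sqrt (p x) * sqrt (q x) \<partial>M) = 1 - h/2"
  proof -
    have "h = (\<integral>x. p x + q x - 2 * (sqrt (p x) * sqrt (q x)) \<partial>M)"
      unfolding h_def power2_diff using p0 q0 by (simp add: mult.assoc)
    also have "\<dots> = 2 - 2 * (\<integral>x. sqrt (p x) * sqrt (q x) \<partial>M)"
      using jp jq jpq by simp
    finally show ?thesis by (simp add: field_simps)
  qed
  have h2: "1 - h/2 \<ge> 0" unfolding h[symmetric] using p0 q0 by simp
  have sqrt_prod: "sqrt (\<Prod>i<m. f i) = (\<Prod>i<m. sqrt (f i))" for f :: "nat \<Rightarrow> real" and m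
    by (induction m) (auto simp: real_sqrt_mult)
  have "(\<integral>\<omega>. a \<omega> * b \<omega> \<partial>?N) = (\<integral>\<omega>. (\<Prod>i<n. sqrt (p (\<omega> i)) * sqrt (q (\<omega> i))) \<partial>?N)"
    by (simp add: a_def b_def sqrt_prod prod.distrib)
  also have "\<dots> = (1 - h/2) ^ n"
    by (subst S.product_integral_prod) (use jpq h in auto)
  \<comment> \<open>Bernoulli's inequality applies since \<open>1 - h/2\<close> is an integral of a
    nonnegative function. It turns the tensorized affinity into the linear bound
    \<open>n * h / 2\<close>.\<close>
  also have "(1 - h/2) ^ n \<ge> 1 - real n * (h/2)"
    using Bernoulli_inequality[of "- (h/2)" n] h2 by simp
  finally have ab: "(\<integral>\<omega>. a \<omega> * b \<omega> \<partial>?N) \<ge> 1 - real n * (h/2)" .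
  \<comment> \<open>A weighted arithmetic-geometric bound in place of Cauchy-Schwarz for the product
    of \<open>a - b\<close> and \<open>a + b\<close>. The first factor contributes at most
    \<open>n * h\<close> and the second at most 4; the weight \<open>\<kappa>\<close> stays free for
    the caller.\<close>
  have amgm: "x * y \<le> x\<^sup>2 / (2 * \<kappa>) + \<kappa> / 2 * y\<^sup>2" for x y :: real
  proof -
    have "0 \<le> (x - \<kappa> * y)\<^sup>2 / (2 * \<kappa>)" using \<kappa> by simp
    also have "\<dots> = x\<^sup>2 / (2 * \<kappa>) + \<kappa> / 2 * y\<^sup>2 - x * y" using \<kappa> by (simp add: power2_eq_square field_simps)
    finally show ?thesis by simp
  qed
  have sq: "(a \<omega> - b \<omega>)\<^sup>2 = (a \<omega>)\<^sup>2 + (b \<omega>)\<^sup>2 - 2 * (a \<omega> * b \<omega>)"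
    "(a \<omega> + b \<omega>)\<^sup>2 = (a \<omega>)\<^sup>2 + (b \<omega>)\<^sup>2 + 2 * (a \<omega> * b \<omega>)" for \<omega>
    by (simp_all add: power2_diff power2_sum)
  have i1: "integrable ?N (\<lambda>\<omega>. (a \<omega> - b \<omega>)\<^sup>2)" and i2: "integrable ?N (\<lambda>\<omega>. (a \<omega> + b \<omega>)\<^sup>2)"
    unfolding sq using ia ib iab by auto
  have ipF: "integrable ?N (\<lambda>\<omega>. (\<Prod>i<n. p (\<omega> i)) * F \<omega>)"
    by (rule Bochner_Integration.integrable_bound[OF ip(2)])
       (use F01 p0 in \<open>auto simp: abs_mult prod_nonneg intro!: mult_right_le_one_le\<close>)
  have iqF: "integrable ?N (\<lambda>\<omega>. (\<Prod>i<n. q (\<omega> i)) * F \<omega>)"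
    by (rule Bochner_Integration.integrable_bound[OF iq(2)])
       (use F01 q0 in \<open>auto simp: abs_mult prod_nonneg intro!: mult_right_le_one_le\<close>)
  have "(\<integral>\<omega>. F \<omega> \<partial>PiM {..<n} (\<lambda>_. density M p)) - (\<integral>\<omega>. F \<omega> \<partial>PiM {..<n} (\<lambda>_. density M q))
     = (\<integral>\<omega>. ((\<Prod>i<n. p (\<omega> i)) - (\<Prod>i<n. q (\<omega> i))) * F \<omega> \<partial>?N)"
    unfolding ip(1) iq(1) using ipF iqF by (simp add: left_diff_distrib)
  also have "\<dots> \<le> (\<integral>\<omega>. (a \<omega> - b \<omega>)\<^sup>2 / (2 * \<kappa>) + \<kappa> / 2 * (a \<omega> + b \<omega>)\<^sup>2 \<partial>?N)"
  proof (rule integral_mono)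
    show "integrable ?N (\<lambda>\<omega>. ((\<Prod>i<n. p (\<omega> i)) - (\<Prod>i<n. q (\<omega> i))) * F \<omega>)"
      using ipF iqF by (simp add: left_diff_distrib)
    show "integrable ?N (\<lambda>\<omega>. (a \<omega> - b \<omega>)\<^sup>2 / (2 * \<kappa>) + \<kappa> / 2 * (a \<omega> + b \<omega>)\<^sup>2)"
      using i1 i2 by simp
    fix \<omega>
    have "((\<Prod>i<n. p (\<omega> i)) - (\<Prod>i<n. q (\<omega> i))) * F \<omega> \<le> \<bar>(\<Prod>i<n. p (\<omega> i)) - (\<Prod>i<n. q (\<omega> i))\<bar> * 1"
      by (intro mult_mono) (use F01 in auto)
    also have "\<dots> = \<bar>a \<omega> - b \<omega>\<bar> * \<bar>a \<omega> + b \<omega>\<bar>"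
      unfolding a2[symmetric] b2[symmetric] by (simp add: abs_mult[symmetric] power2_eq_square algebra_simps)
    also have "\<dots> \<le> \<bar>a \<omega> - b \<omega>\<bar>\<^sup>2 / (2 * \<kappa>) + \<kappa> / 2 * \<bar>a \<omega> + b \<omega>\<bar>\<^sup>2" by (rule amgm)
    finally show "((\<Prod>i<n. p (\<omega> i)) - (\<Prod>i<n. q (\<omega> i))) * F \<omega> \<le> (a \<omega> - b \<omega>)\<^sup>2 / (2 * \<kappa>) + \<kappa> / 2 * (a \<omega> + b \<omega>)\<^sup>2"
      by simp
  qed
  also have "\<dots> = (\<integral>\<omega>. (a \<omega> - b \<omega>)\<^sup>2 \<partial>?N) / (2 * \<kappa>) + \<kappa> / 2 * (\<integral>\<omega>. (a \<omega> + b \<omega>)\<^sup>2 \<partial>?N)"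
    using i1 i2 by simp
  also have "(\<integral>\<omega>. (a \<omega> - b \<omega>)\<^sup>2 \<partial>?N) = 2 - 2 * (\<integral>\<omega>. a \<omega> * b \<omega> \<partial>?N)"
    unfolding sq using ia ib iab by simp
  also have "(\<integral>\<omega>. (a \<omega> + b \<omega>)\<^sup>2 \<partial>?N) = 2 + 2 * (\<integral>\<omega>. a \<omega> * b \<omega> \<partial>?N)"
    unfolding sq using ia ib iab by simp
  also have "(2 - 2 * (\<integral>\<omega>. a \<omega> * b \<omega> \<partial>?N)) / (2 * \<kappa>) \<le> real n * h / (2 * \<kappa>)"
    using ab \<kappa> by (intro divide_right_mono) auto
  also have "\<kappa> / 2 * (2 + 2 * (\<integral>\<omega>. a \<omega> * b \<omega> \<partial>?N)) \<le> \<kappa> / 2 * 4"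
  proof (intro mult_left_mono)
    have "0 \<le> (\<integral>\<omega>. (a \<omega> - b \<omega>)\<^sup>2 \<partial>?N)" by simp
    also have "\<dots> = 2 - 2 * (\<integral>\<omega>. a \<omega> * b \<omega> \<partial>?N)" unfolding sq using ia ib iab by simp
    finally show "2 + 2 * (\<integral>\<omega>. a \<omega> * b \<omega> \<partial>?N) \<le> 4" by simp
  qed (use \<kappa> in auto)
  finally show ?thesis by (simp add: h_def)
qed

text \<open>The factor \<open>(1 + c)^n\<close> is the second moment of the likelihood ratio when
  each factor has relative density \<open>1 + u\<close> with \<open>u\<close> centred and of variance \<open>c\<close>.\<close>
lemma product_tilt_bound:
  fixes F :: "(nat \<Rightarrow> 'a) \<Rightarrow> real"
  assumes p [measurable]: "p \<in> borel_measurable M" and p0: "\<And>x. 0 \<le> p x" and P: "prob_space (density M p)"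
    and u [measurable]: "u \<in> borel_measurable M" and u1: "\<And>x. \<bar>u x\<bar> \<le> 1"
    and um: "(\<integral>x. u x * p x \<partial>M) = 0"
    and F [measurable]: "F \<in> borel_measurable (PiM {..<n} (\<lambda>_. M))" and F01: "\<And>\<omega>. 0 \<le> F \<omega>" "\<And>\<omega>. F \<omega> \<le> 1"
    and \<kappa>: "0 < \<kappa>"
  shows "prob_space (density M (\<lambda>x. ennreal (p x * (1 + u x))))"
    "(\<integral>\<omega>. F \<omega> \<partial>PiM {..<n} (\<lambda>_. density M (\<lambda>x. ennreal (p x * (1 + u x)))))
      \<le> (\<integral>\<omega>. F \<omega> \<partial>PiM {..<n} (\<lambda>_. density M p)) / (2 * \<kappa>) + \<kappa> / 2 * (1 + (\<integral>x. (u x)\<^sup>2 * p x \<partial>M)) ^ n"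
proof -
  interpret S: product_sigma_finite "\<lambda>_. M" by unfold_locales
  let ?N = "PiM {..<n} (\<lambda>_. M)"
  let ?r = "\<lambda>x. p x * (1 + u x)"
  have r0: "0 \<le> ?r x" for x using p0[of x] u1[of x] by (intro mult_nonneg_nonneg) (auto simp: abs_le_iff)
  note jp = prob_density_integrable[OF p p0 P]
  have iu: "integrable M (\<lambda>x. u x * p x)"
    by (rule Bochner_Integration.integrable_bound[OF jp(1)])
       (use u1 p0 in \<open>auto simp: abs_mult intro!: mult_left_le_one_le\<close>)
  have iu2: "integrable M (\<lambda>x. (u x)\<^sup>2 * p x)"
    by (rule Bochner_Integration.integrable_bound[OF jp(1)])
       (use u1 p0 in \<open>auto simp: abs_mult abs_square_le_1 intro!: mult_left_le_one_le\<close>)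
  have ir: "integrable M ?r" "(\<integral>x. ?r x \<partial>M) = 1"
    using jp iu um by (simp_all add: distrib_left mult.commute)
  show R: "prob_space (density M ?r)"
    by (rule prob_spaceI) (use r0 ir in \<open>simp add: emeasure_density nn_integral_eq_integral cong: nn_integral_cong\<close>)
  define V where "V \<omega> = (\<Prod>i<n. 1 + u (\<omega> i))" for \<omega> :: "nat \<Rightarrow> 'a"
  define pp where "pp \<omega> = (\<Prod>i<n. p (\<omega> i))" for \<omega> :: "nat \<Rightarrow> 'a"
  have pp0: "pp \<omega> \<ge> 0" for \<omega> by (simp add: pp_def prod_nonneg p0)
  have [measurable]: "V \<in> borel_measurable ?N" "pp \<in> borel_measurable ?N" unfolding V_def pp_def by measurable
  have i2: "integrable M (\<lambda>x. p x * (1 + u x)\<^sup>2)" "(\<integral>x. p x * (1 + u x)\<^sup>2 \<partial>M) = 1 + (\<integral>x. (u x)\<^sup>2 * p x \<partial>M)"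
  proof -
    have eq: "(\<lambda>x. p x * (1 + u x)\<^sup>2) = (\<lambda>x. p x + 2 * (u x * p x) + (u x)\<^sup>2 * p x)"
      by (simp add: power2_sum algebra_simps)
    show "integrable M (\<lambda>x. p x * (1 + u x)\<^sup>2)" "(\<integral>x. p x * (1 + u x)\<^sup>2 \<partial>M) = 1 + (\<integral>x. (u x)\<^sup>2 * p x \<partial>M)"
      unfolding eq using jp iu iu2 um by simp_all
  qed
  have V2: "integrable ?N (\<lambda>\<omega>. pp \<omega> * (V \<omega>)\<^sup>2)"
    "(\<integral>\<omega>. pp \<omega> * (V \<omega>)\<^sup>2 \<partial>?N) = (1 + (\<integral>x. (u x)\<^sup>2 * p x \<partial>M)) ^ n"
  proof -
    have eq: "(\<lambda>\<omega>. pp \<omega> * (V \<omega>)\<^sup>2) = (\<lambda>\<omega>. \<Prod>i<n. p (\<omega> i) * (1 + u (\<omega> i))\<^sup>2)"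
      by (simp add: pp_def V_def prod.distrib prod_power_distrib)
    show "integrable ?N (\<lambda>\<omega>. pp \<omega> * (V \<omega>)\<^sup>2)" unfolding eq
      by (rule S.product_integrable_prod) (use i2 in auto)
    show "(\<integral>\<omega>. pp \<omega> * (V \<omega>)\<^sup>2 \<partial>?N) = (1 + (\<integral>x. (u x)\<^sup>2 * p x \<partial>M)) ^ n" unfolding eq
      by (subst S.product_integral_prod) (use i2 in auto)
  qed
  note ip = product_density_integral[OF p p0 P F, folded pp_def]
  have ipF: "integrable ?N (\<lambda>\<omega>. pp \<omega> * F \<omega>)"
    by (rule Bochner_Integration.integrable_bound[OF ip(2)])
       (use F01 pp0 in \<open>auto simp: abs_mult intro!: mult_right_le_one_le\<close>)
  have "(\<integral>\<omega>. F \<omega> \<partial>PiM {..<n} (\<lambda>_. density M ?r)) = (\<integral>\<omega>. pp \<omega> * (V \<omega> * F \<omega>) \<partial>?N)"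
    using product_density_integral(1)[OF _ r0 R F] by (simp add: pp_def V_def prod.distrib mult.assoc)
  also have "\<dots> \<le> (\<integral>\<omega>. pp \<omega> * F \<omega> / (2 * \<kappa>) + \<kappa> / 2 * (pp \<omega> * (V \<omega>)\<^sup>2) \<partial>?N)"
  proof (rule integral_mono')
    show "integrable ?N (\<lambda>\<omega>. pp \<omega> * F \<omega> / (2 * \<kappa>) + \<kappa> / 2 * (pp \<omega> * (V \<omega>)\<^sup>2))"
      using ipF V2 by simp
    fix \<omega>
    \<comment> \<open>The same weighted bound, now separating the likelihood ratio \<open>V\<close>
      from the test function. The square of \<open>F\<close> is at most \<open>F\<close>, so only
      its mean under the untilted law remains.\<close>
    have "V \<omega> * F \<omega> \<le> F \<omega> / (2 * \<kappa>) + \<kappa> / 2 * (V \<omega>)\<^sup>2"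
    proof -
      have "0 \<le> (F \<omega> - \<kappa> * V \<omega>)\<^sup>2 / (2 * \<kappa>)" using \<kappa> by simp
      also have "\<dots> = (F \<omega>)\<^sup>2 / (2 * \<kappa>) + \<kappa> / 2 * (V \<omega>)\<^sup>2 - V \<omega> * F \<omega>"
        using \<kappa> by (simp add: power2_eq_square field_simps)
      also have "(F \<omega>)\<^sup>2 / (2 * \<kappa>) \<le> F \<omega> / (2 * \<kappa>)"
        using F01[of \<omega>] \<kappa> by (intro divide_right_mono) (auto simp: power2_eq_square mult_left_le)
      finally show ?thesis by simp
    qed
    from mult_left_mono[OF this pp0[of \<omega>]]
    show "pp \<omega> * (V \<omega> * F \<omega>) \<le> pp \<omega> * F \<omega> / (2 * \<kappa>) + \<kappa> / 2 * (pp \<omega> * (V \<omega>)\<^sup>2)"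
      by (simp add: algebra_simps)
    show "0 \<le> pp \<omega> * F \<omega> / (2 * \<kappa>) + \<kappa> / 2 * (pp \<omega> * (V \<omega>)\<^sup>2)"
      using pp0[of \<omega>] F01(1)[of \<omega>] \<kappa> by (intro add_nonneg_nonneg mult_nonneg_nonneg divide_nonneg_nonneg) auto
  qed
  also have "\<dots> = (\<integral>\<omega>. F \<omega> \<partial>PiM {..<n} (\<lambda>_. density M p)) / (2 * \<kappa>) + \<kappa> / 2 * (1 + (\<integral>x. (u x)\<^sup>2 * p x \<partial>M)) ^ n"
    using ipF V2 ip(1) by simp
  finally show "(\<integral>\<omega>. F \<omega> \<partial>PiM {..<n} (\<lambda>_. density M ?r))
      \<le> (\<integral>\<omega>. F \<omega> \<partial>PiM {..<n} (\<lambda>_. density M p)) / (2 * \<kappa>) + \<kappa> / 2 * (1 + (\<integral>x. (u x)\<^sup>2 * p x \<partial>M)) ^ n" .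
qed

end

section \<open>Local alternatives\<close>

text \<open>With \<open>y = sqrt (1 + x)\<close> the remainder is exactly
  \<open>- (y - 1)\<^sup>2 / 2\<close>, while \<open>x = (y - 1) * (y + 1)\<close> and
  \<open>y + 1 \<ge> 1\<close>.\<close>

lemma sqrt_one_plus_remainder: "\<bar>x\<bar> \<le> 1 \<Longrightarrow> \<bar>sqrt (1 + x) - 1 - x / 2\<bar> \<le> x\<^sup>2 / 2" for x :: real
proof -
  assume x: "\<bar>x\<bar> \<le> 1"
  define y where "y = sqrt (1 + x)"
  have y: "y \<ge> 0" "y\<^sup>2 = 1 + x" using x by (auto simp: y_def)
  have x2: "x = (y - 1) * (y + 1)" using y by (simp add: power2_eq_square algebra_simps)
  have "y - 1 - x / 2 = - ((y - 1)\<^sup>2) / 2" using y by (simp add: power2_eq_square algebra_simps)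
  then have "\<bar>y - 1 - x / 2\<bar> = (y - 1)\<^sup>2 / 2" by simp
  also have "\<dots> \<le> (y - 1)\<^sup>2 * (y + 1)\<^sup>2 / 2"
    using mult_left_mono[of 1 "(y + 1)\<^sup>2" "(y - 1)\<^sup>2"] y(1) by (simp add: one_le_power)
  also have "\<dots> = x\<^sup>2 / 2" using x2 by (simp add: power_mult_distrib)
  finally show ?thesis by (simp add: y_def)
qed

text \<open>Both \<open>w n\<close> and \<open>exp (z / n)\<close> lie in the closed unit disc, the
  latter because \<open>Re z \<le> 0\<close>. Their \<open>n\<close>-th powers thus differ by at
  most \<open>n\<close> times their distance, which tends to 0. No complex logarithm is
  taken.\<close>

lemma complex_power_exp_limit:
  fixes w :: "nat \<Rightarrow> complex"
  assumes w: "\<And>n. norm (w n) \<le> 1" and z: "Re z \<le> 0" and lim: "(\<lambda>n. of_nat n * (w n - 1)) \<longlonglongrightarrow> z"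
  shows "(\<lambda>n. w n ^ n) \<longlonglongrightarrow> exp z"
proof -
  have e: "exp (z / of_nat n) ^ n = exp z" if "n > 0" for n
    using that by (simp add: exp_of_nat_mult[symmetric])
  have e1: "norm (exp (z / of_nat n)) \<le> 1" for n
    using z by (simp add: divide_nonpos_nonneg)
  have "((\<lambda>h. (exp (0 + h) - exp 0) / h) \<longlongrightarrow> exp (0::complex)) (at 0)"
    using DERIV_exp[of "0::complex"] unfolding DERIV_def .
  then have dl: "((\<lambda>h. (exp h - 1) / h) \<longlongrightarrow> (1::complex)) (at 0)" by simp
  have zl: "(\<lambda>n. of_nat n * (exp (z / of_nat n) - 1)) \<longlonglongrightarrow> z"
  proof (cases "z = 0")
    case False
    have "filterlim (\<lambda>n. z / of_nat n) (at 0) sequentially"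
      unfolding filterlim_at using False
      by (auto intro!: eventually_sequentiallyI[of 1] tendsto_divide_0[OF tendsto_const] tendsto_of_nat)
    from filterlim_compose[OF dl this]
    have "(\<lambda>n. z * ((exp (z / of_nat n) - 1) / (z / of_nat n))) \<longlonglongrightarrow> z * 1" by (intro tendsto_intros)
    moreover have "z * ((exp (z / of_nat n) - 1) / (z / of_nat n)) = of_nat n * (exp (z / of_nat n) - 1)" for n :: nat
      using False by simp
    ultimately show ?thesis by simp
  qed simp
  have "(\<lambda>n. norm (of_nat n * (w n - 1) - of_nat n * (exp (z / of_nat n) - 1))) \<longlonglongrightarrow> norm (z - z)"
    by (intro tendsto_intros lim zl)
  then have "(\<lambda>n. real n * norm (w n - exp (z / of_nat n))) \<longlonglongrightarrow> 0"
    by (simp add: right_diff_distrib[symmetric] norm_mult)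
  then have "(\<lambda>n. w n ^ n - exp (z / of_nat n) ^ n) \<longlonglongrightarrow> 0"
    by (rule Lim_null_comparison[rotated]) (use norm_power_diff[OF w e1] in auto)
  then have "(\<lambda>n. w n ^ n - exp z) \<longlonglongrightarrow> 0"
    by (rule Lim_transform_eventually[OF _ eventually_sequentiallyI[of 1]]) (simp add: e)
  then show ?thesis by (rule LIM_zero_cancel)
qed

text \<open>Quadratic mean differentiability along the scale \<open>1 / sqrt n\<close> only:
  \<open>qmd\<close> is the squared condition at that parameter, divided by its square. Every
  \<open>q n\<close> is a probability density, so early indices need no special care.\<close>

locale qmd_sequence = sigma_finite_measure M for M :: "'a measure" +
  fixes p :: "'a \<Rightarrow> real" and q :: "nat \<Rightarrow> 'a \<Rightarrow> real" and s :: "'a \<Rightarrow> real"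
  assumes p_meas [measurable]: "p \<in> borel_measurable M" and p_nonneg: "\<And>x. 0 \<le> p x"
    and p_prob: "prob_space (density M p)"
    and q_meas [measurable]: "\<And>n. q n \<in> borel_measurable M" and q_nonneg: "\<And>n x. 0 \<le> q n x"
    and q_prob: "\<And>n. prob_space (density M (q n))"
    and s_meas [measurable]: "s \<in> borel_measurable M" and s_L2: "integrable M (\<lambda>x. (s x)\<^sup>2 * p x)"
    and qmd: "(\<lambda>n. real n * (\<integral>x. (sqrt (q n x) - sqrt (p x) - s x * sqrt (p x) / (2 * sqrt (real n)))\<^sup>2 \<partial>M)) \<longlonglongrightarrow> 0"
begin

text \<open>The root densities satisfy \<open>sqrt q\<^sub>n = sqrt p + (v + r\<^sub>n) / sqrt n\<close>, where the remainder \<open>r\<^sub>n\<close>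
  tends to zero in \<open>L\<^sup>2\<close>.\<close>
definition v where "v x = s x * sqrt (p x) / 2"

definition r where "r n x = sqrt (real n) * (sqrt (q n x) - sqrt (p x)) - v x"

lemma v_meas [measurable]: "v \<in> borel_measurable M" and r_meas [measurable]: "r n \<in> borel_measurable M"
  unfolding v_def[abs_def] r_def[abs_def] by measurable

lemmas p_int = prob_density_integrable[OF p_meas p_nonneg p_prob]
lemmas q_int = prob_density_integrable[OF q_meas q_nonneg q_prob]

lemma v_L2: "integrable M (\<lambda>x. (v x)\<^sup>2)"
  using s_L2 p_nonneg by (simp add: v_def power_divide power_mult_distrib)

lemma sqrt_L2: "integrable M (\<lambda>x. (sqrt (p x))\<^sup>2)" "integrable M (\<lambda>x. (sqrt (q n x))\<^sup>2)"
  using p_int q_int p_nonneg q_nonneg by simp_all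

lemma r_L2: "integrable M (\<lambda>x. (r n x)\<^sup>2)"
proof -
  have "integrable M (\<lambda>x. (sqrt (q n x) + (- sqrt (p x)))\<^sup>2)"
    by (rule integrable_add_square) (use sqrt_L2 in auto)
  then have "integrable M (\<lambda>x. (sqrt (real n) * (sqrt (q n x) - sqrt (p x)))\<^sup>2)"
    by (simp add: power_mult_distrib)
  then have "integrable M (\<lambda>x. (sqrt (real n) * (sqrt (q n x) - sqrt (p x)) + (- v x))\<^sup>2)"
    by (intro integrable_add_square) (use v_L2 in auto)
  then show ?thesis by (simp add: r_def)
qed

lemma r_lim: "(\<lambda>n. \<integral>x. (r n x)\<^sup>2 \<partial>M) \<longlonglongrightarrow> 0"
proof (rule Lim_transform_eventually[OF qmd eventually_sequentiallyI[of 1]])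
  fix n :: nat assume n: "1 \<le> n"
  have "(r n x)\<^sup>2 = real n * (sqrt (q n x) - sqrt (p x) - s x * sqrt (p x) / (2 * sqrt (real n)))\<^sup>2" for x
  proof -
    have "r n x = sqrt (real n) * (sqrt (q n x) - sqrt (p x) - s x * sqrt (p x) / (2 * sqrt (real n)))"
      using n by (simp add: r_def v_def field_simps)
    then show ?thesis by (simp add: power_mult_distrib)
  qed
  then show "real n * (\<integral>x. (sqrt (q n x) - sqrt (p x) - s x * sqrt (p x) / (2 * sqrt (real n)))\<^sup>2 \<partial>M) = (\<integral>x. (r n x)\<^sup>2 \<partial>M)"
    by simp
qed

lemma sqrt_r_lim: "(\<lambda>n. sqrt (\<integral>x. (r n x)\<^sup>2 \<partial>M)) \<longlonglongrightarrow> 0"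
  using tendsto_real_sqrt[OF r_lim] by simp

text \<open>The square of the root expansion. In \<open>L\<^sup>1\<close> the four terms are of
  order \<open>n\<close>, \<open>sqrt n\<close>, o(\<open>sqrt n\<close>) and O(1); this ordering
  drives both the centring of the score and the characteristic function limit.\<close>

lemma q_expand:
  assumes "n \<ge> 1"
  shows "real n * q n x = real n * p x + sqrt (real n) * (s x * p x) + 2 * sqrt (real n) * (sqrt (p x) * r n x) + (v x + r n x)\<^sup>2"
proof -
  have e: "sqrt (real n) * sqrt (q n x) = sqrt (real n) * sqrt (p x) + (v x + r n x)"
    by (simp add: r_def algebra_simps)
  have "real n * q n x = (sqrt (real n) * sqrt (q n x))\<^sup>2" using q_nonneg by (simp add: power_mult_distrib)
  also have "\<dots> = (sqrt (real n) * sqrt (p x))\<^sup>2 + (v x + r n x)\<^sup>2 + 2 * (sqrt (real n) * sqrt (p x)) * (v x + r n x)"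
    unfolding e power2_sum ..
  also have "2 * (sqrt (real n) * sqrt (p x)) * (v x + r n x)
     = sqrt (real n) * (s x * (sqrt (p x) * sqrt (p x))) + 2 * sqrt (real n) * (sqrt (p x) * r n x)"
    by (simp add: v_def algebra_simps)
  finally show ?thesis using p_nonneg by (simp add: power_mult_distrib)
qed

lemma vr_L2: "integrable M (\<lambda>x. (v x + r n x)\<^sup>2)"
  by (rule integrable_add_square) (use v_L2 r_L2 in auto)

lemma sp_integrable: "integrable M (\<lambda>x. s x * p x)"
proof -
  have "integrable M (\<lambda>x. (s x * sqrt (p x)) * sqrt (p x))"
    by (rule integrable_mult_square) (use s_L2 sqrt_L2 p_nonneg in \<open>auto simp: power_mult_distrib\<close>)
  then show ?thesis using p_nonneg by (simp add: mult.assoc)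
qed

lemma pr_integrable: "integrable M (\<lambda>x. sqrt (p x) * r n x)"
  by (rule integrable_mult_square) (use sqrt_L2 r_L2 in auto)

lemma vr_bound: "(\<integral>x. (v x + r n x)\<^sup>2 \<partial>M) \<le> 2 * (\<integral>x. (v x)\<^sup>2 \<partial>M) + 2 * (\<integral>x. (r n x)\<^sup>2 \<partial>M)"
proof -
  have "(\<integral>x. (v x + r n x)\<^sup>2 \<partial>M) \<le> (\<integral>x. 2 * (v x)\<^sup>2 + 2 * (r n x)\<^sup>2 \<partial>M)"
  proof (rule integral_mono[OF vr_L2])
    show "(v x + r n x)\<^sup>2 \<le> 2 * (v x)\<^sup>2 + 2 * (r n x)\<^sup>2" for x
      using sum_squares_bound[of "v x" "r n x"] by (simp add: power2_sum)
  qed (use v_L2 r_L2 in auto)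
  then show ?thesis using v_L2 r_L2 by simp
qed

text \<open>Both densities have mass 1, so after integrating \<open>q_expand\<close> the leading
  terms cancel. Dividing by \<open>sqrt n\<close> leaves the mean of the score equal to a remainder
  that tends to 0.\<close>

lemma score_mean_zero: "(\<integral>x. s x * p x \<partial>M) = 0"
proof -
  have "(\<integral>x. s x * p x \<partial>M) = - 2 * (\<integral>x. sqrt (p x) * r n x \<partial>M) - (\<integral>x. (v x + r n x)\<^sup>2 \<partial>M) / sqrt (real n)"
    if n: "n \<ge> 1" for n
  proof -
    have "(\<integral>x. real n * q n x \<partial>M) = (\<integral>x. real n * p x + sqrt (real n) * (s x * p x)
        + 2 * sqrt (real n) * (sqrt (p x) * r n x) + (v x + r n x)\<^sup>2 \<partial>M)"
      by (simp add: q_expand[OF n])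
    also have "\<dots> = real n + sqrt (real n) * (\<integral>x. s x * p x \<partial>M)
        + 2 * sqrt (real n) * (\<integral>x. sqrt (p x) * r n x \<partial>M) + (\<integral>x. (v x + r n x)\<^sup>2 \<partial>M)"
      using p_int sp_integrable pr_integrable vr_L2 by simp
    finally have "sqrt (real n) * (\<integral>x. s x * p x \<partial>M) = - 2 * sqrt (real n) * (\<integral>x. sqrt (p x) * r n x \<partial>M) - (\<integral>x. (v x + r n x)\<^sup>2 \<partial>M)"
      using q_int by simp
    then show ?thesis using n by (simp add: field_simps)
  qed
  then have "\<bar>\<integral>x. s x * p x \<partial>M\<bar> \<le> 2 * sqrt (\<integral>x. (r n x)\<^sup>2 \<partial>M)
      + (2 * (\<integral>x. (v x)\<^sup>2 \<partial>M) + 2 * (\<integral>x. (r n x)\<^sup>2 \<partial>M)) * (1 / sqrt (real n))" if n: "n \<ge> 1" for n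
  proof -
    have "\<bar>\<integral>x. sqrt (p x) * r n x \<partial>M\<bar> \<le> (\<integral>x. \<bar>sqrt (p x) * r n x\<bar> \<partial>M)" by (rule integral_abs_bound)
    also have "\<dots> \<le> sqrt (\<integral>x. (sqrt (p x))\<^sup>2 \<partial>M) * sqrt (\<integral>x. (r n x)\<^sup>2 \<partial>M)"
      by (rule integral_cauchy_schwarz) (use sqrt_L2 r_L2 in auto)
    finally have 1: "\<bar>\<integral>x. sqrt (p x) * r n x \<partial>M\<bar> \<le> sqrt (\<integral>x. (r n x)\<^sup>2 \<partial>M)" using p_int p_nonneg by simp
    have 2: "(\<integral>x. (v x + r n x)\<^sup>2 \<partial>M) / sqrt (real n) \<le> (2 * (\<integral>x. (v x)\<^sup>2 \<partial>M) + 2 * (\<integral>x. (r n x)\<^sup>2 \<partial>M)) * (1 / sqrt (real n))"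
      using divide_right_mono[OF vr_bound, of "sqrt (real n)" n] by simp
    have 3: "0 \<le> (\<integral>x. (v x + r n x)\<^sup>2 \<partial>M) / sqrt (real n)" by simp
    show ?thesis using 1 2 3 \<open>\<And>n. n \<ge> 1 \<Longrightarrow> (\<integral>x. s x * p x \<partial>M) = _ n\<close>[OF n] by linarith
  qed
  moreover have "(\<lambda>n. 2 * sqrt (\<integral>x. (r n x)\<^sup>2 \<partial>M)
      + (2 * (\<integral>x. (v x)\<^sup>2 \<partial>M) + 2 * (\<integral>x. (r n x)\<^sup>2 \<partial>M)) * (1 / sqrt (real n))) \<longlonglongrightarrow> 2 * 0 + (2 * (\<integral>x. (v x)\<^sup>2 \<partial>M) + 2 * 0) * 0"
    by (intro tendsto_intros sqrt_r_lim r_lim real_tendsto_divide_at_top[where F=sequentially, OF tendsto_const]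
        filterlim_compose[OF sqrt_at_top filterlim_real_sequentially])
  ultimately have "\<bar>\<integral>x. s x * p x \<partial>M\<bar> \<le> 2 * 0 + (2 * (\<integral>x. (v x)\<^sup>2 \<partial>M) + 2 * 0) * 0"
    by (intro LIMSEQ_le_const) auto
  then show ?thesis by simp
qed

text \<open>Supplies the direction of the tilt: bounded, so that \<open>1 + t / sqrt n\<close> is
  nonnegative for large \<open>n\<close>; of mean zero, so that the tilted density has mass 1; and
  close to the score in \<open>L\<^sup>2\<close>.\<close>

lemma truncated_score:
  assumes \<eta>: "0 < \<eta>"
  obtains t B where "t \<in> borel_measurable M" "\<And>x. \<bar>t x\<bar> \<le> B" "(\<integral>x. t x * p x \<partial>M) = 0"
    "integrable M (\<lambda>x. (s x - t x)\<^sup>2 * p x)" "(\<integral>x. (s x - t x)\<^sup>2 * p x \<partial>M) < \<eta>"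
proof -
  define sk where "sk k x = s x * indicator {x. \<bar>s x\<bar> \<le> real k} x" for k x
  have [measurable]: "sk k \<in> borel_measurable M" for k unfolding sk_def by measurable
  have skb: "\<bar>sk k x\<bar> \<le> real k" for k x by (auto simp: sk_def indicator_def)
  have skx: "(\<lambda>k. sk k x) \<longlonglongrightarrow> s x" for x
  proof (rule tendsto_eventually, rule eventually_sequentiallyI[of "nat \<lceil>\<bar>s x\<bar>\<rceil>"])
    fix k assume "nat \<lceil>\<bar>s x\<bar>\<rceil> \<le> k"
    then have "\<bar>s x\<bar> \<le> real k" by linarith
    then show "sk k x = s x" by (simp add: sk_def)
  qed
  define c where "c k = (\<integral>x. sk k x * p x \<partial>M)" for k
  have isk: "integrable M (\<lambda>x. sk k x * p x)" for k
    by (rule Bochner_Integration.integrable_bound[OF sp_integrable]) (auto simp: sk_def indicator_def)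
  have "(\<lambda>k. \<integral>x. sk k x * p x \<partial>M) \<longlonglongrightarrow> (\<integral>x. s x * p x \<partial>M)"
    by (rule integral_dominated_convergence[where w="\<lambda>x. \<bar>s x * p x\<bar>"])
       (use sp_integrable skx in \<open>auto intro!: tendsto_intros AE_I2 simp: sk_def indicator_def\<close>)
  then have c0: "c \<longlonglongrightarrow> 0" by (simp add: c_def[abs_def] score_mean_zero)
  have i2: "integrable M (\<lambda>x. (s x - sk k x)\<^sup>2 * p x)" for k
    by (rule Bochner_Integration.integrable_bound[OF s_L2]) (auto simp: sk_def indicator_def)
  have skx2: "AE x in M. (\<lambda>k. (s x - sk k x)\<^sup>2 * p x) \<longlonglongrightarrow> (s x - s x)\<^sup>2 * p x"
    by (intro AE_I2 tendsto_intros skx)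
  have "(\<lambda>k. \<integral>x. (s x - sk k x)\<^sup>2 * p x \<partial>M) \<longlonglongrightarrow> (\<integral>x. (s x - s x)\<^sup>2 * p x \<partial>M)"
    by (rule integral_dominated_convergence[where w="\<lambda>x. (s x)\<^sup>2 * p x"])
       (use s_L2 p_nonneg skx2 in \<open>auto simp: sk_def indicator_def\<close>)
  then have "(\<lambda>k. 2 * (\<integral>x. (s x - sk k x)\<^sup>2 * p x \<partial>M) + 2 * (c k)\<^sup>2) \<longlonglongrightarrow> 2 * 0 + 2 * 0\<^sup>2"
    by (intro tendsto_intros c0) simp
  then have "eventually (\<lambda>k. 2 * (\<integral>x. (s x - sk k x)\<^sup>2 * p x \<partial>M) + 2 * (c k)\<^sup>2 < \<eta>) sequentially"
    using \<eta> by (intro order_tendstoD(2)) auto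
  then obtain k where k: "2 * (\<integral>x. (s x - sk k x)\<^sup>2 * p x \<partial>M) + 2 * (c k)\<^sup>2 < \<eta>"
    unfolding eventually_sequentially by blast
  \<comment> \<open>Truncation destroys the zero mean. Subtracting the constant \<open>c k\<close>
    restores it, at a cost that vanishes because the score itself is centred.\<close>
  define t where "t x = sk k x - c k" for x
  have [measurable]: "t \<in> borel_measurable M" unfolding t_def[abs_def] by measurable
  have bd: "(s x - t x)\<^sup>2 * p x \<le> 2 * ((s x - sk k x)\<^sup>2 * p x) + 2 * (c k)\<^sup>2 * p x" for x
  proof -
    have "(s x - t x)\<^sup>2 \<le> 2 * (s x - sk k x)\<^sup>2 + 2 * (c k)\<^sup>2"
      using sum_squares_bound[of "s x - sk k x" "c k"] power2_sum[of "s x - sk k x" "c k"] by (simp add: t_def algebra_simps)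
    from mult_right_mono[OF this p_nonneg[of x]] show ?thesis by (simp add: algebra_simps)
  qed
  have it: "integrable M (\<lambda>x. (s x - t x)\<^sup>2 * p x)"
    by (rule Bochner_Integration.integrable_bound[where f="\<lambda>x. 2 * ((s x - sk k x)\<^sup>2 * p x) + 2 * (c k)\<^sup>2 * p x"])
       (use bd i2 p_int p_nonneg in \<open>auto intro!: AE_I2 order_trans[OF bd]\<close>)
  have "(\<integral>x. (s x - t x)\<^sup>2 * p x \<partial>M) \<le> (\<integral>x. 2 * ((s x - sk k x)\<^sup>2 * p x) + 2 * (c k)\<^sup>2 * p x \<partial>M)"
    by (rule integral_mono[OF it _ bd]) (use i2 p_int in auto)
  also have "\<dots> = 2 * (\<integral>x. (s x - sk k x)\<^sup>2 * p x \<partial>M) + 2 * (c k)\<^sup>2" using i2 p_int by simp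
  finally have lt: "(\<integral>x. (s x - t x)\<^sup>2 * p x \<partial>M) < \<eta>" using k by linarith
  show ?thesis
  proof (rule that[OF _ _ _ it lt])
    show "t \<in> borel_measurable M" by measurable
    show "\<bar>t x\<bar> \<le> real k + \<bar>c k\<bar>" for x using skb[of k x] by (simp add: t_def)
    show "(\<integral>x. t x * p x \<partial>M) = 0" using isk p_int by (simp add: t_def left_diff_distrib c_def)
  qed
qed

end

section \<open>Contiguity, and characteristic functions along the alternatives\<close>

context qmd_sequence
begin

text \<open>Stated for [0,1]-valued functionals rather than events, with \<open>\<eta>\<close> and
  \<open>n0\<close> independent of \<open>F\<close>. Later the functional is built after
  \<open>\<eta>\<close> is known, so this uniformity is essential.\<close>

lemma contiguity:
  assumes e: "0 < e"
  shows "\<exists>\<eta>>0. \<exists>n0. \<forall>n\<ge>n0. \<forall>F\<in>borel_measurable (PiM {..<n} (\<lambda>_. M)). (\<forall>\<omega>. 0 \<le> F \<omega> \<and> F \<omega> \<le> 1) \<longrightarrow>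
    (\<integral>\<omega>. F \<omega> \<partial>PiM {..<n} (\<lambda>_. density M p)) \<le> \<eta> \<longrightarrow> (\<integral>\<omega>. F \<omega> \<partial>PiM {..<n} (\<lambda>_. density M (q n))) \<le> (e::real)"
proof -
  \<comment> \<open>The Hellinger comparison costs at most \<open>e / 8\<close> from the distance
    and \<open>2 * \<kappa> = e / 4\<close> from the weight. The tilted law is left with
    \<open>e / 2\<close>.\<close>
  define \<kappa> where "\<kappa> = e / 8"
  have \<kappa>: "\<kappa> > 0" using e by (simp add: \<kappa>_def)
  obtain t B where [measurable]: "t \<in> borel_measurable M" and tB: "\<And>x. \<bar>t x\<bar> \<le> B" and t0: "(\<integral>x. t x * p x \<partial>M) = 0"
    and ist: "integrable M (\<lambda>x. (s x - t x)\<^sup>2 * p x)" and st: "(\<integral>x. (s x - t x)\<^sup>2 * p x \<partial>M) < \<kappa> * e / 8"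
    using truncated_score[of "\<kappa> * e / 8"] e \<kappa> by auto
  have B0: "B \<ge> 0" using tB[of undefined] by linarith
  have t2: "(t x)\<^sup>2 \<le> B\<^sup>2" for x using tB[of x] B0 by (simp add: abs_le_square_iff[symmetric])
  \<comment> \<open>Chosen so that the second moment of the likelihood ratio, at most
    \<open>exp (B\<^sup>2)\<close>, contributes \<open>e / 4\<close>. The threshold
    \<open>\<kappa>' * e / 2\<close> for the mean under the base law then contributes another
    \<open>e / 4\<close>.\<close>
  define \<kappa>' where "\<kappa>' = e / (2 * exp (B\<^sup>2))"
  have \<kappa>': "\<kappa>' > 0" using e by (simp add: \<kappa>'_def)
  have "(\<lambda>n. 3 * (\<integral>x. (r n x)\<^sup>2 \<partial>M) + 3 * B^4 / 4 * (1 / real n)) \<longlonglongrightarrow> 3 * 0 + 3 * B^4 / 4 * 0"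
    by (intro tendsto_intros r_lim lim_1_over_n)
  then have "eventually (\<lambda>n. 3 * (\<integral>x. (r n x)\<^sup>2 \<partial>M) + 3 * B^4 / 4 * (1 / real n) < \<kappa> * e / 8) sequentially"
    using \<kappa> e by (intro order_tendstoD(2)) auto
  then obtain n1 where n1: "\<And>n. n \<ge> n1 \<Longrightarrow> 3 * (\<integral>x. (r n x)\<^sup>2 \<partial>M) + 3 * B^4 / 4 * (1 / real n) < \<kappa> * e / 8"
    unfolding eventually_sequentially by blast
  show ?thesis
  \<comment> \<open>The second lower bound on \<open>n\<close> gives \<open>sqrt n \<ge> B\<close>,
    so that \<open>\<bar>u\<bar> \<le> 1\<close>; the added 1 excludes \<open>n = 0\<close>.\<close>
  proof (intro exI[of _ "\<kappa>' * e / 2"] conjI exI[of _ "max n1 (nat \<lceil>B\<^sup>2\<rceil> + 1)"] allI impI ballI)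
    show "0 < \<kappa>' * e / 2" using \<kappa>' e by simp
    fix n F
    assume n: "max n1 (nat \<lceil>B\<^sup>2\<rceil> + 1) \<le> n" and F [measurable]: "F \<in> borel_measurable (PiM {..<n} (\<lambda>_. M))"
      and F01: "\<forall>\<omega>. 0 \<le> F \<omega> \<and> F \<omega> \<le> (1::real)"
      and Fp: "(\<integral>\<omega>. F \<omega> \<partial>PiM {..<n} (\<lambda>_. density M p)) \<le> \<kappa>' * e / 2"
    have nB: "real n \<ge> B\<^sup>2" and npos: "real n > 0" using n by linarith+
    have sn: "sqrt (real n) \<ge> B" "sqrt (real n) > 0" using nB npos by (auto intro: real_le_rsqrt)
    define u where "u x = t x / sqrt (real n)" for x
    have [measurable]: "u \<in> borel_measurable M" unfolding u_def[abs_def] by measurable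
    have u1: "\<bar>u x\<bar> \<le> 1" for x using tB[of x] sn by (simp add: u_def)
    have u2: "(u x)\<^sup>2 \<le> B\<^sup>2 / real n" for x
      using divide_right_mono[OF t2[of x], of "real n"] npos by (simp add: u_def power_divide)
    have um: "(\<integral>x. u x * p x \<partial>M) = 0" using t0 by (simp add: u_def)
    let ?\<rho> = "\<lambda>x. p x * (1 + u x)"
    have \<rho>0: "0 \<le> ?\<rho> x" for x using p_nonneg[of x] u1[of x] by (intro mult_nonneg_nonneg) (auto simp: abs_le_iff)
    have [measurable]: "?\<rho> \<in> borel_measurable M" by measurable
    note tilt = product_tilt_bound[OF p_meas p_nonneg p_prob _ u1 um F _ _ \<kappa>']
    have R: "prob_space (density M (\<lambda>x. ennreal (?\<rho> x)))" by (rule tilt(1)) (use F01 in auto)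
    have hell: "real n * (\<integral>x. (sqrt (q n x) - sqrt (?\<rho> x))\<^sup>2 \<partial>M) \<le> \<kappa> * e / 4"
    proof -
      \<comment> \<open>The distance between the root densities splits into the remainder of the
        path, the truncation error of the score and the curvature of the square root in the tilt.
        The factor 3 comes from squaring a sum of three terms.\<close>
      have pt: "real n * (sqrt (q n x) - sqrt (?\<rho> x))\<^sup>2
          \<le> 3 * (r n x)\<^sup>2 + 3 / 4 * ((s x - t x)\<^sup>2 * p x) + 3 * B^4 / 4 * (1 / real n) * p x" for x
      proof -
        define d where "d = sqrt (1 + u x) - 1 - u x / 2"
        have "\<bar>d\<bar> \<le> (u x)\<^sup>2 / 2" unfolding d_def by (rule sqrt_one_plus_remainder[OF u1])
        also have "\<dots> \<le> B\<^sup>2 / real n / 2"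
          using u2[of x] by (intro divide_right_mono) auto
        finally have "d\<^sup>2 \<le> (B\<^sup>2 / real n / 2)\<^sup>2" by (metis abs_ge_zero power2_abs power_mono)
        then have d2: "real n * d\<^sup>2 \<le> B^4 / 4 * (1 / real n)"
          using npos by (simp add: power_divide power2_eq_square power4_eq_xxxx field_simps)
        have "sqrt (?\<rho> x) = sqrt (p x) * (1 + u x / 2 + d)" by (simp add: real_sqrt_mult d_def)
        then have "sqrt (real n) * (sqrt (q n x) - sqrt (?\<rho> x)) = r n x + sqrt (p x) * (s x - t x) / 2 + (- sqrt (real n) * sqrt (p x) * d)"
          using sn(2) by (simp add: r_def v_def u_def field_simps)
        then have "real n * (sqrt (q n x) - sqrt (?\<rho> x))\<^sup>2 = (r n x + sqrt (p x) * (s x - t x) / 2 + (- sqrt (real n) * sqrt (p x) * d))\<^sup>2"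
          by (metis power_mult_distrib real_sqrt_pow2 of_nat_0_le_iff)
        also have "\<dots> \<le> 3 * (r n x)\<^sup>2 + 3 * (sqrt (p x) * (s x - t x) / 2)\<^sup>2 + 3 * (- sqrt (real n) * sqrt (p x) * d)\<^sup>2"
        proof -
          have "(a + b + c)\<^sup>2 \<le> 3 * a\<^sup>2 + 3 * b\<^sup>2 + 3 * c\<^sup>2" for a b c :: real
            using zero_le_power2[of "a - b"] zero_le_power2[of "b - c"] zero_le_power2[of "a - c"]
            by (simp add: power2_eq_square algebra_simps)
          then show ?thesis .
        qed
        also have "\<dots> = 3 * (r n x)\<^sup>2 + 3 / 4 * ((s x - t x)\<^sup>2 * p x) + 3 * (real n * d\<^sup>2) * p x"
          using p_nonneg[of x] by (simp add: power_mult_distrib power_divide)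
        also have "\<dots> \<le> 3 * (r n x)\<^sup>2 + 3 / 4 * ((s x - t x)\<^sup>2 * p x) + 3 * (B^4 / 4 * (1 / real n)) * p x"
          using d2 p_nonneg[of x] by (intro add_left_mono mult_right_mono mult_left_mono) auto
        finally show ?thesis by simp
      qed
      have "real n * (\<integral>x. (sqrt (q n x) - sqrt (?\<rho> x))\<^sup>2 \<partial>M) = (\<integral>x. real n * (sqrt (q n x) - sqrt (?\<rho> x))\<^sup>2 \<partial>M)" by simp
      also have "\<dots> \<le> (\<integral>x. 3 * (r n x)\<^sup>2 + 3 / 4 * ((s x - t x)\<^sup>2 * p x) + 3 * B^4 / 4 * (1 / real n) * p x \<partial>M)"
        by (rule integral_mono'[OF _ pt]) (use r_L2 ist p_int p_nonneg in auto)
      also have "\<dots> = 3 * (\<integral>x. (r n x)\<^sup>2 \<partial>M) + 3 / 4 * (\<integral>x. (s x - t x)\<^sup>2 * p x \<partial>M) + 3 * B^4 / 4 * (1 / real n)"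
        using r_L2 ist p_int by simp
      finally have "real n * (\<integral>x. (sqrt (q n x) - sqrt (?\<rho> x))\<^sup>2 \<partial>M)
         \<le> 3 * (\<integral>x. (r n x)\<^sup>2 \<partial>M) + 3 / 4 * (\<integral>x. (s x - t x)\<^sup>2 * p x \<partial>M) + 3 * B^4 / 4 * (1 / real n)" .
      moreover have "n \<ge> n1" using n by simp
      ultimately show ?thesis using n1[of n] st \<kappa> e mult_pos_pos[OF \<kappa> e] by linarith
    qed
    have "(\<integral>x. (u x)\<^sup>2 * p x \<partial>M) \<le> (\<integral>x. B\<^sup>2 / real n * p x \<partial>M)"
    proof (rule integral_mono')
      show "(u x)\<^sup>2 * p x \<le> B\<^sup>2 / real n * p x" for x
        using u2[of x] p_nonneg[of x] by (rule mult_right_mono)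
    qed (use p_int p_nonneg in auto)
    then have uv: "(\<integral>x. (u x)\<^sup>2 * p x \<partial>M) \<le> B\<^sup>2 / real n" using p_int by simp
    have "(1 + (\<integral>x. (u x)\<^sup>2 * p x \<partial>M)) ^ n \<le> (1 + B\<^sup>2 / real n) ^ n"
      using uv p_nonneg by (intro power_mono) auto
    also have "\<dots> \<le> exp (B\<^sup>2 / real n) ^ n" by (intro power_mono) auto
    also have "\<dots> = exp (B\<^sup>2)" using npos by (simp add: exp_of_nat_mult[symmetric])
    finally have V: "(1 + (\<integral>x. (u x)\<^sup>2 * p x \<partial>M)) ^ n \<le> exp (B\<^sup>2)" .
    have "(\<integral>\<omega>. F \<omega> \<partial>PiM {..<n} (\<lambda>_. density M (\<lambda>x. ennreal (?\<rho> x))))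
       \<le> (\<integral>\<omega>. F \<omega> \<partial>PiM {..<n} (\<lambda>_. density M p)) / (2 * \<kappa>') + \<kappa>' / 2 * (1 + (\<integral>x. (u x)\<^sup>2 * p x \<partial>M)) ^ n"
      by (rule tilt(2)) (use F01 in auto)
    also have "\<dots> \<le> (\<kappa>' * e / 2) / (2 * \<kappa>') + \<kappa>' / 2 * exp (B\<^sup>2)"
      using Fp V \<kappa>' by (intro add_mono divide_right_mono mult_left_mono) auto
    also have "\<dots> = e / 2" using \<kappa>' by (simp add: field_simps) (simp add: \<kappa>'_def)
    finally have A1: "(\<integral>\<omega>. F \<omega> \<partial>PiM {..<n} (\<lambda>_. density M (\<lambda>x. ennreal (?\<rho> x)))) \<le> e / 2" .
    have "(\<integral>\<omega>. F \<omega> \<partial>PiM {..<n} (\<lambda>_. density M (q n))) \<le> (\<integral>\<omega>. F \<omega> \<partial>PiM {..<n} (\<lambda>_. density M (\<lambda>x. ennreal (?\<rho> x))))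
       + real n * (\<integral>x. (sqrt (q n x) - sqrt (?\<rho> x))\<^sup>2 \<partial>M) / (2 * \<kappa>) + 2 * \<kappa>"
      by (rule product_hellinger_bound[OF q_meas q_nonneg q_prob _ \<rho>0 R F _ _ \<kappa>]) (use F01 in auto)
    moreover have "real n * (\<integral>x. (sqrt (q n x) - sqrt (?\<rho> x))\<^sup>2 \<partial>M) / (2 * \<kappa>) \<le> e / 8"
      using divide_right_mono[OF hell, of "2 * \<kappa>"] \<kappa> by simp
    moreover have "e / 2 + e / 8 + 2 * \<kappa> \<le> e" using e by (simp add: \<kappa>_def)
    ultimately show "(\<integral>\<omega>. F \<omega> \<partial>PiM {..<n} (\<lambda>_. density M (q n))) \<le> e" using A1 by linarith
  qed
qed

text \<open>Central limit theorem and shift at once: the first-order part of the character,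
  integrated against the first-order part of the density, gives the shift, and its second-order part
  under the base law gives the variance. A joint limit with the log likelihood ratio is thereby
  avoided.\<close>

lemma char_local_alternative:
  assumes f [measurable]: "f \<in> borel_measurable M" and f2: "integrable M (\<lambda>x. (f x)\<^sup>2 * p x)"
    and f0: "(\<integral>x. f x * p x \<partial>M) = 0"
  shows "(\<lambda>n. \<integral>\<omega>. iexp (1 / sqrt (real n) * (\<Sum>i<n. f (\<omega> i))) \<partial>PiM {..<n} (\<lambda>_. density M (q n)))
    \<longlonglongrightarrow> exp (\<i> * complex_of_real (\<integral>x. s x * f x * p x \<partial>M) - complex_of_real ((\<integral>x. (f x)\<^sup>2 * p x \<partial>M) / 2))"
proof -
  define \<epsilon> where "\<epsilon> n = 1 / sqrt (real n)" for n
  define g where "g n x = iexp (\<epsilon> n * f x) - 1" for n x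
  have [measurable]: "g n \<in> borel_measurable M" for n unfolding g_def by measurable
  have \<epsilon>0: "\<epsilon> n \<ge> 0" for n by (simp add: \<epsilon>_def)
  have \<epsilon>n: "sqrt (real n) * \<epsilon> n = 1" "real n * (\<epsilon> n)\<^sup>2 = 1" "real n * \<epsilon> n = sqrt (real n)" if "n \<ge> 1" for n
    using that by (auto simp: \<epsilon>_def power_divide real_div_sqrt)
  have \<epsilon>lim: "\<epsilon> \<longlonglongrightarrow> 0" unfolding \<epsilon>_def[abs_def]
    by (intro real_tendsto_divide_at_top[where F=sequentially, OF tendsto_const]
        filterlim_compose[OF sqrt_at_top filterlim_real_sequentially])
  have g1: "norm (g n x) \<le> \<epsilon> n * \<bar>f x\<bar>" for n x
    using iexp_approx1[of "\<epsilon> n * f x" 0] \<epsilon>0[of n] by (simp add: g_def abs_mult)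
  have g2: "norm (g n x) \<le> 2" for n x
    using norm_triangle_ineq4[of "iexp (\<epsilon> n * f x)" 1] by (simp add: g_def)
  have gq: "norm (iexp (\<epsilon> n * f x) - 1 - \<i> * (\<epsilon> n * f x)) \<le> (\<epsilon> n * f x)\<^sup>2 / 2" for n x
    using iexp_approx1[of "\<epsilon> n * f x" 1] by (simp add: power2_eq_square abs_mult diff_diff_eq)
  have glim: "(\<lambda>n. g n x) \<longlonglongrightarrow> 0" for x
  proof (rule Lim_null_comparison[where g="\<lambda>n. \<epsilon> n * \<bar>f x\<bar>"])
    show "(\<lambda>n. \<epsilon> n * \<bar>f x\<bar>) \<longlonglongrightarrow> 0" by (rule tendsto_mult_left_zero[OF \<epsilon>lim])
  qed (use g1 in auto)
  have g3: "(\<lambda>n. of_nat n * (iexp (\<epsilon> n * f x) - 1 - \<i> * (\<epsilon> n * f x))) \<longlonglongrightarrow> - complex_of_real ((f x)\<^sup>2 / 2)" for x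
  proof -
    have "norm (of_nat n * (iexp (\<epsilon> n * f x) - 1 - \<i> * (\<epsilon> n * f x)) - (- complex_of_real ((f x)\<^sup>2 / 2)))
        \<le> \<epsilon> n * \<bar>f x\<bar>^3" if n: "n \<ge> 1" for n
    proof -
      have eq: "of_nat n * (iexp (\<epsilon> n * f x) - 1 - \<i> * (\<epsilon> n * f x)) - (- complex_of_real ((f x)\<^sup>2 / 2))
          = of_nat n * (iexp (\<epsilon> n * f x) - (\<Sum>k\<le>2. (\<i> * (\<epsilon> n * f x)) ^ k / fact k))"
      proof -
        have "real n * (\<epsilon> n * f x)\<^sup>2 = (f x)\<^sup>2"
          using \<epsilon>n(2)[OF n] by (simp add: power_mult_distrib mult.assoc[symmetric])
        from arg_cong[OF this, of complex_of_real]
        have 1: "complex_of_real ((f x)\<^sup>2 / 2) = of_nat n * (complex_of_real (\<epsilon> n * f x))\<^sup>2 / 2" by simp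
        have 2: "(\<Sum>k\<le>2. (\<i> * y) ^ k / fact k) = 1 + \<i> * y - y\<^sup>2 / 2" for y :: complex
        proof -
          have "{..2::nat} = {0, 1, 2}" by auto
          then show ?thesis by (simp add: power_mult_distrib)
        qed
        show ?thesis unfolding 1 2 by (simp add: right_diff_distrib distrib_left)
      qed
      have "norm (of_nat n * (iexp (\<epsilon> n * f x) - (\<Sum>k\<le>2. (\<i> * (\<epsilon> n * f x)) ^ k / fact k)))
         \<le> real n * (\<bar>\<epsilon> n * f x\<bar> ^ 3 / 6)"
        unfolding norm_mult using iexp_approx1[of "\<epsilon> n * f x" 2]
        by (intro mult_mono) (auto simp: fact_numeral)
      also have "\<dots> = (real n * (\<epsilon> n)\<^sup>2) * \<epsilon> n * \<bar>f x\<bar>^3 / 6" using \<epsilon>0[of n] by (simp add: abs_mult power_mult_distrib power2_eq_square power3_eq_cube)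
      also have "\<dots> \<le> \<epsilon> n * \<bar>f x\<bar>^3" using \<epsilon>n(2)[OF n] \<epsilon>0[of n] by simp
      finally show ?thesis unfolding eq .
    qed
    then show ?thesis
      by (intro LIM_zero_cancel[OF Lim_null_comparison[OF eventually_sequentiallyI[of 1] tendsto_mult_left_zero[OF \<epsilon>lim]]]) auto
  qed
  have g4: "(\<lambda>n. sqrt (real n) * g n x) \<longlonglongrightarrow> \<i> * f x" for x
  proof -
    have "norm (sqrt (real n) * g n x - \<i> * f x) \<le> \<epsilon> n * (f x)\<^sup>2" if n: "n \<ge> 1" for n
    proof -
      have "complex_of_real (sqrt (real n)) * complex_of_real (\<epsilon> n) = 1"
        using \<epsilon>n(1)[OF n] by (metis of_real_1 of_real_mult)
      moreover have "complex_of_real (sqrt (real n)) * (\<i> * complex_of_real (\<epsilon> n * f x))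
          = (complex_of_real (sqrt (real n)) * complex_of_real (\<epsilon> n)) * (\<i> * f x)"
        by (simp only: of_real_mult mult_ac)
      ultimately have "complex_of_real (sqrt (real n)) * (\<i> * complex_of_real (\<epsilon> n * f x)) = \<i> * f x"
        by (simp only: mult_1)
      then have "sqrt (real n) * g n x - \<i> * f x = sqrt (real n) * (iexp (\<epsilon> n * f x) - 1 - \<i> * (\<epsilon> n * f x))"
        by (simp only: g_def right_diff_distrib)
      then have "norm (sqrt (real n) * g n x - \<i> * f x) \<le> sqrt (real n) * ((\<epsilon> n * f x)\<^sup>2 / 2)"
        using mult_left_mono[OF gq[of n x], of "sqrt (real n)"] by (simp add: norm_mult)
      also have "\<dots> = (sqrt (real n) * \<epsilon> n) * \<epsilon> n * (f x)\<^sup>2 / 2" by (simp add: power2_eq_square)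
      also have "\<dots> \<le> \<epsilon> n * (f x)\<^sup>2" using \<epsilon>n(1)[OF n] \<epsilon>0[of n] by simp
      finally show ?thesis .
    qed
    then show ?thesis
      by (intro LIM_zero_cancel[OF Lim_null_comparison[OF eventually_sequentiallyI[of 1] tendsto_mult_left_zero[OF \<epsilon>lim]]]) auto
  qed
  define z where "z = \<i> * complex_of_real (\<integral>x. s x * f x * p x \<partial>M) - complex_of_real ((\<integral>x. (f x)\<^sup>2 * p x \<partial>M) / 2)"
  have fL2: "integrable M (\<lambda>x. (f x * sqrt (p x))\<^sup>2)" using f2 p_nonneg by (simp add: power_mult_distrib)
  have fp: "integrable M (\<lambda>x. f x * p x)"
    using integrable_mult_square[OF _ _ fL2 sqrt_L2(1)] p_nonneg by (simp add: mult.assoc)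
  have sfp: "integrable M (\<lambda>x. s x * f x * p x)"
  proof -
    have "integrable M (\<lambda>x. (s x * sqrt (p x)) * (f x * sqrt (p x)))"
      by (rule integrable_mult_square[OF _ _ _ fL2]) (use s_L2 p_nonneg in \<open>auto simp: power_mult_distrib\<close>)
    moreover have "(s x * sqrt (p x)) * (f x * sqrt (p x)) = s x * f x * p x" for x
      using p_nonneg[of x] by (metis (no_types, lifting) mult.assoc mult.commute real_sqrt_mult_self abs_of_nonneg)
    ultimately show ?thesis by simp
  qed
  have ig: "integrable M (\<lambda>x. g n x * complex_of_real (h x))" if "integrable M h" for n h
    by (rule Bochner_Integration.integrable_bound[where f="\<lambda>x. 2 * h x"])
       (use that g2 in \<open>auto simp: norm_mult abs_mult intro!: AE_I2 mult_right_mono borel_measurable_integrable\<close>)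
  define T1 T2 T3 T4 where "T1 n = (\<integral>x. g n x * complex_of_real (real n * p x) \<partial>M)"
    and "T2 n = (\<integral>x. g n x * complex_of_real (sqrt (real n) * (s x * p x)) \<partial>M)"
    and "T3 n = (\<integral>x. g n x * complex_of_real (2 * sqrt (real n) * (sqrt (p x) * r n x)) \<partial>M)"
    and "T4 n = (\<integral>x. g n x * complex_of_real ((v x + r n x)\<^sup>2) \<partial>M)" for n
  have T1: "T1 \<longlonglongrightarrow> - complex_of_real ((\<integral>x. (f x)\<^sup>2 * p x \<partial>M) / 2)"
  proof -
    \<comment> \<open>Since \<open>f\<close> is centred, the linear term of the character can be
      subtracted for free. What remains is dominated by \<open>f\<^sup>2 * p\<close> uniformly in
      \<open>n\<close>.\<close>
    have eq: "T1 n = (\<integral>x. of_nat n * (iexp (\<epsilon> n * f x) - 1 - \<i> * (\<epsilon> n * f x)) * complex_of_real (p x) \<partial>M)" for n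
    proof -
      have "(\<integral>x. \<i> * (real n * \<epsilon> n) * complex_of_real (f x * p x) \<partial>M) = 0"
        using f0 by (simp del: of_real_mult)
      moreover have "T1 n - (\<integral>x. \<i> * (real n * \<epsilon> n) * complex_of_real (f x * p x) \<partial>M)
         = (\<integral>x. g n x * complex_of_real (real n * p x) - \<i> * (real n * \<epsilon> n) * complex_of_real (f x * p x) \<partial>M)"
        unfolding T1_def
        by (rule Bochner_Integration.integral_diff[symmetric]) (use ig p_int fp in \<open>auto simp del: of_real_mult\<close>)
      moreover have "g n x * complex_of_real (real n * p x) - \<i> * (real n * \<epsilon> n) * complex_of_real (f x * p x)
         = of_nat n * (iexp (\<epsilon> n * f x) - 1 - \<i> * (\<epsilon> n * f x)) * complex_of_real (p x)" for x
        by (simp add: g_def algebra_simps)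
      ultimately show ?thesis by (simp only: diff_zero)
    qed
    have "T1 \<longlonglongrightarrow> (\<integral>x. - complex_of_real ((f x)\<^sup>2 / 2) * complex_of_real (p x) \<partial>M)"
      unfolding eq[abs_def]
    proof (rule integral_dominated_convergence[where w="\<lambda>x. (f x)\<^sup>2 * p x"])
      show "AE x in M. (\<lambda>n. of_nat n * (iexp (\<epsilon> n * f x) - 1 - \<i> * (\<epsilon> n * f x)) * complex_of_real (p x))
         \<longlonglongrightarrow> - complex_of_real ((f x)\<^sup>2 / 2) * complex_of_real (p x)"
        by (intro AE_I2 tendsto_mult g3 tendsto_const)
      show "AE x in M. norm (of_nat n * (iexp (\<epsilon> n * f x) - 1 - \<i> * (\<epsilon> n * f x)) * complex_of_real (p x)) \<le> (f x)\<^sup>2 * p x" for n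
      proof (intro AE_I2)
        fix x
        have "real n * norm (iexp (\<epsilon> n * f x) - 1 - \<i> * (\<epsilon> n * f x)) \<le> real n * ((\<epsilon> n * f x)\<^sup>2 / 2)"
          by (intro mult_left_mono gq) auto
        also have "\<dots> = (real n * (\<epsilon> n)\<^sup>2) * ((f x)\<^sup>2 / 2)" by (simp add: power_mult_distrib)
        also have "\<dots> \<le> 1 * (f x)\<^sup>2"
          by (intro mult_mono) (cases "n = 0"; use \<epsilon>n(2)[of n] in auto)+
        finally show "norm (of_nat n * (iexp (\<epsilon> n * f x) - 1 - \<i> * (\<epsilon> n * f x)) * complex_of_real (p x)) \<le> (f x)\<^sup>2 * p x"
          unfolding norm_mult using p_nonneg[of x] by (intro mult_mono) auto
      qed
    qed (use f2 in auto)
    also have "(\<integral>x. - complex_of_real ((f x)\<^sup>2 / 2) * complex_of_real (p x) \<partial>M) = (\<integral>x. complex_of_real (- ((f x)\<^sup>2 * p x / 2)) \<partial>M)"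
      by (intro Bochner_Integration.integral_cong) auto
    also have "\<dots> = - complex_of_real ((\<integral>x. (f x)\<^sup>2 * p x \<partial>M) / 2)"
      by (subst integral_complex_of_real) simp
    finally show ?thesis .
  qed
  \<comment> \<open>The source of the shift: \<open>sqrt n * g n\<close> tends to
    \<open>\<i> * f\<close>, and the bound on \<open>g n\<close> absorbs the factor
    \<open>sqrt n\<close>, leaving the integrable majorant
    \<open>\<bar>s * f * p\<bar>\<close>.\<close>
  have T2: "T2 \<longlonglongrightarrow> \<i> * complex_of_real (\<integral>x. s x * f x * p x \<partial>M)"
  proof -
    have "T2 \<longlonglongrightarrow> (\<integral>x. \<i> * complex_of_real (s x * f x * p x) \<partial>M)"
      unfolding T2_def[abs_def]
    proof (rule integral_dominated_convergence[where w="\<lambda>x. \<bar>s x * f x * p x\<bar>"])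
      show "AE x in M. (\<lambda>n. g n x * complex_of_real (sqrt (real n) * (s x * p x))) \<longlonglongrightarrow> \<i> * complex_of_real (s x * f x * p x)"
      proof (intro AE_I2)
        fix x
        have "(\<lambda>n. (sqrt (real n) * g n x) * complex_of_real (s x * p x)) \<longlonglongrightarrow> (\<i> * f x) * complex_of_real (s x * p x)"
          by (intro tendsto_mult g4 tendsto_const)
        then show "(\<lambda>n. g n x * complex_of_real (sqrt (real n) * (s x * p x))) \<longlonglongrightarrow> \<i> * complex_of_real (s x * f x * p x)"
          by (simp add: mult_ac)
      qed
      show "AE x in M. norm (g n x * complex_of_real (sqrt (real n) * (s x * p x))) \<le> \<bar>s x * f x * p x\<bar>" for n
      proof (intro AE_I2)
        fix x
        have "norm (g n x) * sqrt (real n) \<le> (\<epsilon> n * \<bar>f x\<bar>) * sqrt (real n)" by (intro mult_right_mono g1) auto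
        also have "\<dots> = (sqrt (real n) * \<epsilon> n) * \<bar>f x\<bar>" by (simp add: mult_ac)
        also have "\<dots> \<le> \<bar>f x\<bar>" using \<epsilon>n(1)[of n] by (cases "n = 0") auto
        finally have "(norm (g n x) * sqrt (real n)) * \<bar>s x * p x\<bar> \<le> \<bar>f x\<bar> * \<bar>s x * p x\<bar>"
          by (rule mult_right_mono) simp
        then show "norm (g n x * complex_of_real (sqrt (real n) * (s x * p x))) \<le> \<bar>s x * f x * p x\<bar>"
          by (simp add: norm_mult abs_mult mult_ac)
      qed
    qed (use sfp in auto)
    then show ?thesis by (simp del: of_real_mult)
  qed
  \<comment> \<open>The factor \<open>sqrt n\<close> is again absorbed by \<open>g n\<close>;
    Cauchy-Schwarz then leaves the \<open>L\<^sup>2\<close> norm of the remainder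
    \<open>r n\<close>.\<close>
  have T3: "T3 \<longlonglongrightarrow> 0"
  proof (rule Lim_null_comparison[where g="\<lambda>n. 2 * (sqrt (\<integral>x. (f x * sqrt (p x))\<^sup>2 \<partial>M) * sqrt (\<integral>x. (r n x)\<^sup>2 \<partial>M))"])
    have "norm (T3 n) \<le> 2 * (sqrt (\<integral>x. (f x * sqrt (p x))\<^sup>2 \<partial>M) * sqrt (\<integral>x. (r n x)\<^sup>2 \<partial>M))" for n
    proof -
      have ifr: "integrable M (\<lambda>x. (f x * sqrt (p x)) * r n x)"
        by (rule integrable_mult_square[OF _ _ fL2 r_L2]) auto
      have "norm (T3 n) \<le> (\<integral>x. norm (g n x * complex_of_real (2 * sqrt (real n) * (sqrt (p x) * r n x))) \<partial>M)"
        unfolding T3_def by (rule integral_norm_bound)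
      also have "\<dots> \<le> (\<integral>x. 2 * \<bar>(f x * sqrt (p x)) * r n x\<bar> \<partial>M)"
      proof (rule integral_mono')
        fix x
        have "norm (g n x) * sqrt (real n) \<le> (\<epsilon> n * \<bar>f x\<bar>) * sqrt (real n)" by (intro mult_right_mono g1) auto
        also have "\<dots> = (sqrt (real n) * \<epsilon> n) * \<bar>f x\<bar>" by (simp add: mult_ac)
        also have "\<dots> \<le> \<bar>f x\<bar>" using \<epsilon>n(1)[of n] by (cases "n = 0") auto
        finally have "(norm (g n x) * sqrt (real n)) * (2 * \<bar>sqrt (p x) * r n x\<bar>) \<le> \<bar>f x\<bar> * (2 * \<bar>sqrt (p x) * r n x\<bar>)"
          by (rule mult_right_mono) simp
        then show "norm (g n x * complex_of_real (2 * sqrt (real n) * (sqrt (p x) * r n x))) \<le> 2 * \<bar>(f x * sqrt (p x)) * r n x\<bar>"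
          by (simp add: norm_mult abs_mult mult_ac)
      qed (use ifr in auto)
      also have "\<dots> = 2 * (\<integral>x. \<bar>(f x * sqrt (p x)) * r n x\<bar> \<partial>M)" by simp
      also have "\<dots> \<le> 2 * (sqrt (\<integral>x. (f x * sqrt (p x))\<^sup>2 \<partial>M) * sqrt (\<integral>x. (r n x)\<^sup>2 \<partial>M))"
        by (intro mult_left_mono integral_cauchy_schwarz fL2 r_L2) auto
      finally show ?thesis .
    qed
    then show "\<forall>\<^sub>F n in sequentially. norm (T3 n) \<le> 2 * (sqrt (\<integral>x. (f x * sqrt (p x))\<^sup>2 \<partial>M) * sqrt (\<integral>x. (r n x)\<^sup>2 \<partial>M))" by simp
    show "(\<lambda>n. 2 * (sqrt (\<integral>x. (f x * sqrt (p x))\<^sup>2 \<partial>M) * sqrt (\<integral>x. (r n x)\<^sup>2 \<partial>M))) \<longlonglongrightarrow> 0"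
      by (intro tendsto_mult_right_zero sqrt_r_lim)
  qed
  \<comment> \<open>No factor \<open>sqrt n\<close> is left to absorb, so \<open>g n\<close> is used
    differently: it tends to 0 boundedly against the fixed weight \<open>v\<^sup>2\<close>, while
    against the square of \<open>r n\<close> its bound 2 is enough.\<close>
  have T4: "T4 \<longlonglongrightarrow> 0"
  proof (rule Lim_null_comparison[where g="\<lambda>n. (\<integral>x. 2 * norm (g n x) * (v x)\<^sup>2 \<partial>M) + 4 * (\<integral>x. (r n x)\<^sup>2 \<partial>M)"])
    have igv: "integrable M (\<lambda>x. 2 * norm (g n x) * (v x)\<^sup>2)" for n
      by (rule Bochner_Integration.integrable_bound[where f="\<lambda>x. 4 * (v x)\<^sup>2"])
         (use v_L2 g2 in \<open>auto intro!: mult_right_mono\<close>)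
    have "norm (T4 n) \<le> (\<integral>x. 2 * norm (g n x) * (v x)\<^sup>2 \<partial>M) + 4 * (\<integral>x. (r n x)\<^sup>2 \<partial>M)" for n
    proof -
      have "norm (T4 n) \<le> (\<integral>x. norm (g n x * complex_of_real ((v x + r n x)\<^sup>2)) \<partial>M)"
        unfolding T4_def by (rule integral_norm_bound)
      also have "\<dots> \<le> (\<integral>x. 2 * norm (g n x) * (v x)\<^sup>2 + 4 * (r n x)\<^sup>2 \<partial>M)"
      proof (rule integral_mono')
        fix x
        have "(v x + r n x)\<^sup>2 \<le> 2 * (v x)\<^sup>2 + 2 * (r n x)\<^sup>2"
          using sum_squares_bound[of "v x" "r n x"] by (simp add: power2_sum)
        then have "norm (g n x) * (v x + r n x)\<^sup>2 \<le> norm (g n x) * (2 * (v x)\<^sup>2 + 2 * (r n x)\<^sup>2)"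
          by (intro mult_left_mono) auto
        also have "\<dots> = 2 * norm (g n x) * (v x)\<^sup>2 + norm (g n x) * (2 * (r n x)\<^sup>2)" by (simp add: algebra_simps)
        also have "norm (g n x) * (2 * (r n x)\<^sup>2) \<le> 2 * (2 * (r n x)\<^sup>2)" by (intro mult_right_mono g2) auto
        finally show "norm (g n x * complex_of_real ((v x + r n x)\<^sup>2)) \<le> 2 * norm (g n x) * (v x)\<^sup>2 + 4 * (r n x)\<^sup>2"
          by (simp add: norm_mult norm_power[symmetric] del: of_real_add of_real_power)
      qed (use igv r_L2 in auto)
      also have "\<dots> = (\<integral>x. 2 * norm (g n x) * (v x)\<^sup>2 \<partial>M) + 4 * (\<integral>x. (r n x)\<^sup>2 \<partial>M)" using igv r_L2 by simp
      finally show ?thesis .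
    qed
    then show "\<forall>\<^sub>F n in sequentially. norm (T4 n) \<le> (\<integral>x. 2 * norm (g n x) * (v x)\<^sup>2 \<partial>M) + 4 * (\<integral>x. (r n x)\<^sup>2 \<partial>M)" by simp
    have "(\<lambda>n. \<integral>x. 2 * norm (g n x) * (v x)\<^sup>2 \<partial>M) \<longlonglongrightarrow> (\<integral>x. 2 * norm (0::complex) * (v x)\<^sup>2 \<partial>M)"
    proof (rule integral_dominated_convergence[where w="\<lambda>x. 4 * (v x)\<^sup>2"])
      show "AE x in M. (\<lambda>n. 2 * norm (g n x) * (v x)\<^sup>2) \<longlonglongrightarrow> 2 * norm (0::complex) * (v x)\<^sup>2"
        by (intro AE_I2 tendsto_intros glim)
    qed (use v_L2 g2 in \<open>auto intro!: mult_right_mono\<close>)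
    from tendsto_add[OF this tendsto_mult[OF tendsto_const r_lim, of 4]]
    show "(\<lambda>n. (\<integral>x. 2 * norm (g n x) * (v x)\<^sup>2 \<partial>M) + 4 * (\<integral>x. (r n x)\<^sup>2 \<partial>M)) \<longlonglongrightarrow> 0" by simp
  qed
  define w where "w n = (\<integral>x. iexp (\<epsilon> n * f x) * complex_of_real (q n x) \<partial>M)" for n
  have iw: "integrable M (\<lambda>x. iexp (\<epsilon> n * f x) * complex_of_real (q n x))" for n
    by (rule Bochner_Integration.integrable_bound[OF q_int(1)[of n]]) (auto simp: norm_mult)
  have wn: "norm (w n) \<le> 1" for n
  proof -
    have "norm (w n) \<le> (\<integral>x. norm (iexp (\<epsilon> n * f x) * complex_of_real (q n x)) \<partial>M)"
      unfolding w_def by (rule integral_norm_bound)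
    also have "\<dots> = 1" using q_int(2)[of n] q_nonneg by (simp add: norm_mult)
    finally show ?thesis .
  qed
  have wT: "of_nat n * (w n - 1) = T1 n + T2 n + T3 n + T4 n" if n: "n \<ge> 1" for n
  proof -
    have "1 = (\<integral>x. complex_of_real (q n x) \<partial>M)" using q_int(2)[of n] by simp
    then have "w n - 1 = (\<integral>x. iexp (\<epsilon> n * f x) * complex_of_real (q n x) - complex_of_real (q n x) \<partial>M)"
      unfolding w_def using iw q_int(1)[of n] by (subst Bochner_Integration.integral_diff) auto
    then have "of_nat n * (w n - 1) = (\<integral>x. of_nat n * (iexp (\<epsilon> n * f x) * complex_of_real (q n x) - complex_of_real (q n x)) \<partial>M)"
      by (simp only: integral_mult_right_zero)
    also have "\<dots> = (\<integral>x. g n x * complex_of_real (real n * q n x) \<partial>M)"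
      by (rule Bochner_Integration.integral_cong) (simp_all add: g_def algebra_simps)
    also have "\<dots> = (\<integral>x. g n x * complex_of_real (real n * p x) + g n x * complex_of_real (sqrt (real n) * (s x * p x))
       + g n x * complex_of_real (2 * sqrt (real n) * (sqrt (p x) * r n x)) + g n x * complex_of_real ((v x + r n x)\<^sup>2) \<partial>M)"
      unfolding q_expand[OF n] by (simp add: algebra_simps)
    also have "\<dots> = T1 n + T2 n + T3 n + T4 n"
    proof -
      have i: "integrable M (\<lambda>x. g n x * complex_of_real (real n * p x))"
        "integrable M (\<lambda>x. g n x * complex_of_real (sqrt (real n) * (s x * p x)))"
        "integrable M (\<lambda>x. g n x * complex_of_real (2 * sqrt (real n) * (sqrt (p x) * r n x)))"
        "integrable M (\<lambda>x. g n x * complex_of_real ((v x + r n x)\<^sup>2))"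
        by (rule ig; use p_int sp_integrable pr_integrable vr_L2 in simp)+
      show ?thesis unfolding T1_def T2_def T3_def T4_def
        by (simp only: Bochner_Integration.integral_add Bochner_Integration.integrable_add i)
    qed
    finally show ?thesis .
  qed
  have "(\<lambda>n. T1 n + T2 n + T3 n + T4 n) \<longlonglongrightarrow> - complex_of_real ((\<integral>x. (f x)\<^sup>2 * p x \<partial>M) / 2)
      + \<i> * complex_of_real (\<integral>x. s x * f x * p x \<partial>M) + 0 + 0"
    by (intro tendsto_add T1 T2 T3 T4)
  moreover have "eventually (\<lambda>n. T1 n + T2 n + T3 n + T4 n = of_nat n * (w n - 1)) sequentially"
    by (rule eventually_sequentiallyI[of 1]) (simp add: wT)
  ultimately have "(\<lambda>n. of_nat n * (w n - 1)) \<longlonglongrightarrow> - complex_of_real ((\<integral>x. (f x)\<^sup>2 * p x \<partial>M) / 2)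
      + \<i> * complex_of_real (\<integral>x. s x * f x * p x \<partial>M) + 0 + 0"
    by (rule Lim_transform_eventually)
  then have "(\<lambda>n. of_nat n * (w n - 1)) \<longlonglongrightarrow> z" by (simp add: z_def)
  moreover have "Re z \<le> 0" using p_nonneg by (simp add: z_def)
  ultimately have "(\<lambda>n. w n ^ n) \<longlonglongrightarrow> exp z" using wn by (intro complex_power_exp_limit)
  moreover have "w n ^ n = (\<integral>\<omega>. iexp (1 / sqrt (real n) * (\<Sum>i<n. f (\<omega> i))) \<partial>PiM {..<n} (\<lambda>_. density M (q n)))" for n
  proof -
    interpret Q: prob_space "density M (q n)" by (rule q_prob)
    interpret S: product_sigma_finite "\<lambda>_::nat. density M (q n)" by unfold_locales
    have "w n = (\<integral>x. iexp (\<epsilon> n * f x) \<partial>density M (q n))"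
      unfolding w_def by (subst integral_density) (use q_nonneg in \<open>auto simp: scaleR_conv_of_real mult.commute\<close>)
    moreover have "(\<integral>\<omega>. (\<Prod>i<n. iexp (\<epsilon> n * f (\<omega> i))) \<partial>PiM {..<n} (\<lambda>_. density M (q n)))
       = (\<Prod>i<n. \<integral>x. iexp (\<epsilon> n * f x) \<partial>density M (q n))"
      by (rule S.product_integral_prod) (auto intro!: Q.integrable_const_bound[where B=1])
    ultimately show ?thesis by (simp add: exp_sum[symmetric] sum_distrib_left \<epsilon>_def)
  qed
  ultimately show ?thesis by (simp add: z_def)
qed

end

section \<open>Gaussian measures on Hilbert space\<close>

lemma padded_onb_laplace_limit:
  fixes Z :: "'a \<Rightarrow> 'h::{real_inner,polish_space}"
  assumes onb: "padded_onb hb" and "prob_space L" and [measurable]: "Z \<in> borel_measurable L"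
  shows "(\<lambda>K. \<integral>x. exp (- (real m * (\<Sum>k<K. (inner (Z x) (hb k))\<^sup>2))) \<partial>L)
    \<longlonglongrightarrow> (\<integral>x. exp (- (real m * (norm (Z x))\<^sup>2)) \<partial>L)"
proof -
  interpret L: prob_space L by fact
  show ?thesis
  proof (rule integral_dominated_convergence[where w="\<lambda>_. 1"])
    show "AE x in L. (\<lambda>K. exp (- (real m * (\<Sum>k<K. (inner (Z x) (hb k))\<^sup>2)))) \<longlonglongrightarrow> exp (- (real m * (norm (Z x))\<^sup>2))"
      using padded_onb_parseval[OF onb] unfolding sums_def by (intro AE_I2 tendsto_intros)
    show "AE x in L. norm (exp (- (real m * (\<Sum>k<K. (inner (Z x) (hb k))\<^sup>2)))) \<le> 1" for K
      by (intro AE_I2) (simp add: sum_nonneg)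
  qed auto
qed

text \<open>Characteristic functionals determine the Laplace transforms of the truncated squared
  norms, then those of the full ones, and so a law on the real line. Uniqueness of measures on the
  Hilbert space is not invoked.\<close>

lemma norm_law_eq:
  fixes X :: "'a \<Rightarrow> 'h::{real_inner,polish_space}" and Y :: "'b \<Rightarrow> 'h" and hb :: "nat \<Rightarrow> 'h"
  assumes onb: "padded_onb hb" and M: "prob_space M" and N: "prob_space N"
    and X [measurable]: "X \<in> borel_measurable M" and Y [measurable]: "Y \<in> borel_measurable N"
    and eq: "\<And>w. (\<integral>x. iexp (inner (X x) w) \<partial>M) = (\<integral>y. iexp (inner (Y y) w) \<partial>N)"
  shows "distr M borel (\<lambda>x. (norm (X x))\<^sup>2) = distr N borel (\<lambda>y. (norm (Y y))\<^sup>2)"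
proof -
  interpret M: prob_space M by fact
  interpret N: prob_space N by fact
  have trunc: "(\<integral>x. exp (- (real m * (\<Sum>k<K. (inner (X x) (hb k))\<^sup>2))) \<partial>M)
      = (\<integral>y. exp (- (real m * (\<Sum>k<K. (inner (Y y) (hb k))\<^sup>2))) \<partial>N)" for m K
  proof -
    \<comment> \<open>A constant sequence turns the convergence lemma into an equality.\<close>
    have "(\<lambda>n::nat. \<integral>x. exp (- (real m * (\<Sum>k<K. (inner (X x) (hb k))\<^sup>2))) \<partial>M)
      \<longlonglongrightarrow> (\<integral>y. exp (- (real m * (\<Sum>k<K. (inner (Y y) (hb k))\<^sup>2))) \<partial>N)"
    proof (rule char_convergence_imp_laplace_convergence[OF M N])
      fix w :: "nat \<Rightarrow> real"
      have *: "(\<Sum>k<K. w k * inner z (hb k)) = inner z (\<Sum>k<K. w k *\<^sub>R hb k)" for z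
        by (simp add: inner_sum_right)
      show "(\<lambda>n::nat. \<integral>x. iexp (\<Sum>k<K. w k * inner (X x) (hb k)) \<partial>M) \<longlonglongrightarrow> (\<integral>y. iexp (\<Sum>k<K. w k * inner (Y y) (hb k)) \<partial>N)"
        unfolding * eq by (rule tendsto_const)
    qed measurable
    then show ?thesis by (simp add: LIMSEQ_const_iff)
  qed
  have lap: "(\<integral>x. exp (- (real m * (norm (X x))\<^sup>2)) \<partial>M) = (\<integral>y. exp (- (real m * (norm (Y y))\<^sup>2)) \<partial>N)" for m
    using padded_onb_laplace_limit[OF onb M X, of m] padded_onb_laplace_limit[OF onb N Y, of m]
    unfolding trunc by (rule LIMSEQ_unique)
  have cdf_eq: "cdf (distr M borel (\<lambda>x. (norm (X x))\<^sup>2)) a = cdf (distr N borel (\<lambda>y. (norm (Y y))\<^sup>2)) a" for a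
  proof -
    have "measure M {x \<in> space M. (norm (X x))\<^sup>2 \<le> a} = measure N {y \<in> space N. (norm (Y y))\<^sup>2 \<le> a}"
      by (rule laplace_eq_imp_cdf_eq[OF M N]) (auto intro: lap)
    then show ?thesis by (simp add: cdf_def measure_distr vimage_def Int_def conj_commute)
  qed
  show ?thesis
    by (rule cdf_unique) (auto intro!: M.real_distribution_distr N.real_distribution_distr cdf_eq)
qed

text \<open>A bathtub argument: the centred interval is a superlevel set of the density, and the
  shifted one has the same length. Only mass at lower density can be gained by moving, with a strict
  loss on an open set once the shift is nonzero and the interval nondegenerate.\<close>

lemma normal_interval_shift:
  fixes b c \<sigma> :: real
  assumes \<sigma>: "\<sigma> > 0"
  defines "N \<equiv> density lborel (normal_density 0 \<sigma>)"
  shows "measure N {u. (u + b)\<^sup>2 \<le> c} \<le> measure N {u. u\<^sup>2 \<le> c}"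
    and "b \<noteq> 0 \<Longrightarrow> 0 < c \<Longrightarrow> measure N {u. (u + b)\<^sup>2 \<le> c} < measure N {u. u\<^sup>2 \<le> c}"
    and "measure N {u. (u + b)\<^sup>2 = c} = 0"
proof -
  interpret N: prob_space N unfolding N_def by (rule prob_space_normal_density) fact
  let ?f = "normal_density 0 \<sigma>"
  define k where "k = sqrt c"
  define A where "A = {u::real. u\<^sup>2 \<le> c}"
  define B where "B = {u. (u + b)\<^sup>2 \<le> c}"
  have meas: "measure N S = (\<integral>u. ?f u * indicator S u \<partial>lborel)" if "S \<in> sets borel" for S
  proof -
    have "measure N S = (\<integral>u. indicator S u \<partial>N)" by (simp add: N_def)
    also have "\<dots> = (\<integral>u. ?f u * indicator S u \<partial>lborel)"
      unfolding N_def using that by (subst integral_density) auto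
    finally show ?thesis .
  qed
  have mono: "?f u \<le> ?f v" if "v\<^sup>2 \<le> u\<^sup>2" for u v
    unfolding normal_density_def using \<sigma> that by (intro mult_left_mono) (auto intro!: divide_right_mono)
  have smono: "?f u < ?f v" if "v\<^sup>2 < u\<^sup>2" for u v
    unfolding normal_density_def using \<sigma> that by (intro mult_strict_left_mono) (auto intro!: divide_strict_right_mono)
  show "measure N {u. (u + b)\<^sup>2 = c} = 0"
  proof -
    have "finite {u. (u + b)\<^sup>2 = c}"
    proof (rule finite_subset[of _ "{sqrt c - b, - sqrt c - b}"])
      show "{u. (u + b)\<^sup>2 = c} \<subseteq> {sqrt c - b, - sqrt c - b}"
        by (auto simp: real_sqrt_abs abs_if split: if_splits)
    qed simp
    then have "{u. (u + b)\<^sup>2 = c} \<in> null_sets lborel" by (rule finite_imp_null_set_lborel)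
    then have "AE u in lborel. u \<notin> {u. (u + b)\<^sup>2 = c}" by (rule AE_not_in)
    then have "AE u in N. u \<notin> {u. (u + b)\<^sup>2 = c}" unfolding N_def by (subst AE_density) auto
    moreover have "{u. (u + b)\<^sup>2 = c} \<in> sets N" unfolding N_def by simp
    ultimately have "{u. (u + b)\<^sup>2 = c} \<in> null_sets N" using AE_iff_null_sets by blast
    then show ?thesis by (simp add: measure_def null_setsD1)
  qed
  have key: "measure N B \<le> measure N A \<and> (b \<noteq> 0 \<longrightarrow> 0 < c \<longrightarrow> measure N B < measure N A)" if c: "c \<ge> 0"
  proof -
    have k: "k \<ge> 0" "k\<^sup>2 = c" using c by (auto simp: k_def)
    have A: "A = {-k..k}" and B: "B = {-k-b..k-b}"
      unfolding A_def B_def k(2)[symmetric] using k(1) by (auto simp: abs_le_square_iff[symmetric])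
    have [measurable]: "A \<in> sets borel" "B \<in> sets borel" by (auto simp: A B)
    have iA: "integrable lborel (indicator A :: real \<Rightarrow> real)" and iB: "integrable lborel (indicator B :: real \<Rightarrow> real)"
      by (auto simp: A B emeasure_lborel_Icc_eq intro!: integrable_real_indicator)
    have eqAB: "(\<integral>u. indicator A u \<partial>lborel) = (\<integral>u. indicator B u \<partial>lborel :: real)"
      using k by (simp add: A B)
    have fA: "integrable lborel (\<lambda>u. ?f u * indicator A u)" and fB: "integrable lborel (\<lambda>u. ?f u * indicator B u)"
      using integrable_normal_moment[OF \<sigma>, of 0 0] by (auto intro!: integrable_real_mult_indicator)
    \<comment> \<open>Subtracting the density at the endpoint makes the integrand nonnegative
      everywhere. It changes no integral difference, since \<open>A\<close> and \<open>B\<close>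
      have equal length.\<close>
    let ?g = "\<lambda>u. (?f u - ?f k) * (indicator A u - indicator B u) :: real"
    have ig: "integrable lborel ?g"
      using fA fB iA iB by (simp add: left_diff_distrib right_diff_distrib)
    have g0: "0 \<le> ?g u" for u
      using mono[of u k] mono[of k u] k by (auto simp: A_def B_def indicator_def)
    have diff: "measure N A - measure N B = (\<integral>u. ?g u \<partial>lborel)"
    proof -
      have "(\<integral>u. ?g u \<partial>lborel) = (\<integral>u. ?f u * indicator A u - ?f u * indicator B u - (?f k * indicator A u - ?f k * indicator B u) \<partial>lborel)"
        by (intro Bochner_Integration.integral_cong) (auto simp: algebra_simps)
      also have "\<dots> = measure N A - measure N B"
        using fA fB iA iB eqAB by (simp add: meas)
      finally show ?thesis by simp
    qed
    have le: "measure N B \<le> measure N A" using diff g0 by (smt (verit) Bochner_Integration.integral_nonneg)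
    moreover have "measure N B \<noteq> measure N A" if b: "b \<noteq> 0" and c0: "0 < c"
    proof
      assume "measure N B = measure N A"
      then have "(\<integral>u. ?g u \<partial>lborel) = 0" using diff by simp
      then have ae: "AE u in lborel. ?g u = 0"
        using integral_nonneg_eq_0_iff_AE[OF ig] g0 by simp
      \<comment> \<open>Points inside the centred interval and outside the shifted one, strictly in
        both senses. The set is open, and \<open>?g\<close> is positive on it.\<close>
      define S where "S = {u. \<bar>u\<bar> < k \<and> k < \<bar>u + b\<bar>}"
      have k0: "k > 0" using c0 by (simp add: k_def)
      have "open S" unfolding S_def by (intro open_Collect_conj open_Collect_less continuous_intros)
      moreover have "S \<noteq> {}"
      proof (cases "b > 0")
        case True
        then have "k - min b k / 2 \<in> S" using k0 by (auto simp: S_def min_def abs_if field_simps)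
        then show ?thesis by blast
      next
        case False
        then have "- k + min (-b) k / 2 \<in> S" using k0 b by (auto simp: S_def min_def abs_if field_simps)
        then show ?thesis by blast
      qed
      ultimately have "\<not> negligible S" by (rule open_not_negligible)
      moreover have "S \<in> null_sets lborel"
      proof -
        have gpos: "?g u > 0" if "u \<in> S" for u
        proof -
          have "\<bar>u\<bar> < \<bar>k\<bar>" "\<bar>k\<bar> < \<bar>u + b\<bar>" using that k0 by (auto simp: S_def)
          then have "u\<^sup>2 < k\<^sup>2" "k\<^sup>2 < (u + b)\<^sup>2"
            using power_strict_mono[of "\<bar>u\<bar>" "\<bar>k\<bar>" 2] power_strict_mono[of "\<bar>k\<bar>" "\<bar>u + b\<bar>" 2] by simp_all
          then show ?thesis using smono[of u k] k by (auto simp: A_def B_def indicator_def)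
        qed
        have "AE u in lborel. u \<notin> S"
        proof (rule AE_mp[OF ae], intro AE_I2 impI notI)
          fix u assume "?g u = 0" "u \<in> S"
          then show False using gpos[of u] by linarith
        qed
        moreover have "S \<in> sets lborel" using \<open>open S\<close> by simp
        ultimately show ?thesis using AE_iff_null_sets by blast
      qed
      ultimately show False using negligible_iff_null_sets null_sets_completionI by blast
    qed
    ultimately show ?thesis by linarith
  qed
  show "measure N {u. (u + b)\<^sup>2 \<le> c} \<le> measure N {u. u\<^sup>2 \<le> c}"
  proof (cases "c \<ge> 0")
    case True then show ?thesis using key by (simp add: A_def B_def)
  next
    case False
    then have "{u. (u + b)\<^sup>2 \<le> c} = {}" by (auto simp: not_le intro: less_le_trans)
    then show ?thesis by simp
  qed
  show "b \<noteq> 0 \<Longrightarrow> 0 < c \<Longrightarrow> measure N {u. (u + b)\<^sup>2 \<le> c} < measure N {u. u\<^sup>2 \<le> c}"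
    using key by (simp add: A_def B_def)
qed

section \<open>Scalar Gaussian laws and quantiles\<close>

lemma char_gauss:
  assumes "v \<ge> 0"
  shows "(\<integral>u. iexp u \<partial>gauss v) = complex_of_real (exp (- v / 2))"
proof (cases "v = 0")
  case True
  then show ?thesis by (simp add: gauss_def integral_return)
next
  case False
  then have v: "v > 0" "sqrt v > 0" using assms by auto
  have "distributed std_normal_distribution lborel (\<lambda>x. x) std_normal_density"
    unfolding distributed_def by (auto intro: distr_id2)
  then have "distributed std_normal_distribution lborel (\<lambda>x. sqrt v * x) (normal_density 0 (sqrt v))"
    using prob_space.normal_standard_normal_convert[OF prob_space_normal_density[OF zero_less_one], of "sqrt v" 0 "\<lambda>x. sqrt v * x"] v
    by simp
  then have "density lborel (normal_density 0 (sqrt v)) = distr std_normal_distribution lborel (\<lambda>x. sqrt v * x)"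
    by (simp add: distributed_def)
  then have "(\<integral>u. iexp u \<partial>gauss v) = char std_normal_distribution (sqrt v)"
    using False by (simp add: gauss_def integral_distr char_def)
  also have "\<dots> = complex_of_real (exp (- v / 2))" using v by (simp add: char_std_normal_distribution)
  finally show ?thesis .
qed

text \<open>Without atoms the distribution function is continuous. The set that defines the quantile
  is then closed and attains its infimum, and any excess over \<open>q\<close> there would persist
  slightly to the left.\<close>

lemma measure_le_quantile:
  fixes f :: "'a \<Rightarrow> real"
  assumes M: "prob_space M" and f [measurable]: "f \<in> borel_measurable M"
    and atom: "\<And>t. measure M {x \<in> space M. f x = t} = 0" and q: "0 < q" "q < 1"
  shows "measure M {x \<in> space M. f x \<le> quantile M f q} = q"
proof -
  interpret M: prob_space M by fact
  let ?D = "distr M borel f"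
  interpret D: real_distribution ?D by (rule M.real_distribution_distr) fact
  have cdf: "cdf ?D t = measure M {x \<in> space M. f x \<le> t}" for t
    by (simp add: cdf_def measure_distr vimage_def Int_def conj_commute)
  have cont: "isCont (cdf ?D) t" for t
    using atom[of t] by (simp add: D.isCont_cdf measure_distr vimage_def Int_def conj_commute)
  define S where "S = {t. q \<le> cdf ?D t}"
  have z: "quantile M f q = Inf S" by (simp add: quantile_def S_def cdf)
  have "eventually (\<lambda>t. cdf ?D t > q) at_top" using D.cdf_lim_at_top_prob q(2) by (rule order_tendstoD)
  then obtain b where "cdf ?D b > q" by (auto simp: eventually_at_top_linorder)
  then have ne: "S \<noteq> {}" by (auto simp: S_def intro: less_imp_le)
  have "eventually (\<lambda>t. cdf ?D t < q) at_bot" using D.cdf_lim_at_bot q(1) by (rule order_tendstoD)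
  then obtain a where a: "\<And>t. t \<le> a \<Longrightarrow> cdf ?D t < q" by (auto simp: eventually_at_bot_linorder)
  have bdd: "bdd_below S"
  proof (rule bdd_belowI[of _ a])
    show "a \<le> t" if "t \<in> S" for t using a[of t] that by (cases "t \<le> a") (auto simp: S_def)
  qed
  have "closed S" unfolding S_def using cont
    by (intro closed_Collect_le continuous_on_const continuous_at_imp_continuous_on) auto
  from closed_contains_Inf[OF ne bdd this] have ge: "q \<le> cdf ?D (Inf S)" by (simp add: S_def)
  have "cdf ?D (Inf S) \<le> q"
  proof (rule ccontr)
    assume "\<not> cdf ?D (Inf S) \<le> q"
    then have "eventually (\<lambda>t. cdf ?D t > q) (at (Inf S))"
      using cont[of "Inf S"] by (intro order_tendstoD(1)) (auto simp: isCont_def)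
    then have "eventually (\<lambda>t. cdf ?D t > q) (at_left (Inf S))"
      by (rule filter_leD[OF at_le, rotated]) simp
    then obtain c where c: "c < Inf S" "\<And>t. c < t \<Longrightarrow> t < Inf S \<Longrightarrow> cdf ?D t > q"
      unfolding eventually_at_left_field by auto
    then obtain t where t: "c < t" "t < Inf S" using dense by blast
    then have "t \<in> S" using c(2) by (auto simp: S_def intro: less_imp_le)
    then show False using cInf_lower[OF _ bdd, of t] t by simp
  qed
  then show ?thesis using ge unfolding z cdf by simp
qed

text \<open>The law is prescribed by its one-dimensional marginals, which give the characteristic
  functional. Compactness of the covariance operator supplies the eigenvectors along which the law
  is split.\<close>

locale gaussian_on_hilbert = prob_space G + compact_positive_operator C Q c
  for G :: "'h::{real_inner,polish_space} measure" and C Q c +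
  fixes hb :: "nat \<Rightarrow> 'h"
  assumes onb: "padded_onb hb" and sets_G [measurable_cong]: "sets G = sets borel"
    and marginal: "distr G borel (\<lambda>x. inner x w) = gauss (inner (C w) w)"
begin

lemma char_G: "(\<integral>x. iexp (inner x w) \<partial>G) = complex_of_real (exp (- inner (C w) w / 2))"
proof -
  have "(\<integral>x. iexp (inner x w) \<partial>G) = (\<integral>u. iexp u \<partial>distr G borel (\<lambda>x. inner x w))"
    by (subst integral_distr) auto
  then show ?thesis using char_gauss[OF pos[of w]] by (simp add: marginal)
qed

lemma space_G: "space G = UNIV"
  using sets_eq_imp_space_eq[OF sets_G] by simp

definition ball_prob :: "'h \<Rightarrow> real \<Rightarrow> real" where
  "ball_prob a \<tau> = measure G {x. (norm (x + a))\<^sup>2 \<le> \<tau>}"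

text \<open>The target set stays general so that a single splitting formula serves balls, with
  \<open>{..\<tau>}\<close>, as well as spheres, with \<open>{\<tau>}\<close>.\<close>

definition axis_prob :: "'h \<Rightarrow> real \<Rightarrow> real set \<Rightarrow> real" where
  "axis_prob e b B = measure G {x. (inner x e + b)\<^sup>2 \<in> B}"

text \<open>An eigenvector \<open>e\<close> of the covariance splits \<open>G\<close> into the independent components
  along \<open>e\<close> and orthogonal to \<open>e\<close>.\<close>
lemma eigen_split:
  assumes e: "norm e = 1" and Ce: "C e = r *\<^sub>R e" and B [measurable]: "B \<in> sets borel"
  defines "P \<equiv> \<lambda>x. x - inner x e *\<^sub>R e"
  shows "measure G {x. (norm (x + a))\<^sup>2 \<in> B}
     = (\<integral>x'. axis_prob e (inner a e) {t. t + (norm (P (x' + a)))\<^sup>2 \<in> B} \<partial>G)"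
    and "(\<lambda>x'. axis_prob e (inner a e) {t. t + (norm (P (x' + a)))\<^sup>2 \<in> B}) \<in> borel_measurable G"
proof -
  interpret GG: pair_prob_space G G by unfold_locales
  have ee: "inner e e = 1" using e by (simp add: norm_eq_1)
  \<comment> \<open>The component along \<open>e\<close> is taken from one copy of \<open>G\<close>,
    the orthogonal component from an independent copy. The aim is that \<open>Y\<close> and
    \<open>x + a\<close> have the same characteristic functional.\<close>
  define Y where "Y z = inner (fst z) e *\<^sub>R e + P (snd z) + a" for z :: "'h \<times> 'h"
  have P [measurable]: "P \<in> borel_measurable borel" unfolding P_def by measurable
  have Y [measurable]: "Y \<in> borel_measurable (G \<Otimes>\<^sub>M G)" unfolding Y_def by measurable
  have Psym: "inner (P x) w = inner x (P w)" for x w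
    by (simp add: P_def inner_diff_left inner_diff_right inner_commute)
  have char_eq: "(\<integral>x. iexp (inner (x + a) w) \<partial>G) = (\<integral>z. iexp (inner (Y z) w) \<partial>(G \<Otimes>\<^sub>M G))" for w
  proof -
    \<comment> \<open>The eigenvector relation and symmetry kill the mixed terms of the quadratic
      form. This is where independence of the two components comes from.\<close>
    have Cw: "inner (C w) w = inner (C (inner e w *\<^sub>R e)) (inner e w *\<^sub>R e) + inner (C (P w)) (P w)"
    proof -
      have w: "w = inner e w *\<^sub>R e + P w" by (simp add: P_def inner_commute)
      have 0: "inner e (P w) = 0" by (simp add: P_def inner_diff_right ee inner_commute)
      have 1: "inner (C (inner e w *\<^sub>R e)) (P w) = 0" by (simp add: C_scaleR Ce 0)
      have 2: "inner (C (P w)) (inner e w *\<^sub>R e) = 0" by (simp add: selfadj[of "P w"] C_scaleR Ce 0 inner_commute[of "P w"])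
      have "inner (C w) w = inner (C (inner e w *\<^sub>R e + P w)) (inner e w *\<^sub>R e + P w)" using w by simp
      also have "\<dots> = inner (C (inner e w *\<^sub>R e)) (inner e w *\<^sub>R e) + inner (C (P w)) (P w)"
        unfolding C_add inner_add_left inner_add_right 1 2 by simp
      finally show ?thesis .
    qed
    have i: "integrable G (\<lambda>x. iexp (inner x u))" for u
      by (rule integrable_const_bound[where B=1]) auto
    have "(\<integral>z. iexp (inner (Y z) w) \<partial>(G \<Otimes>\<^sub>M G))
      = (\<integral>z. iexp (inner a w) * (iexp (inner (fst z) (inner e w *\<^sub>R e)) * iexp (inner (snd z) (P w))) \<partial>(G \<Otimes>\<^sub>M G))"
      by (intro Bochner_Integration.integral_cong refl)
         (simp add: Y_def inner_add_left Psym mult_exp_exp algebra_simps)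
    also have "\<dots> = iexp (inner a w) * (\<integral>z. iexp (inner (fst z) (inner e w *\<^sub>R e)) * iexp (inner (snd z) (P w)) \<partial>(G \<Otimes>\<^sub>M G))"
      by (rule integral_mult_right_zero)
    also have "(\<integral>z. iexp (inner (fst z) (inner e w *\<^sub>R e)) * iexp (inner (snd z) (P w)) \<partial>(G \<Otimes>\<^sub>M G))
      = (\<integral>x. (\<integral>y. iexp (inner x (inner e w *\<^sub>R e)) * iexp (inner y (P w)) \<partial>G) \<partial>G)"
    proof (rule GG.integral_fst'[symmetric, of "\<lambda>z. iexp (inner (fst z) (inner e w *\<^sub>R e)) * iexp (inner (snd z) (P w))", simplified fst_conv snd_conv])
      show "integrable (G \<Otimes>\<^sub>M G) (\<lambda>z. iexp (inner (fst z) (inner e w *\<^sub>R e)) * iexp (inner (snd z) (P w)))"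
        by (rule GG.integrable_const_bound[where B=1]) (auto simp: norm_mult)
    qed
    also have "\<dots> = (\<integral>x. iexp (inner x (inner e w *\<^sub>R e)) \<partial>G) * (\<integral>y. iexp (inner y (P w)) \<partial>G)"
      by (simp only: integral_mult_right_zero integral_mult_left_zero)
    also have "\<dots> = (\<integral>x. iexp (inner x w) \<partial>G)"
      unfolding char_G Cw of_real_mult[symmetric] by (simp add: exp_add[symmetric] add_divide_distrib)
    also have "iexp (inner a w) * (\<integral>x. iexp (inner x w) \<partial>G) = (\<integral>x. iexp (inner a w) * iexp (inner x w) \<partial>G)"
      by (rule integral_mult_right_zero[symmetric])
    also have "\<dots> = (\<integral>x. iexp (inner (x + a) w) \<partial>G)"
      by (simp add: mult_exp_exp inner_add_left algebra_simps)
    finally show ?thesis by simp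
  qed
  have nY: "(norm (Y z))\<^sup>2 = (inner (fst z) e + inner a e)\<^sup>2 + (norm (P (snd z + a)))\<^sup>2" for z
  proof -
    have Yz: "Y z = (inner (fst z) e + inner a e) *\<^sub>R e + P (snd z + a)"
      by (simp add: Y_def P_def inner_add_left algebra_simps)
    have 0: "inner e (P x) = 0" "inner (P x) e = 0" for x
      by (simp_all add: P_def inner_diff_right inner_diff_left ee inner_commute)
    show ?thesis unfolding Yz power2_norm_eq_inner
      by (simp add: inner_add_left inner_add_right 0 ee power2_eq_square)
  qed
  have law: "distr G borel (\<lambda>x. (norm (x + a))\<^sup>2) = distr (G \<Otimes>\<^sub>M G) borel (\<lambda>z. (norm (Y z))\<^sup>2)"
    by (rule norm_law_eq[OF onb _ _ _ _ char_eq]) (unfold_locales, auto)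
  define h where "h z = (indicator B ((inner (fst z) e + inner a e)\<^sup>2 + (norm (P (snd z + a)))\<^sup>2) :: real)" for z :: "'h \<times> 'h"
  have h [measurable]: "h \<in> borel_measurable (G \<Otimes>\<^sub>M G)" unfolding h_def by measurable
  have ih: "integrable (G \<Otimes>\<^sub>M G) (\<lambda>(x, y). h (x, y))"
    by (rule GG.integrable_const_bound[where B=1]) (auto simp: h_def)
  have inner_int: "(\<integral>x. h (x, y) \<partial>G) = axis_prob e (inner a e) {t. t + (norm (P (y + a)))\<^sup>2 \<in> B}" for y
  proof -
    have "(\<integral>x. h (x, y) \<partial>G) = (\<integral>x. indicator {x. (inner x e + inner a e)\<^sup>2 + (norm (P (y + a)))\<^sup>2 \<in> B} x \<partial>G)"
      by (simp add: h_def indicator_def)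
    also have "\<dots> = measure G ({x. (inner x e + inner a e)\<^sup>2 + (norm (P (y + a)))\<^sup>2 \<in> B} \<inter> space G)"
      by (rule Bochner_Integration.integral_indicator)
    finally show ?thesis by (simp add: axis_prob_def space_G)
  qed
  have "measure G {x. (norm (x + a))\<^sup>2 \<in> B} = measure (distr G borel (\<lambda>x. (norm (x + a))\<^sup>2)) B"
    by (subst measure_distr) (auto simp: vimage_def space_G)
  also have "\<dots> = measure (G \<Otimes>\<^sub>M G) {z \<in> space (G \<Otimes>\<^sub>M G). (norm (Y z))\<^sup>2 \<in> B}"
    unfolding law by (subst measure_distr) (auto simp: vimage_def Int_def conj_commute)
  also have "\<dots> = (\<integral>z. indicator {z \<in> space (G \<Otimes>\<^sub>M G). (norm (Y z))\<^sup>2 \<in> B} z \<partial>(G \<Otimes>\<^sub>M G))"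
    by (subst Bochner_Integration.integral_indicator) (auto intro!: arg_cong[where f="measure _"])
  also have "\<dots> = (\<integral>z. h z \<partial>(G \<Otimes>\<^sub>M G))"
    by (rule Bochner_Integration.integral_cong) (auto simp: h_def nY indicator_def)
  also have "\<dots> = (\<integral>y. (\<integral>x. h (x, y) \<partial>G) \<partial>G)"
    using GG.integral_snd[of "\<lambda>x y. h (x, y)", OF ih] by simp
  finally show "measure G {x. (norm (x + a))\<^sup>2 \<in> B}
     = (\<integral>x'. axis_prob e (inner a e) {t. t + (norm (P (x' + a)))\<^sup>2 \<in> B} \<partial>G)" by (simp add: inner_int)
  have "(\<lambda>y. \<integral>x. h (x, y) \<partial>G) \<in> borel_measurable G" by measurable
  then show "(\<lambda>x'. axis_prob e (inner a e) {t. t + (norm (P (x' + a)))\<^sup>2 \<in> B}) \<in> borel_measurable G" by (simp add: inner_int)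
qed

section \<open>Deleting the shift along one eigenvector\<close>

context
  fixes e :: 'h and r :: real
  assumes e: "norm e = 1" and r: "0 < r" and Ce: "C e = r *\<^sub>R e"
begin

lemma axis_prob_normal:
  assumes "{u. (u + b)\<^sup>2 \<in> B} \<in> sets borel"
  shows "axis_prob e b B = measure (density lborel (normal_density 0 (sqrt r))) {u. (u + b)\<^sup>2 \<in> B}"
proof -
  have "inner (C e) e = r" using e by (simp add: Ce norm_eq_1)
  then have "density lborel (normal_density 0 (sqrt r)) = distr G borel (\<lambda>x. inner x e)"
    using marginal[of e] r by (simp add: gauss_def)
  then show ?thesis using assms by (simp add: axis_prob_def measure_distr vimage_def space_G)
qed

lemma axis_prob_shift:
  "axis_prob e b {..\<tau>} \<le> axis_prob e 0 {..\<tau>}"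
  "b \<noteq> 0 \<Longrightarrow> 0 < \<tau> \<Longrightarrow> axis_prob e b {..\<tau>} < axis_prob e 0 {..\<tau>}"
  "axis_prob e b {\<tau>} = 0"
  using normal_interval_shift[of "sqrt r" b \<tau>] r by (simp_all add: axis_prob_normal)

text \<open>Given the orthogonal part, the component along \<open>e\<close> would have to satisfy an
  equation with at most two solutions, and its law is a nondegenerate normal.\<close>

lemma norm_no_atom: "measure G {x. (norm (x + a))\<^sup>2 = \<tau>} = 0"
proof -
  have "{t. t + k \<in> {\<tau>}} = {\<tau> - k}" for k :: real by auto
  then show ?thesis using eigen_split(1)[OF e Ce, of "{\<tau>}" a] by (simp add: axis_prob_shift)
qed

lemma ball_prob_split:
  "ball_prob a \<tau> = (\<integral>x'. axis_prob e (inner a e) {..\<tau> - (norm (x' + a - inner (x' + a) e *\<^sub>R e))\<^sup>2} \<partial>G)"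
  "(\<lambda>x'. axis_prob e (inner a e) {..\<tau> - (norm (x' + a - inner (x' + a) e *\<^sub>R e))\<^sup>2}) \<in> borel_measurable G"
proof -
  have "{t. t + k \<in> {..\<tau>}} = {..\<tau> - k}" for k :: real by auto
  then show "ball_prob a \<tau> = (\<integral>x'. axis_prob e (inner a e) {..\<tau> - (norm (x' + a - inner (x' + a) e *\<^sub>R e))\<^sup>2} \<partial>G)"
    "(\<lambda>x'. axis_prob e (inner a e) {..\<tau> - (norm (x' + a - inner (x' + a) e *\<^sub>R e))\<^sup>2}) \<in> borel_measurable G"
    using eigen_split[OF e Ce, of "{..\<tau>}" a] by (simp_all add: ball_prob_def)
qed

text \<open>Given the orthogonal part, \<open>T\<close> is the squared radius left for the component
  along \<open>e\<close>, and the interval comparison is integrated over that part. Equality would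
  force \<open>T \<le> 0\<close> almost surely, so the ball without the shift component would be
  null.\<close>

lemma ball_prob_remove_component:
  defines "a' \<equiv> \<lambda>a. a - inner a e *\<^sub>R e"
  shows "ball_prob a \<tau> \<le> ball_prob (a' a) \<tau>"
    and "inner a e \<noteq> 0 \<Longrightarrow> 0 < ball_prob (a' a) \<tau> \<Longrightarrow> ball_prob a \<tau> < ball_prob (a' a) \<tau>"
proof -
  have ee: "inner e e = 1" using e by (simp add: norm_eq_1)
  define T where "T x = \<tau> - (norm (x + a - inner (x + a) e *\<^sub>R e))\<^sup>2" for x
  have a'e: "inner (a' a) e = 0" by (simp add: a'_def inner_diff_left ee)
  have T': "\<tau> - (norm (x + a' a - inner (x + a' a) e *\<^sub>R e))\<^sup>2 = T x" for x
    by (simp add: T_def a'_def inner_diff_left inner_add_left ee algebra_simps)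
  have Fa: "ball_prob a \<tau> = (\<integral>x. axis_prob e (inner a e) {..T x} \<partial>G)" "(\<lambda>x. axis_prob e (inner a e) {..T x}) \<in> borel_measurable G"
    using ball_prob_split[of a \<tau>] by (simp_all add: T_def)
  have Fa': "ball_prob (a' a) \<tau> = (\<integral>x. axis_prob e 0 {..T x} \<partial>G)" "(\<lambda>x. axis_prob e 0 {..T x}) \<in> borel_measurable G"
    using ball_prob_split[of "a' a" \<tau>] unfolding a'e T' by simp_all
  have prob01: "0 \<le> axis_prob e b B" "axis_prob e b B \<le> 1" for b B by (simp_all add: axis_prob_def)
  have i: "integrable G (\<lambda>x. axis_prob e (inner a e) {..T x})"
    by (rule integrable_const_bound[where B=1]) (use Fa prob01 in auto)
  have i': "integrable G (\<lambda>x. axis_prob e 0 {..T x})"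
    by (rule integrable_const_bound[where B=1]) (use Fa' prob01 in auto)
  show le: "ball_prob a \<tau> \<le> ball_prob (a' a) \<tau>" unfolding Fa Fa' by (rule integral_mono[OF i i']) (rule axis_prob_shift)
  assume b: "inner a e \<noteq> 0" and F0: "0 < ball_prob (a' a) \<tau>"
  have "ball_prob a \<tau> \<noteq> ball_prob (a' a) \<tau>"
  proof
    assume eq: "ball_prob a \<tau> = ball_prob (a' a) \<tau>"
    then have "(\<integral>x. axis_prob e 0 {..T x} - axis_prob e (inner a e) {..T x} \<partial>G) = 0"
      using i i' Fa(1) Fa'(1) by simp
    then have "AE x in G. axis_prob e 0 {..T x} - axis_prob e (inner a e) {..T x} = 0"
      by (subst (asm) integral_nonneg_eq_0_iff_AE) (use i i' axis_prob_shift(1) in auto)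
    \<comment> \<open>Where the two axis probabilities agree, the strict interval comparison
      excludes \<open>T x > 0\<close>. At most one point of the axis is then admissible, and it has
      no mass.\<close>
    then have "AE x in G. axis_prob e 0 {..T x} = 0"
    proof (rule AE_mp, intro AE_I2 impI)
      fix x assume "axis_prob e 0 {..T x} - axis_prob e (inner a e) {..T x} = 0"
      then have "T x \<le> 0" using axis_prob_shift(2)[OF b, of "T x"] by force
      then have "{z. (inner z e + 0)\<^sup>2 \<in> {..T x}} \<subseteq> {z. (inner z e + 0)\<^sup>2 \<in> {0}}"
        by (auto, metis order_trans power2_less_eq_zero_iff)
      then have "axis_prob e 0 {..T x} \<le> axis_prob e 0 {0}" unfolding axis_prob_def
        by (rule finite_measure_mono) auto
      then show "axis_prob e 0 {..T x} = 0" using prob01(1)[of 0 "{..T x}"] by (simp add: axis_prob_shift(3))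
    qed
    then have "ball_prob (a' a) \<tau> = 0" unfolding Fa' by (rule integral_eq_zero_AE)
    then show False using F0 by simp
  qed
  then show "ball_prob a \<tau> < ball_prob (a' a) \<tau>" using le by simp
qed

end

text \<open>Upper semicontinuity of the ball probability at a vanishing shift: the shifted balls are
  eventually contained in centred balls of slightly larger radius, which decrease to the closed
  ball.\<close>

lemma ball_prob_limsup:
  assumes d: "d \<longlonglongrightarrow> 0" and le: "\<And>j. k \<le> ball_prob (d j) \<tau>"
  shows "k \<le> ball_prob 0 \<tau>"
proof (cases "\<tau> < 0")
  case True
  have "{x. (norm (x + d 0))\<^sup>2 \<le> \<tau>} = {}" using True by (auto simp: not_le intro: less_le_trans)
  then have "ball_prob (d 0) \<tau> = 0" by (simp add: ball_prob_def)
  then show ?thesis using le[of 0] by (simp add: ball_prob_def order_trans)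
next
  case False
  define A where "A n = {x :: 'h. norm x \<le> sqrt \<tau> + 1 / real (Suc n)}" for n
  have A0: "{x. (norm x)\<^sup>2 \<le> \<tau>} = {x :: 'h. norm x \<le> sqrt \<tau>}"
    using False by (auto simp: real_le_rsqrt sqrt_ge_absD dest: power_mono[where n=2])
  have "(\<Inter>n. A n) = {x. norm x \<le> sqrt \<tau>}"
  proof (intro set_eqI iffI)
    fix x assume x: "x \<in> (\<Inter>n. A n)"
    have "(\<lambda>n. sqrt \<tau> + 1 / real (Suc n)) \<longlonglongrightarrow> sqrt \<tau> + 0"
      by (intro tendsto_add tendsto_const LIMSEQ_Suc[OF lim_1_over_n])
    then have "norm x \<le> sqrt \<tau>" using x by (intro LIMSEQ_le_const) (auto simp: A_def)
    then show "x \<in> {x. norm x \<le> sqrt \<tau>}" by simp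
  next
    fix x :: 'h assume "x \<in> {x. norm x \<le> sqrt \<tau>}"
    then show "x \<in> (\<Inter>n. A n)" by (auto simp: A_def intro: order_trans)
  qed
  moreover have "decseq A"
  proof (intro decseq_SucI subsetI)
    fix n x assume "x \<in> A (Suc n)"
    moreover have "1 / real (Suc (Suc n)) \<le> 1 / real (Suc n)" by (simp add: frac_le)
    ultimately show "x \<in> A n" by (auto simp: A_def)
  qed
  moreover have "range A \<subseteq> sets G" by (auto simp: A_def sets_G)
  ultimately have lim: "(\<lambda>n. measure G (A n)) \<longlonglongrightarrow> measure G {x. norm x \<le> sqrt \<tau>}"
    using finite_Lim_measure_decseq[of A] by simp
  have "k \<le> measure G (A n)" for n
  proof -
    have "eventually (\<lambda>j. dist (d j) 0 < 1 / real (Suc n)) sequentially"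
      using d by (rule tendstoD) simp
    then obtain j where j: "norm (d j) < 1 / real (Suc n)" by (auto simp: eventually_sequentially)
    have "{x. (norm (x + d j))\<^sup>2 \<le> \<tau>} \<subseteq> A n"
    proof
      fix x assume "x \<in> {x. (norm (x + d j))\<^sup>2 \<le> \<tau>}"
      then have "norm (x + d j) \<le> sqrt \<tau>" by (auto intro: real_le_rsqrt)
      moreover have "norm x \<le> norm (x + d j) + norm (d j)" using norm_triangle_ineq4[of "x + d j" "d j"] by simp
      ultimately show "x \<in> A n" using j by (simp add: A_def)
    qed
    then have "ball_prob (d j) \<tau> \<le> measure G (A n)" unfolding ball_prob_def
      by (rule finite_measure_mono) (simp add: A_def sets_G)
    then show ?thesis using le[of j] by simp
  qed
  then have "k \<le> measure G {x. norm x \<le> sqrt \<tau>}" by (intro LIMSEQ_le_const[OF lim]) auto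
  then show ?thesis by (simp add: ball_prob_def A0)
qed

lemma ex_unit_eigenvector:
  assumes "C a \<noteq> 0" obtains e r where "norm e = 1" "0 < r" "C e = r *\<^sub>R e"
  using ex_eigenvector[OF assms] by blast

text \<open>Strictness is taken from the first deletion alone; the later ones only have to preserve
  the inequality up to the limit. If the ball after the first deletion is null, positivity of the
  centred ball gives strictness directly.\<close>

theorem strict_Anderson_ball:
  assumes C\<delta>: "C \<delta> \<noteq> 0" and ker: "\<And>w. C w = 0 \<Longrightarrow> inner \<delta> w = 0" and F0: "0 < ball_prob 0 \<tau>"
  shows "ball_prob \<delta> \<tau> < ball_prob 0 \<tau>"
proof -
  obtain d d' where d0: "d 0 = \<delta>" and lim: "d \<longlonglongrightarrow> d'" and Cd': "C d' = 0"
    and step: "\<And>j. if C (d j) = 0 then d (Suc j) = d j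
       else \<exists>e r. norm e = 1 \<and> 0 < r \<and> C e = r *\<^sub>R e \<and> inner (d j) e \<noteq> 0 \<and> d (Suc j) = d j - inner (d j) e *\<^sub>R e"
    using deflation[of \<delta>] by blast
  have kerj: "inner (d j) w = 0" if w: "C w = 0" for j w
  proof (induction j)
    case 0 then show ?case using ker[OF w] by (simp add: d0)
  next
    case (Suc j)
    show ?case
    proof (cases "C (d j) = 0")
      case True then show ?thesis using step[of j] Suc by simp
    next
      case False
      then obtain e r where e: "0 < r" "C e = r *\<^sub>R e" "d (Suc j) = d j - inner (d j) e *\<^sub>R e" using step[of j] by auto
      have "r * inner e w = inner e (C w)" using selfadj[of e w] by (simp add: e(2))
      then have "inner e w = 0" using w e(1) by simp
      then show ?thesis using Suc by (simp add: e(3) inner_diff_left)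
    qed
  qed
  \<comment> \<open>The limiting residual lies in the kernel of \<open>C\<close> and is orthogonal
    to that kernel, hence zero.\<close>
  have "(\<lambda>j. inner (d j) d') \<longlonglongrightarrow> inner d' d'" by (intro tendsto_intros lim)
  then have "inner d' d' = 0" by (simp add: kerj[OF Cd'] LIMSEQ_const_iff)
  then have d'0: "d' = 0" by simp
  have mono: "ball_prob (d j) \<tau> \<le> ball_prob (d (Suc j)) \<tau>" for j
  proof (cases "C (d j) = 0")
    case False
    then obtain e r where "norm e = 1" "0 < r" "C e = r *\<^sub>R e" "d (Suc j) = d j - inner (d j) e *\<^sub>R e" using step[of j] by auto
    then show ?thesis using ball_prob_remove_component(1)[of e r "d j" \<tau>] by simp
  qed (use step[of j] in simp)
  have "ball_prob (d 1) \<tau> \<le> ball_prob (d (Suc j)) \<tau>" for j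
    by (induction j) (auto intro: order_trans[OF _ mono])
  then have le: "ball_prob (d 1) \<tau> \<le> ball_prob 0 \<tau>"
    using ball_prob_limsup[of "\<lambda>j. d (Suc j)"] LIMSEQ_Suc[OF lim] d'0 by blast
  show ?thesis
  proof (cases "0 < ball_prob (d 1) \<tau>")
    case True
    obtain e r where "norm e = 1" "0 < r" "C e = r *\<^sub>R e" "inner (d 0) e \<noteq> 0" "d 1 = d 0 - inner (d 0) e *\<^sub>R e"
      using step[of 0] C\<delta> by (auto simp: d0)
    then have "ball_prob (d 0) \<tau> < ball_prob (d 1) \<tau>" using ball_prob_remove_component(2)[of e r "d 0" \<tau>] True by simp
    then show ?thesis using le by (simp add: d0)
  next
    case False
    then show ?thesis using mono[of 0] F0 by (simp add: d0)
  qed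
qed

end

section \<open>Asymptotically linear estimators along a submodel\<close>

text \<open>A Slutsky argument: outside a rare event the random threshold lies within
  \<open>e\<close> of \<open>\<zeta>\<close>, and the Laplace sandwich bounds the two neighbouring
  deterministic thresholds. Absence of an atom at \<open>\<zeta>\<close> makes the bounds
  meet.\<close>

lemma converging_cdf_random_threshold:
  fixes T z :: "nat \<Rightarrow> 'a \<Rightarrow> real" and X :: "'b \<Rightarrow> real"
  assumes M: "\<And>n. prob_space (M n)" and N: "prob_space N"
    and T [measurable]: "\<And>n. T n \<in> borel_measurable (M n)" and X [measurable]: "X \<in> borel_measurable N"
    and z [measurable]: "\<And>n. z n \<in> borel_measurable (M n)"
    and T0: "\<And>n x. T n x \<ge> 0" and X0: "\<And>x. X x \<ge> 0"
    and lim: "\<And>m::nat. (\<lambda>n. \<integral>x. exp (- (real m * T n x)) \<partial>M n) \<longlonglongrightarrow> (\<integral>x. exp (- (real m * X x)) \<partial>N)"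
    and zlim: "\<And>e. e > 0 \<Longrightarrow> (\<lambda>n. measure (M n) {x \<in> space (M n). \<bar>z n x - \<zeta>\<bar> > e}) \<longlonglongrightarrow> 0"
    and atom: "measure N {x \<in> space N. X x = \<zeta>} = 0"
  shows "(\<lambda>n. measure (M n) {x \<in> space (M n). T n x > z n x}) \<longlonglongrightarrow> measure N {x \<in> space N. X x > \<zeta>}"
proof -
  interpret N: prob_space N by fact
  let ?D = "distr N borel X"
  interpret D: real_distribution ?D by (rule N.real_distribution_distr) fact
  have cdf: "cdf ?D t = measure N {x \<in> space N. X x \<le> t}" for t
    by (simp add: cdf_def measure_distr vimage_def Int_def conj_commute)
  have cont: "isCont (cdf ?D) \<zeta>"
    using atom by (simp add: D.isCont_cdf measure_distr vimage_def Int_def conj_commute)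
  have le: "(\<lambda>n. measure (M n) {x \<in> space (M n). T n x \<le> z n x}) \<longlonglongrightarrow> cdf ?D \<zeta>"
  proof (rule tendstoI)
    fix \<epsilon> :: real assume \<epsilon>: "\<epsilon> > 0"
    then obtain d where d: "d > 0" "\<And>t. \<bar>t - \<zeta>\<bar> < d \<Longrightarrow> \<bar>cdf ?D t - cdf ?D \<zeta>\<bar> < \<epsilon> / 2"
      using cont[unfolded continuous_at_eps_delta, rule_format, of "\<epsilon> / 2"] by (auto simp: dist_real_def)
    \<comment> \<open>One \<open>e\<close> is spent on the random threshold and another on the gap
      of the sandwich; \<open>2 * e\<close> still lies within the continuity window
      \<open>d\<close>.\<close>
    define e where "e = d / 3"
    have e: "e > 0" "2 * e < d" using d(1) by (auto simp: e_def)
    have up: "\<zeta> + e < \<zeta> + 2 * e" and dn: "\<zeta> - 2 * e < \<zeta> - e" using e by auto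
    obtain c l where c: "c \<longlonglongrightarrow> l" "\<And>n. measure (M n) {x \<in> space (M n). T n x \<le> \<zeta> + e} \<le> c n"
      "l \<le> measure N {x \<in> space N. X x \<le> \<zeta> + 2 * e}"
      by (rule laplace_convergence_sandwich[OF M N T X T0 X0 lim up]) (rule that)
    obtain c' l' where c': "c' \<longlonglongrightarrow> l'" "\<And>n. c' n \<le> measure (M n) {x \<in> space (M n). T n x \<le> \<zeta> - e}"
      "measure N {x \<in> space N. X x \<le> \<zeta> - 2 * e} \<le> l'"
      by (rule laplace_convergence_sandwich[OF M N T X T0 X0 lim dn]) (rule that)
    have "\<bar>cdf ?D (\<zeta> + 2 * e) - cdf ?D \<zeta>\<bar> < \<epsilon> / 2" "\<bar>cdf ?D (\<zeta> - 2 * e) - cdf ?D \<zeta>\<bar> < \<epsilon> / 2"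
      by (rule d(2), use e in simp)+
    then have l: "l < cdf ?D \<zeta> + \<epsilon> / 2" and l': "l' > cdf ?D \<zeta> - \<epsilon> / 2"
      using c(3) c'(3) unfolding cdf[symmetric] by linarith+
    have ev: "eventually (\<lambda>n. c n < cdf ?D \<zeta> + \<epsilon> / 2) sequentially" "eventually (\<lambda>n. c' n > cdf ?D \<zeta> - \<epsilon> / 2) sequentially"
      "eventually (\<lambda>n. measure (M n) {x \<in> space (M n). \<bar>z n x - \<zeta>\<bar> > e} < \<epsilon> / 2) sequentially"
      using order_tendstoD(2)[OF c(1) l] order_tendstoD(1)[OF c'(1) l'] order_tendstoD(2)[OF zlim[OF e(1)], of "\<epsilon> / 2"] \<epsilon> by auto
    show "eventually (\<lambda>n. dist (measure (M n) {x \<in> space (M n). T n x \<le> z n x}) (cdf ?D \<zeta>) < \<epsilon>) sequentially"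
      using ev
    proof eventually_elim
      fix n assume a: "c n < cdf ?D \<zeta> + \<epsilon> / 2" "c' n > cdf ?D \<zeta> - \<epsilon> / 2"
        "measure (M n) {x \<in> space (M n). \<bar>z n x - \<zeta>\<bar> > e} < \<epsilon> / 2"
      interpret M: prob_space "M n" by (rule M)
      let ?E = "{x \<in> space (M n). \<bar>z n x - \<zeta>\<bar> > e}"
      have "measure (M n) {x \<in> space (M n). T n x \<le> z n x} \<le> measure (M n) ({x \<in> space (M n). T n x \<le> \<zeta> + e} \<union> ?E)"
        by (rule M.finite_measure_mono) auto
      also have "\<dots> \<le> measure (M n) {x \<in> space (M n). T n x \<le> \<zeta> + e} + measure (M n) ?E"
        by (rule measure_Un_le) auto
      finally have 1: "measure (M n) {x \<in> space (M n). T n x \<le> z n x} < cdf ?D \<zeta> + \<epsilon>"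
        using a c(2)[of n] by simp
      have "measure (M n) {x \<in> space (M n). T n x \<le> \<zeta> - e} \<le> measure (M n) ({x \<in> space (M n). T n x \<le> z n x} \<union> ?E)"
        by (rule M.finite_measure_mono) auto
      also have "\<dots> \<le> measure (M n) {x \<in> space (M n). T n x \<le> z n x} + measure (M n) ?E"
        by (rule measure_Un_le) auto
      finally have 2: "measure (M n) {x \<in> space (M n). T n x \<le> z n x} > cdf ?D \<zeta> - \<epsilon>"
        using a c'(2)[of n] by simp
      show "dist (measure (M n) {x \<in> space (M n). T n x \<le> z n x}) (cdf ?D \<zeta>) < \<epsilon>"
        using 1 2 by (simp add: dist_real_def abs_less_iff)
    qed
  qed
  have compl: "measure L {x \<in> space L. g x < f x} = 1 - measure L {x \<in> space L. f x \<le> g x}"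
    if "prob_space L" and [measurable]: "f \<in> borel_measurable L" "g \<in> borel_measurable L" for L :: "'c measure" and f g :: "'c \<Rightarrow> real"
  proof -
    interpret L: prob_space L by fact
    have "{x \<in> space L. g x < f x} = space L - {x \<in> space L. f x \<le> g x}" by auto
    then show ?thesis by (simp add: L.prob_compl)
  qed
  have "(\<lambda>n. 1 - measure (M n) {x \<in> space (M n). T n x \<le> z n x}) \<longlonglongrightarrow> 1 - cdf ?D \<zeta>"
    by (intro tendsto_intros le)
  then show ?thesis by (simp add: compl[OF M T z] compl[OF N X] cdf)
qed

text \<open>By the mean value theorem,
  \<open>2 * m * \<bar>x\<bar> * exp (- (m * x\<^sup>2))\<close> has to be bounded. The estimate
  \<open>exp y \<ge> 1 + y\<close> reduces this to a polynomial inequality that holds by writing the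
  difference as a sum of squares.\<close>

lemma exp_square_lipschitz:
  fixes a b m :: real
  assumes m: "0 \<le> m" shows "\<bar>exp (- (m * a\<^sup>2)) - exp (- (m * b\<^sup>2))\<bar> \<le> (m + 1) * \<bar>a - b\<bar>"
proof -
  have *: "\<bar>exp (- (m * a\<^sup>2)) - exp (- (m * b\<^sup>2))\<bar> \<le> (m + 1) * \<bar>a - b\<bar>" if ab: "a < b" for a b
  proof -
    have der: "((\<lambda>x. exp (- (m * x\<^sup>2))) has_real_derivative (exp (- (m * x\<^sup>2)) * (- (m * (2 * x))))) (at x)" for x
      by (auto intro!: derivative_eq_intros)
    obtain x where x: "exp (- (m * b\<^sup>2)) - exp (- (m * a\<^sup>2)) = (b - a) * (exp (- (m * x\<^sup>2)) * (- (m * (2 * x))))"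
      using MVT2[OF ab der] by auto
    have "2 * m * \<bar>x\<bar> \<le> (m + 1) * (1 + m * x\<^sup>2)"
    proof -
      have "0 \<le> 1 + m * (1 - \<bar>x\<bar>)\<^sup>2 + m\<^sup>2 * x\<^sup>2" using m by simp
      also have "\<dots> = (m + 1) * (1 + m * x\<^sup>2) - 2 * m * \<bar>x\<bar>"
        by (simp add: power2_eq_square algebra_simps flip: abs_mult)
      finally show ?thesis by simp
    qed
    also have "\<dots> \<le> (m + 1) * exp (m * x\<^sup>2)" using m by (intro mult_left_mono) auto
    finally have "exp (- (m * x\<^sup>2)) * (2 * m * \<bar>x\<bar>) \<le> m + 1"
      by (simp add: exp_minus field_simps)
    then have "\<bar>exp (- (m * x\<^sup>2)) * (- (m * (2 * x)))\<bar> \<le> m + 1" using m by (simp add: abs_mult mult_ac)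
    then have "\<bar>(b - a) * (exp (- (m * x\<^sup>2)) * (- (m * (2 * x))))\<bar> \<le> \<bar>b - a\<bar> * (m + 1)"
      unfolding abs_mult[of "b - a"] by (rule mult_left_mono) simp
    then show ?thesis using x by (simp add: abs_minus_commute mult.commute)
  qed
  show ?thesis using *[of a b] *[of b a] by (cases a b rule: linorder_cases) (auto simp: abs_minus_commute)
qed

lemma PiM_sum_second_moment:
  fixes g :: "'a \<Rightarrow> real"
  assumes P: "prob_space P" and [measurable]: "g \<in> borel_measurable P"
    and g2: "integrable P (\<lambda>x. (g x)\<^sup>2)" and g0: "(\<integral>x. g x \<partial>P) = 0"
  shows "integrable (PiM {..<n} (\<lambda>_. P)) (\<lambda>\<omega>. (\<Sum>i<n. g (\<omega> i))\<^sup>2)"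
    "(\<integral>\<omega>. (\<Sum>i<n. g (\<omega> i))\<^sup>2 \<partial>PiM {..<n} (\<lambda>_. P)) = real n * (\<integral>x. (g x)\<^sup>2 \<partial>P)"
proof -
  interpret P: prob_space P by fact
  interpret S: product_sigma_finite "\<lambda>_::nat. P" by unfold_locales
  have g1: "integrable P g"
    using integrable_mult_square[of g P "\<lambda>_. 1"] g2 by simp
  define I where "I i j = (if i = j then (\<integral>x. (g x)\<^sup>2 \<partial>P) else 0)" for i j :: nat
  have ij: "integrable (PiM {..<n} (\<lambda>_. P)) (\<lambda>\<omega>. g (\<omega> i) * g (\<omega> j))"
    "(\<integral>\<omega>. g (\<omega> i) * g (\<omega> j) \<partial>PiM {..<n} (\<lambda>_. P)) = I i j" if "i < n" "j < n" for i j
  proof -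
    \<comment> \<open>Writes \<open>g (\<omega> i) * g (\<omega> j)\<close> as a product over all
      coordinates, with factor 1 off \<open>i\<close> and \<open>j\<close>, so that one formula for
      product integrals covers the diagonal and the vanishing off-diagonal terms.\<close>
    define f where "f l = (if l = i \<and> l = j then (\<lambda>x. (g x)\<^sup>2) else if l = i \<or> l = j then g else (\<lambda>_. 1))" for l
    have f: "integrable P (f l)" for l using g1 g2 by (simp add: f_def)
    have eq: "(\<lambda>\<omega>. g (\<omega> i) * g (\<omega> j)) = (\<lambda>\<omega>. \<Prod>l<n. f l (\<omega> l))"
    proof
      fix \<omega>
      have "(\<Prod>l<n. f l (\<omega> l)) = (\<Prod>l\<in>{i, j}. f l (\<omega> l))"
        by (rule prod.mono_neutral_right) (use that in \<open>auto simp: f_def\<close>)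
      then show "g (\<omega> i) * g (\<omega> j) = (\<Prod>l<n. f l (\<omega> l))"
        by (cases "i = j") (auto simp: f_def power2_eq_square)
    qed
    show "integrable (PiM {..<n} (\<lambda>_. P)) (\<lambda>\<omega>. g (\<omega> i) * g (\<omega> j))"
      unfolding eq by (rule S.product_integrable_prod) (use f in auto)
    have "(\<integral>\<omega>. g (\<omega> i) * g (\<omega> j) \<partial>PiM {..<n} (\<lambda>_. P)) = (\<Prod>l<n. \<integral>x. f l x \<partial>P)"
      unfolding eq by (rule S.product_integral_prod) (use f in auto)
    also have "\<dots> = (\<Prod>l\<in>{i, j}. \<integral>x. f l x \<partial>P)"
      by (rule prod.mono_neutral_right) (use that in \<open>auto simp: f_def P.prob_space\<close>)
    also have "\<dots> = I i j" by (cases "i = j") (auto simp: f_def I_def g0)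
    finally show "(\<integral>\<omega>. g (\<omega> i) * g (\<omega> j) \<partial>PiM {..<n} (\<lambda>_. P)) = I i j" .
  qed
  have eq: "(\<lambda>\<omega>. (\<Sum>i<n. g (\<omega> i))\<^sup>2) = (\<lambda>\<omega>. \<Sum>i<n. \<Sum>j<n. g (\<omega> i) * g (\<omega> j))"
    by (simp add: power2_eq_square sum_product)
  show "integrable (PiM {..<n} (\<lambda>_. P)) (\<lambda>\<omega>. (\<Sum>i<n. g (\<omega> i))\<^sup>2)"
    unfolding eq by (intro Bochner_Integration.integrable_sum ij) auto
  have "(\<integral>\<omega>. (\<Sum>i<n. g (\<omega> i))\<^sup>2 \<partial>PiM {..<n} (\<lambda>_. P)) = (\<Sum>i<n. \<Sum>j<n. I i j)"
  proof -
    have "(\<integral>\<omega>. (\<Sum>i<n. g (\<omega> i))\<^sup>2 \<partial>PiM {..<n} (\<lambda>_. P)) = (\<Sum>i<n. \<integral>\<omega>. (\<Sum>j<n. g (\<omega> i) * g (\<omega> j)) \<partial>PiM {..<n} (\<lambda>_. P))"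
      unfolding eq by (rule Bochner_Integration.integral_sum) (auto intro!: Bochner_Integration.integrable_sum ij)
    also have "\<dots> = (\<Sum>i<n. \<Sum>j<n. \<integral>\<omega>. g (\<omega> i) * g (\<omega> j) \<partial>PiM {..<n} (\<lambda>_. P))"
      by (intro sum.cong refl Bochner_Integration.integral_sum) (auto intro!: ij)
    also have "\<dots> = (\<Sum>i<n. \<Sum>j<n. I i j)"
      by (intro sum.cong refl ij(2)) auto
    finally show ?thesis .
  qed
  also have "\<dots> = real n * (\<integral>x. (g x)\<^sup>2 \<partial>P)" by (simp add: I_def)
  finally show "(\<integral>\<omega>. (\<Sum>i<n. g (\<omega> i))\<^sup>2 \<partial>PiM {..<n} (\<lambda>_. P)) = real n * (\<integral>x. (g x)\<^sup>2 \<partial>P)" .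
qed

section \<open>Densities, submodels and centring of the tangent space\<close>

lemma integral_le_L2_norm:
  assumes P: "prob_space P" and f: "L2 P f"
  shows "integrable P f" "\<bar>\<integral>x. f x \<partial>P\<bar> \<le> L2_norm_P P f"
proof -
  interpret P: prob_space P by fact
  have [measurable]: "f \<in> borel_measurable P" and f2: "integrable P (\<lambda>x. (f x)\<^sup>2)" using f by (auto simp: L2_def)
  show "integrable P f" using integrable_mult_square[of f P "\<lambda>_. 1"] f2 by simp
  have "\<bar>\<integral>x. f x \<partial>P\<bar> \<le> (\<integral>x. \<bar>f x * 1\<bar> \<partial>P)" using integral_abs_bound[of P f] by simp
  also have "\<dots> \<le> sqrt (\<integral>x. (f x)\<^sup>2 \<partial>P) * sqrt (\<integral>x. 1\<^sup>2 \<partial>P)"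
    by (rule integral_cauchy_schwarz) (use f2 in auto)
  finally show "\<bar>\<integral>x. f x \<partial>P\<bar> \<le> L2_norm_P P f" by (simp add: L2_norm_P_def P.prob_space)
qed

text \<open>Passing to real values loses nothing, because the Radon-Nikodym derivative of a finite
  measure is finite almost everywhere.\<close>

lemma density_dens:
  assumes "dominated_model lam Pm" "P \<in> Pm"
  shows "density lam (\<lambda>z. ennreal (dens lam P z)) = P"
proof -
  have lam: "sigma_finite_measure lam" "sets lam = sets borel" and P: "prob_space P" "sets P = sets borel" "absolutely_continuous lam P"
    using assms by (auto simp: dominated_model_def)
  interpret lam: sigma_finite_measure lam by fact
  interpret P: prob_space P by fact
  have "AE z in lam. RN_deriv lam P z \<noteq> \<infinity>"
    by (rule lam.RN_deriv_finite) (use P lam in \<open>auto intro: P.sigma_finite_measure_axioms\<close>)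
  then have "density lam (\<lambda>z. ennreal (dens lam P z)) = density lam (RN_deriv lam P)"
    by (intro density_cong) (auto simp: dens_def less_top elim!: eventually_mono)
  also have "\<dots> = P" by (rule lam.density_RN_deriv) (use P lam in auto)
  finally show ?thesis .
qed

lemma dens_meas [measurable]: "dens lam P \<in> borel_measurable lam"
  unfolding dens_def by measurable

lemma dens_nonneg: "0 \<le> dens lam P z"
  by (simp add: dens_def)

lemma integral_dens:
  fixes f :: "'z::polish_space \<Rightarrow> real"
  assumes "dominated_model lam Pm" "P \<in> Pm" and f: "f \<in> borel_measurable borel"
  shows "(\<integral>z. f z * dens lam P z \<partial>lam) = (\<integral>z. f z \<partial>P)" "integrable lam (\<lambda>z. f z * dens lam P z) \<longleftrightarrow> integrable P f"
proof -
  have [measurable_cong]: "sets lam = sets borel" using assms by (auto simp: dominated_model_def)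
  have [measurable]: "f \<in> borel_measurable lam" using f by (simp cong: measurable_cong_sets)
  have 1: "(\<integral>z. f z \<partial>density lam (\<lambda>z. ennreal (dens lam P z))) = (\<integral>z. f z * dens lam P z \<partial>lam)"
    by (subst integral_density) (auto simp: dens_nonneg mult.commute)
  have 2: "integrable (density lam (\<lambda>z. ennreal (dens lam P z))) f \<longleftrightarrow> integrable lam (\<lambda>z. f z * dens lam P z)"
    by (subst integrable_density) (auto simp: dens_nonneg mult.commute)
  show "(\<integral>z. f z * dens lam P z \<partial>lam) = (\<integral>z. f z \<partial>P)" "integrable lam (\<lambda>z. f z * dens lam P z) \<longleftrightarrow> integrable P f"
    using 1 2 unfolding density_dens[OF assms(1,2)] by simp_all
qed

lemma submodel_qmd_sequence:
  assumes model: "dominated_model lam Pm" and P: "P \<in> Pm" and s: "L2 P s" and path: "Pe \<in> submodels lam Pm P s"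
  obtains q where "qmd_sequence lam (dens lam P) q s"
    "eventually (\<lambda>n. density lam (\<lambda>z. ennreal (q n z)) = Pe (1 / sqrt (real n))) sequentially"
proof -
  have lam: "sigma_finite_measure lam" and [measurable_cong]: "sets lam = sets borel" and setsP: "sets P = sets borel"
    using model P by (auto simp: dominated_model_def)
  obtain \<delta> where \<delta>: "\<delta> > 0" "\<forall>\<epsilon>\<in>{0..<\<delta>}. Pe \<epsilon> \<in> Pm"
    and lim: "((\<lambda>\<epsilon>. (\<integral>\<^sup>+ z. ennreal ((sqrt (dens lam (Pe \<epsilon>) z) - sqrt (dens lam P z)
                 - \<epsilon> * s z * sqrt (dens lam P z) / 2)\<^sup>2) \<partial>lam) / ennreal (\<epsilon>\<^sup>2)) \<longlongrightarrow> 0) (at_right 0)"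
    using path unfolding submodels_def by blast
  \<comment> \<open>Outside the range where the path is known to stay in the model, \<open>P\<close>
    itself serves as default. Every \<open>q n\<close> is then a density, and the sequence is
    unchanged from some index on.\<close>
  define q where "q n = dens lam (if Pe (1 / sqrt (real n)) \<in> Pm then Pe (1 / sqrt (real n)) else P)" for n
  have sq0: "(\<lambda>n. 1 / sqrt (real n)) \<longlonglongrightarrow> 0"
    by (intro real_tendsto_divide_at_top[where F=sequentially, OF tendsto_const]
        filterlim_compose[OF sqrt_at_top filterlim_real_sequentially])
  have fl: "filterlim (\<lambda>n. 1 / sqrt (real n)) (at_right 0) sequentially"
    unfolding filterlim_at using sq0 by (auto intro!: eventually_sequentiallyI[of 1])
  have ev: "eventually (\<lambda>n. Pe (1 / sqrt (real n)) \<in> Pm) sequentially"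
    using order_tendstoD(2)[OF sq0 \<delta>(1)] by eventually_elim (use \<delta>(2) in auto)
  have s_meas [measurable]: "s \<in> borel_measurable borel" using s by (simp add: L2_def measurable_cong_sets[OF setsP refl])
  have pr: "prob_space (density lam (\<lambda>z. ennreal (dens lam R z)))" if "R \<in> Pm" for R
    using density_dens[OF model that] model that by (simp add: dominated_model_def)
  have qm: "q n = dens lam (if Pe (1 / sqrt (real n)) \<in> Pm then Pe (1 / sqrt (real n)) else P)"
    "(if Pe (1 / sqrt (real n)) \<in> Pm then Pe (1 / sqrt (real n)) else P) \<in> Pm" for n
    using P by (auto simp: q_def)
  have "qmd_sequence lam (dens lam P) q s"
  proof (unfold qmd_sequence_def qmd_sequence_axioms_def, intro conjI allI lam)
    show "prob_space (density lam (\<lambda>x. ennreal (dens lam P x)))" by (rule pr[OF P])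
    show "prob_space (density lam (\<lambda>x. ennreal (q n x)))" for n unfolding qm(1) by (rule pr[OF qm(2)])
    show "q n \<in> borel_measurable lam" "0 \<le> q n x" for n x by (simp_all add: q_def dens_nonneg)
    show "integrable lam (\<lambda>x. (s x)\<^sup>2 * dens lam P x)"
      using s by (subst integral_dens(2)[OF model P]) (auto simp: L2_def)
    have "(\<lambda>n. enn2real ((\<integral>\<^sup>+ z. ennreal ((sqrt (dens lam (Pe (1 / sqrt (real n))) z) - sqrt (dens lam P z)
                 - 1 / sqrt (real n) * s z * sqrt (dens lam P z) / 2)\<^sup>2) \<partial>lam) / ennreal ((1 / sqrt (real n))\<^sup>2))) \<longlonglongrightarrow> 0"
      by (rule tendsto_enn2real) (use filterlim_compose[OF lim fl] in auto)
    then show "(\<lambda>n. real n * (\<integral>x. (sqrt (q n x) - sqrt (dens lam P x) - s x * sqrt (dens lam P x) / (2 * sqrt (real n)))\<^sup>2 \<partial>lam)) \<longlonglongrightarrow> 0"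
    proof (rule Lim_transform_eventually)
      show "eventually (\<lambda>n. enn2real ((\<integral>\<^sup>+ z. ennreal ((sqrt (dens lam (Pe (1 / sqrt (real n))) z) - sqrt (dens lam P z)
                 - 1 / sqrt (real n) * s z * sqrt (dens lam P z) / 2)\<^sup>2) \<partial>lam) / ennreal ((1 / sqrt (real n))\<^sup>2))
            = real n * (\<integral>x. (sqrt (q n x) - sqrt (dens lam P x) - s x * sqrt (dens lam P x) / (2 * sqrt (real n)))\<^sup>2 \<partial>lam)) sequentially"
        using ev eventually_ge_at_top[of 1]
      proof eventually_elim
        case (elim n)
        have d: "a / ennreal ((1 / sqrt (real n))\<^sup>2) = ennreal (real n) * a" for a
          using elim(2) by (simp add: divide_ennreal_def inverse_ennreal power_divide mult.commute)
        have "(\<integral>x. (sqrt (q n x) - sqrt (dens lam P x) - s x * sqrt (dens lam P x) / (2 * sqrt (real n)))\<^sup>2 \<partial>lam)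
          = enn2real (\<integral>\<^sup>+x. ennreal ((sqrt (q n x) - sqrt (dens lam P x) - s x * sqrt (dens lam P x) / (2 * sqrt (real n)))\<^sup>2) \<partial>lam)"
          by (rule integral_eq_nn_integral) (auto simp: q_def)
        then show ?case using elim unfolding d by (simp add: q_def enn2real_mult mult_ac)
      qed
    qed
  qed (auto simp: dens_nonneg)
  moreover have "eventually (\<lambda>n. density lam (\<lambda>z. ennreal (q n z)) = Pe (1 / sqrt (real n))) sequentially"
    using ev by eventually_elim (simp add: q_def density_dens[OF model])
  ultimately show ?thesis by (rule that)
qed

text \<open>Scores are centred because densities along a path keep mass 1. Linear combinations
  inherit this, and so do \<open>L\<^sup>2\<close> limits, since the mean is bounded by the
  \<open>L\<^sup>2\<close> norm.\<close>

lemma tangent_space_mean_zero: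
  assumes model: "dominated_model lam Pm" and P: "P \<in> Pm" and f: "f \<in> tangent_space lam Pm P"
  shows "(\<integral>z. f z \<partial>P) = 0"
proof -
  have prob: "prob_space P" and setsP [measurable_cong]: "sets P = sets borel" using model P by (auto simp: dominated_model_def)
  have set0: "L2 P g \<and> (\<integral>z. g z \<partial>P) = 0" if "g \<in> tangent_set lam Pm P" for g
  proof -
    have g: "L2 P g" using that by (simp add: tangent_set_def)
    have "submodels lam Pm P g \<noteq> {}" using that by (simp add: tangent_set_def)
    then obtain Pe where "Pe \<in> submodels lam Pm P g" by blast
    then obtain q where "qmd_sequence lam (dens lam P) q g" by (rule submodel_qmd_sequence[OF model P g])
    then have "(\<integral>z. g z * dens lam P z \<partial>lam) = 0" by (rule qmd_sequence.score_mean_zero)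
    then show ?thesis using g integral_dens(1)[OF model P, of g] by (simp add: L2_def measurable_cong_sets[OF setsP refl])
  qed
  have fL2: "L2 P f" using f by (simp add: tangent_space_def)
  have "\<bar>\<integral>z. f z \<partial>P\<bar> \<le> e" if e: "e > 0" for e
  proof -
    obtain n :: nat and c g where g: "\<And>i. i < n \<Longrightarrow> g i \<in> tangent_set lam Pm P"
      and close: "L2_norm_P P (\<lambda>z. f z - (\<Sum>i<n. c i * g i z)) < e"
      using f e unfolding tangent_space_def by blast
    have comb: "L2 P (\<lambda>z. \<Sum>i<k. c i * g i z) \<and> (\<integral>z. (\<Sum>i<k. c i * g i z) \<partial>P) = 0" if "k \<le> n" for k
      using that
    proof (induction k)
      case 0 show ?case by (simp add: L2_def)
    next
      case (Suc k)
      have IH: "L2 P (\<lambda>z. \<Sum>i<k. c i * g i z)" "(\<integral>z. (\<Sum>i<k. c i * g i z) \<partial>P) = 0" using Suc by auto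
      have gk: "L2 P (g k)" "(\<integral>z. g k z \<partial>P) = 0" using set0[OF g[of k]] Suc by auto
      have ck: "L2 P (\<lambda>z. c k * g k z)" using gk by (auto simp: L2_def power_mult_distrib)
      have "L2 P (\<lambda>z. (\<Sum>i<k. c i * g i z) + c k * g k z)"
        using IH(1) ck unfolding L2_def by (auto intro: integrable_add_square)
      moreover have "(\<integral>z. (\<Sum>i<k. c i * g i z) + c k * g k z \<partial>P) = 0"
        using integral_le_L2_norm(1)[OF prob IH(1)] integral_le_L2_norm(1)[OF prob ck] IH(2) gk(2) by simp
      ultimately show ?case by simp
    qed
    let ?h = "\<lambda>z. \<Sum>i<n. c i * g i z"
    have h: "L2 P ?h" "(\<integral>z. ?h z \<partial>P) = 0" using comb[of n] by auto
    have d: "L2 P (\<lambda>z. f z - ?h z)"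
    proof -
      have "L2 P (\<lambda>z. - ?h z)" using h(1) by (simp add: L2_def)
      then have "L2 P (\<lambda>z. f z + - ?h z)"
        using fL2 integrable_add_square[of f P "\<lambda>z. - ?h z"] unfolding L2_def by auto
      then show ?thesis by simp
    qed
    have "(\<integral>z. f z \<partial>P) = (\<integral>z. f z - ?h z \<partial>P)"
      using integral_le_L2_norm(1)[OF prob h(1)] integral_le_L2_norm(1)[OF prob fL2] h(2) by simp
    then show ?thesis using integral_le_L2_norm(2)[OF prob d] close by simp
  qed
  then show ?thesis by (meson abs_le_zero_iff dense_ge)
qed

section \<open>Influence function, covariance operator and shift\<close>

locale pathwise_model =
  fixes lam :: "'z::polish_space measure" and Pm :: "'z measure set" and P0 :: "'z measure"
    and D :: "('z \<Rightarrow> real) \<Rightarrow> 'h::{real_inner,polish_space}" and Dstar :: "'h \<Rightarrow> 'z \<Rightarrow> real"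
    and hb :: "nat \<Rightarrow> 'h" and \<beta> :: "nat \<Rightarrow> real" and c :: real
  assumes model: "dominated_model lam Pm" and P0: "P0 \<in> Pm"
    and onb: "padded_onb hb"
    and beta: "\<And>k. 0 < \<beta> k" "\<And>k. \<beta> k \<le> 1" "summable (\<lambda>k. (\<beta> k)\<^sup>2)"
    and D_bounded: "\<And>s. s \<in> tangent_space lam Pm P0 \<Longrightarrow> norm (D s) \<le> c * L2_norm_P P0 s"
    and c: "0 \<le> c"
    and adj: "is_adjoint lam Pm P0 D Dstar"
begin

abbreviation \<phi> where "\<phi> \<equiv> phi_beta \<beta> hb Dstar"
abbreviation \<Gamma> where "\<Gamma> \<equiv> Gamma \<beta> hb"

text \<open>\<open>phi_second_moment\<close> identifies this as the covariance operator of the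
  influence function \<open>\<phi>\<close>. The outer \<open>\<Gamma>\<close> makes it
  compact.\<close>

definition Cov where "Cov w = \<Gamma> (D (Dstar (\<Gamma> w)))"

lemma sets_P0 [measurable_cong]: "sets P0 = sets borel" and prob_P0: "prob_space P0"
  using model P0 by (auto simp: dominated_model_def)

lemma borel_P0: "f \<in> borel_measurable P0 \<longleftrightarrow> f \<in> borel_measurable borel"
  by (simp add: measurable_cong_sets[OF sets_P0 refl])

lemma Dstar_tangent: "Dstar h \<in> tangent_space lam Pm P0"
  using adj by (simp add: is_adjoint_def)

lemma inner_D: "s \<in> tangent_space lam Pm P0 \<Longrightarrow> inner (D s) h = (\<integral>z. s z * Dstar h z \<partial>P0)"
  using adj by (simp add: is_adjoint_def)

lemma tangent_meas: "s \<in> tangent_space lam Pm P0 \<Longrightarrow> s \<in> borel_measurable borel"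
  and tangent_L2: "s \<in> tangent_space lam Pm P0 \<Longrightarrow> integrable P0 (\<lambda>z. (s z)\<^sup>2)"
  by (auto simp: tangent_space_def L2_def borel_P0)

lemma Dstar_meas [measurable]: "Dstar h \<in> borel_measurable borel"
  by (rule tangent_meas[OF Dstar_tangent])

lemma inner_DDstar: "inner (D (Dstar h)) k = (\<integral>z. Dstar h z * Dstar k z \<partial>P0)"
  by (rule inner_D[OF Dstar_tangent])

lemma inner_DDstar_commute: "inner (D (Dstar h)) k = inner h (D (Dstar k))"
  by (simp add: inner_DDstar inner_commute[of h] mult.commute)

text \<open>The adjoint relation is tested with \<open>Dstar h\<close> itself, which lies in the
  tangent space, and one factor of its norm cancels.\<close>

lemma Dstar_norm: "L2_norm_P P0 (Dstar h) \<le> c * norm h"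
proof -
  let ?n = "L2_norm_P P0 (Dstar h)"
  have "?n\<^sup>2 = inner (D (Dstar h)) h"
    by (simp add: L2_norm_P_def inner_DDstar power2_eq_square)
  also have "\<dots> \<le> norm (D (Dstar h)) * norm h" by (rule norm_cauchy_schwarz)
  also have "\<dots> \<le> (c * ?n) * norm h" by (intro mult_right_mono D_bounded Dstar_tangent) simp
  finally have "?n * ?n \<le> ?n * (c * norm h)" by (simp add: power2_eq_square mult_ac)
  moreover have "?n \<ge> 0" by (simp add: L2_norm_P_def)
  ultimately show ?thesis using c by (cases "?n = 0") auto
qed

lemma DDstar_norm: "norm (D (Dstar h)) \<le> c\<^sup>2 * norm h"
proof -
  have "norm (D (Dstar h)) \<le> c * L2_norm_P P0 (Dstar h)" by (rule D_bounded[OF Dstar_tangent])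
  also have "\<dots> \<le> c * (c * norm h)" by (intro mult_left_mono Dstar_norm c)
  finally show ?thesis by (simp add: power2_eq_square mult_ac)
qed

lemma \<Gamma>_commute: "inner (\<Gamma> x) y = inner x (\<Gamma> y)"
  and \<Gamma>_hb: "inner (\<Gamma> x) (hb k) = \<beta> k * inner x (hb k)"
  and \<Gamma>_norm: "norm (\<Gamma> x) \<le> norm x"
  by (rule inner_Gamma_commute[OF onb beta(1,2)] inner_Gamma_hb[OF onb beta(1,2)] norm_Gamma_le[OF onb beta(1,2)])+

lemma inner_Cov: "inner (Cov w) w' = (\<integral>z. Dstar (\<Gamma> w) z * Dstar (\<Gamma> w') z \<partial>P0)"
  by (simp add: Cov_def \<Gamma>_commute inner_DDstar)

text \<open>The outer \<open>\<Gamma>\<close> damps the \<open>k\<close>-th coordinate of an image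
  by \<open>\<beta> k\<close>. As \<open>\<beta>\<close> is square summable, the unit ball is mapped
  into a Hilbert cube.\<close>

lemma Cov_operator:
  "compact_positive_operator Cov {x. \<forall>k. \<bar>inner x (hb k)\<bar> \<le> c\<^sup>2 * \<beta> k} (c\<^sup>2)"
proof
  show "inner (Cov x) y = inner x (Cov y)" for x y
    by (simp add: inner_Cov inner_commute[of x] mult.commute)
  show "0 \<le> inner (Cov x) x" for x by (simp add: inner_Cov)
  show "norm (Cov x) \<le> c\<^sup>2 * norm x" for x
  proof -
    have "norm (Cov x) \<le> c\<^sup>2 * norm (\<Gamma> x)" unfolding Cov_def by (rule order_trans[OF \<Gamma>_norm DDstar_norm])
    also have "\<dots> \<le> c\<^sup>2 * norm x" by (intro mult_left_mono \<Gamma>_norm) simp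
    finally show ?thesis .
  qed
  show "compact {x. \<forall>k. \<bar>inner x (hb k)\<bar> \<le> c\<^sup>2 * \<beta> k}"
    by (rule compact_coordinate_box[OF onb]) (use beta(3) in \<open>simp add: power_mult_distrib\<close>)
  fix x :: 'h assume x: "norm x \<le> 1"
  have "\<bar>inner (Cov x) (hb k)\<bar> \<le> c\<^sup>2 * \<beta> k" for k
  proof -
    have "\<bar>inner (D (Dstar (\<Gamma> x))) (hb k)\<bar> \<le> norm (D (Dstar (\<Gamma> x))) * norm (hb k)" by (rule Cauchy_Schwarz_ineq2)
    also have "\<dots> \<le> norm (D (Dstar (\<Gamma> x)))" by (intro mult_left_le padded_onb_norm_le_1[OF onb]) simp
    also have "\<dots> \<le> c\<^sup>2 * norm (\<Gamma> x)" by (rule DDstar_norm)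
    also have "\<dots> \<le> c\<^sup>2" using \<Gamma>_norm[of x] x by (intro mult_left_le) auto
    finally have "\<beta> k * \<bar>inner (D (Dstar (\<Gamma> x))) (hb k)\<bar> \<le> \<beta> k * c\<^sup>2"
      using beta(1)[of k] by (intro mult_left_mono) auto
    then show ?thesis using beta(1)[of k] by (simp add: Cov_def \<Gamma>_hb abs_mult mult.commute)
  qed
  then show "Cov x \<in> {x. \<forall>k. \<bar>inner x (hb k)\<bar> \<le> c\<^sup>2 * \<beta> k}" by simp
qed

sublocale Cov: compact_positive_operator Cov "{x. \<forall>k. \<bar>inner x (hb k)\<bar> \<le> c\<^sup>2 * \<beta> k}" "c\<^sup>2"
  by (rule Cov_operator)

definition phi_partial_sum where "phi_partial_sum K z = (\<Sum>k<K. (\<beta> k * Dstar (hb k) z) *\<^sub>R hb k)"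

lemma phi_partial_sum_meas [measurable]: "phi_partial_sum K \<in> borel_measurable borel"
  unfolding phi_partial_sum_def by measurable

text \<open>The series converges exactly where its partial sums are Cauchy, a measurable set.
  Partial sums set to 0 off it converge everywhere, matching the default value in
  \<open>phi_beta\<close>.\<close>

lemma phi_meas [measurable]: "\<phi> \<in> borel_measurable borel"
proof -
  have sum: "summable (\<lambda>k. (\<beta> k * Dstar (hb k) z) *\<^sub>R hb k) \<longleftrightarrow> Cauchy (\<lambda>K. phi_partial_sum K z)" for z
    by (auto simp: phi_partial_sum_def summable_iff_convergent intro: convergent_Cauchy Cauchy_convergent)
  have [measurable]: "{z. Cauchy (\<lambda>K. phi_partial_sum K z)} \<in> sets borel"
    using sets_Collect_Cauchy[of phi_partial_sum borel] by simp
  show ?thesis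
  proof (rule borel_measurable_LIMSEQ_metric)
    show "(\<lambda>z. if z \<in> {z. Cauchy (\<lambda>K. phi_partial_sum K z)} then phi_partial_sum K z else 0) \<in> borel_measurable borel" for K
      by measurable
    fix z
    show "(\<lambda>K. if z \<in> {z. Cauchy (\<lambda>K. phi_partial_sum K z)} then phi_partial_sum K z else 0) \<longlonglongrightarrow> \<phi> z"
    proof (cases "Cauchy (\<lambda>K. phi_partial_sum K z)")
      case True
      then have "summable (\<lambda>k. (\<beta> k * Dstar (hb k) z) *\<^sub>R hb k)" by (simp add: sum)
      then have "(\<lambda>K. phi_partial_sum K z) \<longlonglongrightarrow> \<phi> z" using summable_LIMSEQ by (auto simp: phi_partial_sum_def phi_beta_def)
      then show ?thesis using True by simp
    next
      case False
      then show ?thesis by (simp add: phi_beta_def sum)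
    qed
  qed
qed

lemma Dstar_square_bound: "(\<integral>z. (\<beta> k * Dstar (hb k) z)\<^sup>2 \<partial>P0) \<le> c\<^sup>2 * (\<beta> k)\<^sup>2"
proof -
  have "L2_norm_P P0 (Dstar (hb k)) \<le> c"
    using Dstar_norm[of "hb k"] padded_onb_norm_le_1[OF onb, of k] c by (meson mult_left_le norm_ge_zero order_trans)
  then have "(L2_norm_P P0 (Dstar (hb k)))\<^sup>2 \<le> c\<^sup>2" by (rule power_mono) (simp add: L2_norm_P_def)
  then have "(\<integral>z. (Dstar (hb k) z)\<^sup>2 \<partial>P0) \<le> c\<^sup>2" by (simp add: L2_norm_P_def)
  then show ?thesis by (simp add: power_mult_distrib mult.commute[of "c\<^sup>2"] mult_left_mono)
qed

text \<open>The expected sum of the squared coefficients is at most \<open>c\<^sup>2\<close> times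
  the sum of the squared weights, hence finite. So the coefficients are almost surely square
  summable and the series converges there.\<close>

lemma AE_phi_coord: "AE z in P0. \<forall>k. inner (\<phi> z) (hb k) = \<beta> k * Dstar (hb k) z"
proof -
  have "(\<integral>\<^sup>+z. (\<Sum>k. ennreal ((\<beta> k * Dstar (hb k) z)\<^sup>2)) \<partial>P0) = (\<Sum>k. \<integral>\<^sup>+z. ennreal ((\<beta> k * Dstar (hb k) z)\<^sup>2) \<partial>P0)"
    by (rule nn_integral_suminf) measurable
  also have "\<dots> \<le> (\<Sum>k. ennreal (c\<^sup>2 * (\<beta> k)\<^sup>2))"
  proof (rule suminf_le)
    fix k
    have "(\<integral>\<^sup>+z. ennreal ((\<beta> k * Dstar (hb k) z)\<^sup>2) \<partial>P0) = ennreal (\<integral>z. (\<beta> k * Dstar (hb k) z)\<^sup>2 \<partial>P0)"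
      by (rule nn_integral_eq_integral) (use tangent_L2[OF Dstar_tangent] in \<open>auto simp: power_mult_distrib\<close>)
    also have "\<dots> \<le> ennreal (c\<^sup>2 * (\<beta> k)\<^sup>2)" by (intro ennreal_leI Dstar_square_bound)
    finally show "(\<integral>\<^sup>+z. ennreal ((\<beta> k * Dstar (hb k) z)\<^sup>2) \<partial>P0) \<le> ennreal (c\<^sup>2 * (\<beta> k)\<^sup>2)" .
  qed auto
  also have "\<dots> < \<infinity>" using beta(3) by (subst suminf_ennreal2) auto
  finally have "AE z in P0. (\<Sum>k. ennreal ((\<beta> k * Dstar (hb k) z)\<^sup>2)) \<noteq> \<infinity>"
    by (intro nn_integral_PInf_AE) auto
  then have ae: "AE z in P0. summable (\<lambda>k. (\<beta> k * Dstar (hb k) z)\<^sup>2)"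
    by eventually_elim (auto intro!: summable_suminf_not_top simp: top_unique)
  \<comment> \<open>At a padding index the coordinate of \<open>\<phi>\<close> is 0, so the
    coefficient must vanish too. \<open>Dstar 0\<close> is pinned down only up to a null set, by its
    norm bound.\<close>
  have z: "AE z in P0. \<forall>k. hb k = 0 \<longrightarrow> Dstar (hb k) z = 0"
  proof (unfold AE_all_countable, intro allI)
    fix k
    show "AE z in P0. hb k = 0 \<longrightarrow> Dstar (hb k) z = 0"
    proof (cases "hb k = 0")
      case True
      then have "L2_norm_P P0 (Dstar (hb k)) \<le> 0" using Dstar_norm[of "hb k"] by simp
      then have "(\<integral>z. (Dstar (hb k) z)\<^sup>2 \<partial>P0) \<le> 0" by (simp add: L2_norm_P_def)
      then have "(\<integral>z. (Dstar (hb k) z)\<^sup>2 \<partial>P0) = 0" by (intro antisym) auto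
      then have "AE z in P0. (Dstar (hb k) z)\<^sup>2 = 0"
        by (subst (asm) integral_nonneg_eq_0_iff_AE) (use tangent_L2[OF Dstar_tangent] in auto)
      then show ?thesis
      proof eventually_elim
        case (elim z)
        then have "Dstar (hb k) z = 0" by simp
        then show ?case by blast
      qed
    qed simp
  qed
  show ?thesis using ae z
  proof eventually_elim
    case (elim z)
    have sm: "summable (\<lambda>k. (\<beta> k * Dstar (hb k) z) *\<^sub>R hb k)" by (rule padded_onb_summable[OF onb elim(1)])
    have "inner (\<phi> z) (hb k) = \<beta> k * Dstar (hb k) z * inner (hb k) (hb k)" for k
      using padded_onb_inner_suminf[OF onb sm, of k] sm by (simp add: phi_beta_def)
    moreover have "Dstar (hb k) z * inner (hb k) (hb k) = Dstar (hb k) z" for k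
      using padded_onb_unit_or_zero[OF onb, of k] elim(2) by (auto simp: norm_eq_1)
    ultimately show ?case by (simp add: mult.assoc)
  qed
qed

text \<open>Coordinates of \<open>\<phi>\<close> itself, for which sums over the sample are exact;
  they agree with the weighted \<open>Dstar (hb k)\<close> only almost everywhere.\<close>

definition phi_coord where "phi_coord k z = inner (\<phi> z) (hb k)"

lemma g_meas [measurable]: "phi_coord k \<in> borel_measurable borel"
  unfolding phi_coord_def by measurable

lemma AE_g: "AE z in P0. phi_coord k z = \<beta> k * Dstar (hb k) z"
  using AE_phi_coord by eventually_elim (simp add: phi_coord_def)

lemma g_L2: "integrable P0 (\<lambda>z. (phi_coord k z)\<^sup>2)" "(\<integral>z. (phi_coord k z)\<^sup>2 \<partial>P0) \<le> c\<^sup>2 * (\<beta> k)\<^sup>2"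
proof -
  have ae: "AE z in P0. (phi_coord k z)\<^sup>2 = (\<beta> k * Dstar (hb k) z)\<^sup>2" using AE_g[of k] by eventually_elim simp
  have "integrable P0 (\<lambda>z. (\<beta> k * Dstar (hb k) z)\<^sup>2)"
    using tangent_L2[OF Dstar_tangent] by (auto simp: power_mult_distrib)
  then show "integrable P0 (\<lambda>z. (phi_coord k z)\<^sup>2)"
    by (subst integrable_cong_AE[OF _ _ ae]) auto
  show "(\<integral>z. (phi_coord k z)\<^sup>2 \<partial>P0) \<le> c\<^sup>2 * (\<beta> k)\<^sup>2"
    by (subst integral_cong_AE[OF _ _ ae]) (use Dstar_square_bound in auto)
qed

lemma g_mean_zero: "(\<integral>z. phi_coord k z \<partial>P0) = 0"
proof -
  have "(\<integral>z. phi_coord k z \<partial>P0) = (\<integral>z. \<beta> k * Dstar (hb k) z \<partial>P0)"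
    by (rule integral_cong_AE[OF _ _ AE_g]) auto
  then show ?thesis by (simp add: tangent_space_mean_zero[OF model P0 Dstar_tangent])
qed

lemma g_prod: "integrable P0 (\<lambda>z. phi_coord j z * phi_coord k z)" "(\<integral>z. phi_coord j z * phi_coord k z \<partial>P0) = inner (Cov (hb j)) (hb k)"
proof -
  show "integrable P0 (\<lambda>z. phi_coord j z * phi_coord k z)" by (rule integrable_mult_square) (use g_L2 in auto)
  have \<Gamma>hb: "\<Gamma> (hb k) = \<beta> k *\<^sub>R hb k" for k
  proof (rule padded_onb_eqI[OF onb])
    show "inner (\<Gamma> (hb k)) (hb j) = inner (\<beta> k *\<^sub>R hb k) (hb j)" for j
      by (cases "j = k") (auto simp: \<Gamma>_hb padded_onb_orthogonal[OF onb])
  qed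
  \<comment> \<open>Homogeneity of \<open>D (Dstar _)\<close> is obtained from symmetry, by moving
    the scaled vector into the other slot of the inner product.\<close>
  have sc: "inner (D (Dstar (t *\<^sub>R x))) y = t * inner (D (Dstar x)) y" for t x y
    by (simp add: inner_DDstar_commute)
  have "(\<integral>z. phi_coord j z * phi_coord k z \<partial>P0) = (\<integral>z. (\<beta> j * \<beta> k) * (Dstar (hb j) z * Dstar (hb k) z) \<partial>P0)"
  proof (rule integral_cong_AE)
    show "AE z in P0. phi_coord j z * phi_coord k z = (\<beta> j * \<beta> k) * (Dstar (hb j) z * Dstar (hb k) z)"
      using AE_g[of j] AE_g[of k] by eventually_elim simp
  qed auto
  also have "\<dots> = (\<beta> j * \<beta> k) * inner (D (Dstar (hb j))) (hb k)" by (simp add: inner_DDstar)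
  also have "\<dots> = inner (Cov (hb j)) (hb k)"
    by (simp add: Cov_def \<Gamma>_commute \<Gamma>hb sc)
  finally show "(\<integral>z. phi_coord j z * phi_coord k z \<partial>P0) = inner (Cov (hb j)) (hb k)" .
qed

lemma comb_second_moment:
  "integrable P0 (\<lambda>z. (\<Sum>k<K. w k * phi_coord k z)\<^sup>2)"
  "(\<integral>z. (\<Sum>k<K. w k * phi_coord k z)\<^sup>2 \<partial>P0) = inner (Cov (\<Sum>k<K. w k *\<^sub>R hb k)) (\<Sum>k<K. w k *\<^sub>R hb k)"
proof -
  have eq: "(\<lambda>z. (\<Sum>k<K. w k * phi_coord k z)\<^sup>2) = (\<lambda>z. \<Sum>j<K. \<Sum>k<K. (w j * w k) * (phi_coord j z * phi_coord k z))"
    by (simp add: power2_eq_square sum_product mult_ac)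
  show "integrable P0 (\<lambda>z. (\<Sum>k<K. w k * phi_coord k z)\<^sup>2)" unfolding eq using g_prod by auto
  interpret L: bounded_linear Cov by (rule Cov.bounded_linear_C)
  have "(\<integral>z. (\<Sum>k<K. w k * phi_coord k z)\<^sup>2 \<partial>P0) = (\<Sum>j<K. \<Sum>k<K. (w j * w k) * inner (Cov (hb j)) (hb k))"
    unfolding eq using g_prod by simp
  also have "\<dots> = inner (Cov (\<Sum>k<K. w k *\<^sub>R hb k)) (\<Sum>k<K. w k *\<^sub>R hb k)"
    by (simp add: L.sum L.scaleR inner_sum_left inner_sum_right sum_distrib_left mult_ac)
       (subst sum.swap, simp add: mult.left_commute)
  finally show "(\<integral>z. (\<Sum>k<K. w k * phi_coord k z)\<^sup>2 \<partial>P0) = inner (Cov (\<Sum>k<K. w k *\<^sub>R hb k)) (\<Sum>k<K. w k *\<^sub>R hb k)" .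
qed

lemma summable_g2: "summable (\<lambda>k. \<integral>z. (phi_coord k z)\<^sup>2 \<partial>P0)"
  by (rule summable_comparison_test'[OF summable_mult[OF beta(3), of "c\<^sup>2"], of 0])
     (use g_L2(2) in auto)

lemma phi_L2: "integrable P0 (\<lambda>z. (norm (\<phi> z))\<^sup>2)"
proof (rule integrableI_nonneg)
  have "(\<integral>\<^sup>+z. ennreal ((norm (\<phi> z))\<^sup>2) \<partial>P0) = (\<integral>\<^sup>+z. (\<Sum>k. ennreal ((phi_coord k z)\<^sup>2)) \<partial>P0)"
  proof (rule nn_integral_cong)
    fix z
    show "ennreal ((norm (\<phi> z))\<^sup>2) = (\<Sum>k. ennreal ((phi_coord k z)\<^sup>2))"
      using padded_onb_parseval[OF onb, of "\<phi> z"] by (subst suminf_ennreal2) (auto simp: phi_coord_def sums_iff)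
  qed
  also have "\<dots> = (\<Sum>k. \<integral>\<^sup>+z. ennreal ((phi_coord k z)\<^sup>2) \<partial>P0)" by (rule nn_integral_suminf) measurable
  also have "\<dots> = (\<Sum>k. ennreal (\<integral>z. (phi_coord k z)\<^sup>2 \<partial>P0))"
    using g_L2 by (intro suminf_cong nn_integral_eq_integral) auto
  also have "\<dots> < \<infinity>" using summable_g2 by (subst suminf_ennreal2) auto
  finally show "(\<integral>\<^sup>+z. ennreal ((norm (\<phi> z))\<^sup>2) \<partial>P0) < \<infinity>" .
qed auto

text \<open>Known for finite combinations of basis vectors, and extended to all \<open>w\<close> by
  expansion: the left side passes to the limit by dominated convergence under the square integrable
  \<open>norm (\<phi> z)\<close>, the right side by continuity of \<open>Cov\<close>.\<close>

lemma phi_second_moment: "(\<integral>z. (inner (\<phi> z) w)\<^sup>2 \<partial>P0) = inner (Cov w) w"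
proof -
  define p where "p K = (\<Sum>k<K. inner w (hb k) *\<^sub>R hb k)" for K
  have p: "p \<longlonglongrightarrow> w" unfolding p_def[abs_def] by (rule padded_onb_norm_tail[OF onb])
  have np: "norm (p K) \<le> norm w" for K
  proof -
    have "(norm (p K))\<^sup>2 \<le> (\<Sum>k<K. (inner w (hb k))\<^sup>2)" unfolding p_def by (rule padded_onb_norm_sum_le[OF onb]) simp
    also have "\<dots> \<le> (norm w)\<^sup>2"
      using padded_onb_parseval[OF onb, of w] sum_le_suminf[of "\<lambda>k. (inner w (hb k))\<^sup>2" "{..<K}"]
      by (simp add: sums_iff)
    finally show ?thesis by (rule power2_le_imp_le) simp
  qed
  have eq: "inner (\<phi> z) (p K) = (\<Sum>k<K. inner w (hb k) * phi_coord k z)" for z K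
    by (simp add: p_def inner_sum_right phi_coord_def)
  have "(\<lambda>K. \<integral>z. (inner (\<phi> z) (p K))\<^sup>2 \<partial>P0) \<longlonglongrightarrow> (\<integral>z. (inner (\<phi> z) w)\<^sup>2 \<partial>P0)"
  proof (rule integral_dominated_convergence[where w="\<lambda>z. (norm (\<phi> z))\<^sup>2 * (norm w)\<^sup>2"])
    show "AE z in P0. (\<lambda>K. (inner (\<phi> z) (p K))\<^sup>2) \<longlonglongrightarrow> (inner (\<phi> z) w)\<^sup>2"
      by (intro AE_I2 tendsto_intros p)
    show "AE z in P0. norm ((inner (\<phi> z) (p K))\<^sup>2) \<le> (norm (\<phi> z))\<^sup>2 * (norm w)\<^sup>2" for K
    proof (intro AE_I2)
      fix z
      have "\<bar>inner (\<phi> z) (p K)\<bar> \<le> norm (\<phi> z) * norm w"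
        by (rule order_trans[OF Cauchy_Schwarz_ineq2]) (intro mult_left_mono np, simp)
      from power_mono[OF this abs_ge_zero, of 2]
      show "norm ((inner (\<phi> z) (p K))\<^sup>2) \<le> (norm (\<phi> z))\<^sup>2 * (norm w)\<^sup>2" by (simp add: power_mult_distrib)
    qed
  qed (use phi_L2 in auto)
  moreover have "(\<lambda>K. inner (Cov (p K)) (p K)) \<longlonglongrightarrow> inner (Cov w) w"
    by (intro tendsto_inner bounded_linear.tendsto[OF Cov.bounded_linear_C] p)
  ultimately show ?thesis unfolding eq comb_second_moment(2) p_def[symmetric] by (rule LIMSEQ_unique)
qed

lemma gaussian_on_hilbert_Cov:
  assumes "gaussian_law_of G P0 \<phi>"
  shows "gaussian_on_hilbert G Cov {x. \<forall>k. \<bar>inner x (hb k)\<bar> \<le> c\<^sup>2 * \<beta> k} (c\<^sup>2) hb"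
  using assms onb Cov_operator
  by (simp add: gaussian_on_hilbert_def gaussian_on_hilbert_axioms_def gaussian_law_of_def phi_second_moment)

context
  fixes s assumes s: "s \<in> tangent_space lam Pm P0"
begin

lemma inner_shift: "inner (\<Gamma> (D s)) w = (\<integral>z. s z * Dstar (\<Gamma> w) z \<partial>P0)"
  by (simp add: \<Gamma>_commute inner_D[OF s])

text \<open>\<open>inner (Cov w) w\<close> is the second moment of
  \<open>Dstar (\<Gamma> w)\<close>, so this function vanishes almost everywhere. The inner product
  with the shift is an integral against it.\<close>

lemma shift_ker:
  assumes "Cov w = 0" shows "inner (\<Gamma> (D s)) w = 0"
proof -
  have "(\<integral>z. (Dstar (\<Gamma> w) z)\<^sup>2 \<partial>P0) = 0" using inner_Cov[of w w] assms by (simp add: power2_eq_square)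
  then have "AE z in P0. (Dstar (\<Gamma> w) z)\<^sup>2 = 0"
    by (subst (asm) integral_nonneg_eq_0_iff_AE) (use tangent_L2[OF Dstar_tangent] in auto)
  then have "AE z in P0. s z * Dstar (\<Gamma> w) z = 0" by eventually_elim simp
  then show ?thesis unfolding inner_shift by (rule integral_eq_zero_AE)
qed

text \<open>If \<open>Cov\<close> annihilated the shift, \<open>shift_ker\<close> would make the
  shift orthogonal to itself, and injectivity of \<open>\<Gamma>\<close> would give
  \<open>D s = 0\<close>.\<close>

lemma Cov_shift_nonzero: "D s \<noteq> 0 \<Longrightarrow> Cov (\<Gamma> (D s)) \<noteq> 0"
  using shift_ker[of "\<Gamma> (D s)"] Gamma_eq_0[OF onb beta(1,2)] by auto

lemma inner_shift_hb: "(\<integral>z. s z * phi_coord k z \<partial>P0) = inner (\<Gamma> (D s)) (hb k)"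
proof -
  have [measurable]: "s \<in> borel_measurable borel" by (rule tangent_meas[OF s])
  have "(\<integral>z. s z * phi_coord k z \<partial>P0) = (\<integral>z. \<beta> k * (s z * Dstar (hb k) z) \<partial>P0)"
  proof (rule integral_cong_AE)
    show "AE z in P0. s z * phi_coord k z = \<beta> k * (s z * Dstar (hb k) z)"
      using AE_g[of k] by eventually_elim simp
  qed auto
  then show ?thesis by (simp add: \<Gamma>_hb inner_D[OF s])
qed

lemma sg_integrable: "integrable P0 (\<lambda>z. s z * phi_coord k z)"
  by (rule integrable_mult_square) (use tangent_meas[OF s] tangent_L2[OF s] g_L2 in \<open>auto simp: borel_P0\<close>)

end

end

lemma padded_onb_projection:
  fixes hb :: "nat \<Rightarrow> 'h::{real_inner,complete_space}" and x :: 'h and K :: nat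
  assumes onb: "padded_onb hb"
  defines "y \<equiv> \<Sum>k<K. inner x (hb k) *\<^sub>R hb k"
  shows "(norm y)\<^sup>2 = (\<Sum>k<K. (inner x (hb k))\<^sup>2)"
    "(\<lambda>k. (inner x (hb (k + K)))\<^sup>2) sums (norm (x - y))\<^sup>2"
proof -
  have y: "inner y (hb j) = (if j < K then inner x (hb j) else 0)" for j
    unfolding y_def padded_onb_inner_sum[OF onb] using padded_onb_inner_self[OF onb, of x j] by simp
  have "(\<lambda>k. if k \<in> {..<K} then (inner x (hb k))\<^sup>2 else 0) sums (\<Sum>k<K. (inner x (hb k))\<^sup>2)"
    by (rule sums_If_finite_set) simp
  moreover have "(\<lambda>k. (inner y (hb k))\<^sup>2) = (\<lambda>k. if k \<in> {..<K} then (inner x (hb k))\<^sup>2 else 0)"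
    by (auto simp: y)
  ultimately show "(norm y)\<^sup>2 = (\<Sum>k<K. (inner x (hb k))\<^sup>2)"
    using padded_onb_parseval[OF onb, of y] sums_unique2 by metis
  have z: "inner (x - y) (hb j) = (if j < K then 0 else inner x (hb j))" for j
    by (simp add: inner_diff_left y)
  have "(\<lambda>k. (inner (x - y) (hb (k + K)))\<^sup>2) sums ((norm (x - y))\<^sup>2 - (\<Sum>k<K. (inner (x - y) (hb k))\<^sup>2))"
    using padded_onb_parseval[OF onb, of "x - y"] by (rule sums_split_initial_segment)
  then show "(\<lambda>k. (inner x (hb (k + K)))\<^sup>2) sums (norm (x - y))\<^sup>2" by (simp add: z)
qed

section \<open>Normalized sums of the influence function and their tails\<close>

context pathwise_model
begin

definition Sn :: "nat \<Rightarrow> (nat \<Rightarrow> 'z) \<Rightarrow> 'h" where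
  "Sn n \<omega> = (1 / sqrt (real n)) *\<^sub>R (\<Sum>i<n. \<phi> (\<omega> i))"

lemma Sn_meas: "Sn n \<in> borel_measurable (PiM {..<n} (\<lambda>_. borel))"
  unfolding Sn_def by measurable

lemma inner_Sn: "inner (Sn n \<omega>) (hb k) = 1 / sqrt (real n) * (\<Sum>i<n. phi_coord k (\<omega> i))"
  by (simp add: Sn_def inner_sum_left phi_coord_def)

text \<open>Bounds, uniformly in the sample size, the expected squared norm of \<open>Sn\<close>
  beyond its first \<open>K\<close> coordinates.\<close>

definition tail where "tail K = (\<Sum>k. \<integral>z. (phi_coord (k + K) z)\<^sup>2 \<partial>P0)"

lemma tail_lim: "tail \<longlonglongrightarrow> 0"
proof -
  have "tail = (\<lambda>K. (\<Sum>k. \<integral>z. (phi_coord k z)\<^sup>2 \<partial>P0) - (\<Sum>k<K. \<integral>z. (phi_coord k z)\<^sup>2 \<partial>P0))"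
    using suminf_minus_initial_segment[OF summable_g2] by (auto simp: tail_def)
  moreover have "(\<lambda>K. (\<Sum>k. \<integral>z. (phi_coord k z)\<^sup>2 \<partial>P0) - (\<Sum>k<K. \<integral>z. (phi_coord k z)\<^sup>2 \<partial>P0))
    \<longlonglongrightarrow> (\<Sum>k. \<integral>z. (phi_coord k z)\<^sup>2 \<partial>P0) - (\<Sum>k. \<integral>z. (phi_coord k z)\<^sup>2 \<partial>P0)"
    by (intro tendsto_diff tendsto_const summable_LIMSEQ summable_g2)
  ultimately show ?thesis by simp
qed

lemma sets_sample: "sets R = sets borel \<Longrightarrow> sets (PiM {..<n} (\<lambda>_. R)) = sets (PiM {..<n} (\<lambda>_. borel :: 'z measure))"
  by (rule sets_PiM_cong) auto

text \<open>Each coordinate of \<open>Sn\<close> is a normalized sum of independent centred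
  variables, whose second moment under \<open>P0\<close> is that of one summand (or 0 when
  \<open>n = 0\<close>). Summing the coordinates beyond \<open>K\<close> gives
  \<open>tail K\<close>.\<close>

lemma Sn_tail:
  defines "R \<equiv> \<lambda>n K \<omega>. (norm (Sn n \<omega> - (\<Sum>k<K. inner (Sn n \<omega>) (hb k) *\<^sub>R hb k)))\<^sup>2"
  shows "integrable (sample n P0) (R n K)" "(\<integral>\<omega>. R n K \<omega> \<partial>sample n P0) \<le> tail K"
proof -
  interpret P0: prob_space P0 by (rule prob_P0)
  have [measurable_cong]: "sets (sample n P0) = sets (PiM {..<n} (\<lambda>_. borel))" by (rule sets_sample[OF sets_P0])
  have Sm [measurable]: "Sn n \<in> borel_measurable (sample n P0)"
    using Sn_meas by (simp add: measurable_cong_sets[OF sets_sample[OF sets_P0] refl])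
  have Rm [measurable]: "R n K \<in> borel_measurable (sample n P0)" unfolding R_def by measurable
  have summ: "summable (\<lambda>k. \<integral>z. (phi_coord (k + K) z)\<^sup>2 \<partial>P0)" using summable_g2 summable_iff_shift[of "\<lambda>k. \<integral>z. (phi_coord k z)\<^sup>2 \<partial>P0" K] by simp
  have tail0: "tail K \<ge> 0" unfolding tail_def by (intro suminf_nonneg summ) simp
  have "(\<integral>\<^sup>+\<omega>. ennreal (R n K \<omega>) \<partial>sample n P0) = (\<integral>\<^sup>+\<omega>. (\<Sum>k. ennreal ((inner (Sn n \<omega>) (hb (k + K)))\<^sup>2)) \<partial>sample n P0)"
  proof (rule nn_integral_cong)
    fix \<omega>
    show "ennreal (R n K \<omega>) = (\<Sum>k. ennreal ((inner (Sn n \<omega>) (hb (k + K)))\<^sup>2))"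
      using padded_onb_projection(2)[OF onb, of "Sn n \<omega>" K]
      by (subst suminf_ennreal2) (auto simp: R_def sums_iff)
  qed
  also have "\<dots> = (\<Sum>k. \<integral>\<^sup>+\<omega>. ennreal ((inner (Sn n \<omega>) (hb (k + K)))\<^sup>2) \<partial>sample n P0)"
    by (rule nn_integral_suminf) measurable
  also have "\<dots> \<le> (\<Sum>k. ennreal (\<integral>z. (phi_coord (k + K) z)\<^sup>2 \<partial>P0))"
  proof (rule suminf_le)
    fix k
    have gm: "phi_coord (k + K) \<in> borel_measurable P0" by measurable
    note sm = PiM_sum_second_moment[OF prob_P0 gm g_L2(1) g_mean_zero, of n]
    have eq: "(inner (Sn n \<omega>) (hb (k + K)))\<^sup>2 = (\<Sum>i<n. phi_coord (k + K) (\<omega> i))\<^sup>2 / real n" for \<omega>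
      by (simp add: inner_Sn power_mult_distrib power_divide)
    have "(\<integral>\<^sup>+\<omega>. ennreal ((inner (Sn n \<omega>) (hb (k + K)))\<^sup>2) \<partial>sample n P0)
       = ennreal (\<integral>\<omega>. (inner (Sn n \<omega>) (hb (k + K)))\<^sup>2 \<partial>sample n P0)"
      by (rule nn_integral_eq_integral) (use sm in \<open>auto simp: eq\<close>)
    also have "(\<integral>\<omega>. (inner (Sn n \<omega>) (hb (k + K)))\<^sup>2 \<partial>sample n P0) \<le> (\<integral>z. (phi_coord (k + K) z)\<^sup>2 \<partial>P0)"
      using sm by (simp add: eq)
    finally show "(\<integral>\<^sup>+\<omega>. ennreal ((inner (Sn n \<omega>) (hb (k + K)))\<^sup>2) \<partial>sample n P0) \<le> ennreal (\<integral>z. (phi_coord (k + K) z)\<^sup>2 \<partial>P0)"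
      by (simp add: ennreal_leI)
  qed auto
  also have "\<dots> = ennreal (tail K)" unfolding tail_def using summ by (intro suminf_ennreal2) auto
  finally have le: "(\<integral>\<^sup>+\<omega>. ennreal (R n K \<omega>) \<partial>sample n P0) \<le> ennreal (tail K)" .
  show i: "integrable (sample n P0) (R n K)"
    by (rule integrableI_bounded) (use le in \<open>auto simp: R_def intro: le_less_trans\<close>)
  have "ennreal (\<integral>\<omega>. R n K \<omega> \<partial>sample n P0) \<le> ennreal (tail K)"
    using le by (subst nn_integral_eq_integral[OF i, symmetric]) (auto simp: R_def)
  then show "(\<integral>\<omega>. R n K \<omega> \<partial>sample n P0) \<le> tail K" using tail0 by (simp add: ennreal_le_iff)
qed

end

section \<open>Limits along the local alternatives\<close>

locale pathwise_alternative = pathwise_model lam Pm P0 D Dstar hb \<beta> c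
  for lam :: "'z::polish_space measure" and Pm P0 and D :: "('z \<Rightarrow> real) \<Rightarrow> 'h::{real_inner,polish_space}"
    and Dstar hb \<beta> c +
  fixes q :: "nat \<Rightarrow> 'z \<Rightarrow> real" and s :: "'z \<Rightarrow> real" and G :: "'h measure"
  assumes qmd: "qmd_sequence lam (dens lam P0) q s" and s: "s \<in> tangent_space lam Pm P0"
    and G: "gaussian_law_of G P0 \<phi>"
begin

sublocale Q: qmd_sequence lam "dens lam P0" q s by (rule qmd)

sublocale H: gaussian_on_hilbert G Cov "{x. \<forall>k. \<bar>inner x (hb k)\<bar> \<le> c\<^sup>2 * \<beta> k}" "c\<^sup>2" hb
  by (rule gaussian_on_hilbert_Cov[OF G])

abbreviation Qn where "Qn n \<equiv> PiM {..<n} (\<lambda>_. density lam (\<lambda>z. ennreal (q n z)))"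
abbreviation \<delta> where "\<delta> \<equiv> \<Gamma> (D s)"

lemma sets_lam [measurable_cong]: "sets lam = sets borel"
  using model by (simp add: dominated_model_def)

lemma sets_Qn: "sets (Qn n) = sets (PiM {..<n} (\<lambda>_. borel))"
  by (rule sets_sample) (simp add: sets_lam)

lemma meas_Qn: "f \<in> borel_measurable (Qn n) \<longleftrightarrow> f \<in> borel_measurable (PiM {..<n} (\<lambda>_. borel))"
  and meas_lam: "f \<in> borel_measurable (PiM {..<n} (\<lambda>_. lam)) \<longleftrightarrow> f \<in> borel_measurable (PiM {..<n} (\<lambda>_. borel))"
  and meas_P0: "f \<in> borel_measurable (sample n P0) \<longleftrightarrow> f \<in> borel_measurable (PiM {..<n} (\<lambda>_. borel))"
  by (simp_all add: measurable_cong_sets[OF sets_Qn refl] measurable_cong_sets[OF sets_sample[OF sets_lam] refl]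
      measurable_cong_sets[OF sets_sample[OF sets_P0] refl])

lemma prob_Qn: "prob_space (Qn n)"
  by (intro prob_space_PiM Q.q_prob)

lemma prob_sample: "prob_space (sample n P0)"
  by (intro prob_space_PiM prob_P0)

lemma contiguous_integral:
  assumes "0 < e"
  obtains \<eta> n0 where "\<eta> > 0"
    "\<And>n F. n \<ge> n0 \<Longrightarrow> F \<in> borel_measurable (PiM {..<n} (\<lambda>_. borel)) \<Longrightarrow> (\<And>\<omega>. 0 \<le> F \<omega> \<and> F \<omega> \<le> 1) \<Longrightarrow>
      (\<integral>\<omega>. F \<omega> \<partial>sample n P0) \<le> \<eta> \<Longrightarrow> (\<integral>\<omega>. F \<omega> \<partial>Qn n) \<le> (e :: real)"
  using Q.contiguity[OF assms] unfolding density_dens[OF model P0] meas_lam[symmetric] by blast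

lemma contiguous_events:
  assumes E: "\<And>n. E n \<in> sets (PiM {..<n} (\<lambda>_. borel))"
    and lim: "(\<lambda>n. measure (sample n P0) (E n)) \<longlonglongrightarrow> 0"
  shows "(\<lambda>n. measure (Qn n) (E n)) \<longlonglongrightarrow> 0"
proof (rule LIMSEQ_I)
  fix e :: real assume e: "0 < e"
  then obtain \<eta> n0 where \<eta>: "\<eta> > 0" and n0: "\<And>n F. n \<ge> n0 \<Longrightarrow> F \<in> borel_measurable (PiM {..<n} (\<lambda>_. borel)) \<Longrightarrow> (\<And>\<omega>. 0 \<le> F \<omega> \<and> F \<omega> \<le> 1) \<Longrightarrow>
      (\<integral>\<omega>. F \<omega> \<partial>sample n P0) \<le> \<eta> \<Longrightarrow> (\<integral>\<omega>. F \<omega> \<partial>Qn n) \<le> e / 2"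
    using contiguous_integral[of "e / 2"] by auto
  obtain n1 where n1: "\<And>n. n \<ge> n1 \<Longrightarrow> measure (sample n P0) (E n) < \<eta>"
    using order_tendstoD(2)[OF lim \<eta>] by (auto simp: eventually_sequentially)
  have "norm (measure (Qn n) (E n) - 0) < e" if n: "n \<ge> max n0 n1" for n
  proof -
    have i: "(\<integral>\<omega>. indicator (E n) \<omega> \<partial>R) = measure R (E n)" if R: "sets R = sets (PiM {..<n} (\<lambda>_. borel :: 'z measure))" for R
      using sets.sets_into_space[of "E n" R] E[of n] R by (simp add: Int_absorb2)
    have "(\<integral>\<omega>. indicator (E n) \<omega> \<partial>Qn n) \<le> e / 2"
    proof (rule n0)
      show "(\<integral>\<omega>. indicator (E n) \<omega> \<partial>sample n P0) \<le> \<eta>"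
        unfolding i[OF sets_sample[OF sets_P0]] using n1[of n] n by simp
    qed (use n E[of n] in \<open>auto intro: borel_measurable_indicator\<close>)
    then show ?thesis using e unfolding i[OF sets_Qn] by simp
  qed
  then show "\<exists>no. \<forall>n\<ge>no. norm (measure (Qn n) (E n) - 0) < e" by blast
qed

lemma char_Sn:
  "(\<lambda>n. \<integral>\<omega>. iexp (\<Sum>k<K. w k * inner (Sn n \<omega>) (hb k)) \<partial>Qn n)
    \<longlonglongrightarrow> (\<integral>x. iexp (\<Sum>k<K. w k * inner (x + \<delta>) (hb k)) \<partial>G)"
proof -
  define f where "f z = (\<Sum>k<K. w k * phi_coord k z)" for z
  define W where "W = (\<Sum>k<K. w k *\<^sub>R hb k)"
  have fm: "f \<in> borel_measurable borel" unfolding f_def[abs_def] by measurable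
  have fl: "f \<in> borel_measurable lam" using fm by (simp add: measurable_cong_sets[OF sets_lam refl])
  have sm: "s \<in> borel_measurable borel" by (rule tangent_meas[OF s])
  have g1: "integrable P0 (phi_coord k)" for k
    by (rule integral_le_L2_norm(1)[OF prob_P0]) (use g_L2 in \<open>auto simp: L2_def borel_P0\<close>)
  have f2: "integrable lam (\<lambda>z. (f z)\<^sup>2 * dens lam P0 z)" "(\<integral>z. (f z)\<^sup>2 * dens lam P0 z \<partial>lam) = inner (Cov W) W"
    using integral_dens[OF model P0, of "\<lambda>z. (f z)\<^sup>2"] fm comb_second_moment[of w K]
    by (auto simp: f_def[symmetric] W_def[symmetric])
  have f0: "(\<integral>z. f z * dens lam P0 z \<partial>lam) = 0"
    using integral_dens(1)[OF model P0 fm] g1 by (simp add: f_def g_mean_zero)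
  have sf: "(\<integral>z. s z * f z * dens lam P0 z \<partial>lam) = inner \<delta> W"
  proof -
    have "(\<integral>z. s z * f z * dens lam P0 z \<partial>lam) = (\<integral>z. s z * f z \<partial>P0)"
      by (rule integral_dens(1)[OF model P0]) (use sm fm in auto)
    also have "\<dots> = (\<integral>z. (\<Sum>k<K. w k * (s z * phi_coord k z)) \<partial>P0)" by (simp add: f_def sum_distrib_left mult_ac)
    also have "\<dots> = (\<Sum>k<K. w k * inner \<delta> (hb k))" using sg_integrable[OF s] by (simp add: inner_shift_hb[OF s])
    finally show ?thesis by (simp add: W_def inner_sum_right)
  qed
  have "(\<lambda>n. \<integral>\<omega>. iexp (1 / sqrt (real n) * (\<Sum>i<n. f (\<omega> i))) \<partial>Qn n)
    \<longlonglongrightarrow> exp (\<i> * complex_of_real (inner \<delta> W) - complex_of_real (inner (Cov W) W / 2))"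
    using Q.char_local_alternative[OF fl f2(1) f0] unfolding sf f2(2) .
  moreover have "1 / sqrt (real n) * (\<Sum>i<n. f (\<omega> i)) = (\<Sum>k<K. w k * inner (Sn n \<omega>) (hb k))" for n \<omega>
  proof -
    have "(\<Sum>i<n. f (\<omega> i)) = (\<Sum>k<K. w k * (\<Sum>i<n. phi_coord k (\<omega> i)))"
      unfolding f_def sum_distrib_left by (rule sum.swap)
    then show ?thesis by (simp add: inner_Sn sum_distrib_left mult_ac)
  qed
  moreover have "(\<integral>x. iexp (\<Sum>k<K. w k * inner (x + \<delta>) (hb k)) \<partial>G)
      = exp (\<i> * complex_of_real (inner \<delta> W) - complex_of_real (inner (Cov W) W / 2))"
  proof -
    have "(\<Sum>k<K. w k * inner (x + \<delta>) (hb k)) = inner \<delta> W + inner x W" for x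
      by (simp add: W_def inner_sum_right inner_add_left distrib_left sum.distrib)
    then have "(\<integral>x. iexp (\<Sum>k<K. w k * inner (x + \<delta>) (hb k)) \<partial>G) = (\<integral>x. iexp (inner \<delta> W) * iexp (inner x W) \<partial>G)"
      by (simp add: mult_exp_exp distrib_left)
    also have "\<dots> = iexp (inner \<delta> W) * (\<integral>x. iexp (inner x W) \<partial>G)" by (rule integral_mult_right_zero)
    also have "\<dots> = exp (\<i> * complex_of_real (inner \<delta> W) - complex_of_real (inner (Cov W) W / 2))"
      unfolding H.char_G by (simp add: exp_of_real[symmetric] mult_exp_exp)
    finally show ?thesis .
  qed
  ultimately show ?thesis by (simp only:)
qed

text \<open>\<open>A n\<close> is replaced by \<open>Sn n\<close>, and this by its projection to
  \<open>K\<close> coordinates, whose transform converges by the characteristic functions. Both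
  replacement errors are dominated by one [0,1]-valued functional with small mean under
  \<open>P0\<close>, which contiguity carries to the alternatives. As \<open>\<eta>\<close> and
  \<open>n0\<close> hold for all functionals, \<open>K\<close> may be chosen after them.\<close>

lemma laplace_asymptotically_linear:
  fixes A :: "nat \<Rightarrow> (nat \<Rightarrow> 'z) \<Rightarrow> 'h"
  assumes Am: "\<And>n. A n \<in> borel_measurable (PiM {..<n} (\<lambda>_. borel))"
    and lin: "\<And>e. e > 0 \<Longrightarrow> (\<lambda>n. measure (sample n P0) {\<omega> \<in> space (sample n P0). norm (A n \<omega> - Sn n \<omega>) > e}) \<longlonglongrightarrow> 0"
  shows "(\<lambda>n. \<integral>\<omega>. exp (- (real m * (norm (A n \<omega>))\<^sup>2)) \<partial>Qn n) \<longlonglongrightarrow> (\<integral>x. exp (- (real m * (norm (x + \<delta>))\<^sup>2)) \<partial>G)"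
proof (rule LIMSEQ_I)
  fix \<epsilon> :: real assume \<epsilon>: "0 < \<epsilon>"
  note Sm = Sn_meas
  define pr where "pr K x = (\<Sum>k<K. inner x (hb k) *\<^sub>R hb k)" for K x
  have prm [measurable]: "pr K \<in> borel_measurable borel" for K unfolding pr_def by measurable
  have npr: "(norm (pr K x))\<^sup>2 = (\<Sum>k<K. (inner x (hb k))\<^sup>2)" for K x
    unfolding pr_def by (rule padded_onb_projection(1)[OF onb])
  define L where "L = real m + 1"
  have L: "L > 0" by (simp add: L_def)
  define Hinf where "Hinf = (\<integral>x. exp (- (real m * (norm (x + \<delta>))\<^sup>2)) \<partial>G)"
  define H where "H K = (\<integral>x. exp (- (real m * (norm (pr K (x + \<delta>)))\<^sup>2)) \<partial>G)" for K
  have Hlim: "H \<longlonglongrightarrow> Hinf" unfolding H_def[abs_def] Hinf_def npr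
    by (rule padded_onb_laplace_limit[OF onb H.prob_space_axioms]) measurable
  obtain \<eta> n0 where \<eta>: "\<eta> > 0" and n0: "\<And>n F. n \<ge> n0 \<Longrightarrow> F \<in> borel_measurable (PiM {..<n} (\<lambda>_. borel)) \<Longrightarrow> (\<And>\<omega>. 0 \<le> F \<omega> \<and> F \<omega> \<le> 1) \<Longrightarrow>
      (\<integral>\<omega>. F \<omega> \<partial>sample n P0) \<le> \<eta> \<Longrightarrow> (\<integral>\<omega>. F \<omega> \<partial>Qn n) \<le> \<epsilon> / 3"
    using contiguous_integral[of "\<epsilon> / 3"] \<epsilon> by auto
  \<comment> \<open>The mean of the functional under \<open>P0\<close> is bounded by four pieces,
    each at most \<open>\<eta> / 4\<close>: the exceptional event, \<open>L * a\<close>,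
    \<open>L * \<kappa> / 2\<close> and the weighted tail. Given \<open>\<kappa>\<close>, the last
    one fixes \<open>K\<close>.\<close>
  define a where "a = \<eta> / (4 * L)"
  define \<kappa> where "\<kappa> = \<eta> / (2 * L)"
  have a: "a > 0" "L * a = \<eta> / 4" and \<kappa>: "\<kappa> > 0" "L * \<kappa> / 2 = \<eta> / 4" using \<eta> L by (auto simp: a_def \<kappa>_def)
  have "eventually (\<lambda>K. dist (H K) Hinf < \<epsilon> / 3) sequentially" using Hlim \<epsilon> by (intro tendstoD) auto
  moreover have "eventually (\<lambda>K. L / (2 * \<kappa>) * tail K < \<eta> / 4) sequentially"
    using tendsto_mult_right_zero[OF tail_lim, of "L / (2 * \<kappa>)"] \<eta> by (intro order_tendstoD(2)) auto
  ultimately have "eventually (\<lambda>K. dist (H K) Hinf < \<epsilon> / 3 \<and> L / (2 * \<kappa>) * tail K < \<eta> / 4) sequentially"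
    by (rule eventually_conj)
  then obtain K where K: "\<bar>H K - Hinf\<bar> < \<epsilon> / 3" "L / (2 * \<kappa>) * tail K < \<eta> / 4"
    by (auto simp: eventually_sequentially dist_real_def)
  have lim3: "(\<lambda>n. \<integral>\<omega>. exp (- (real m * (norm (pr K (Sn n \<omega>)))\<^sup>2)) \<partial>Qn n) \<longlonglongrightarrow> H K"
    unfolding H_def npr
    by (rule char_convergence_imp_laplace_convergence[where U="\<lambda>n k \<omega>. inner (Sn n \<omega>) (hb k)" and V="\<lambda>k x. inner (x + \<delta>) (hb k)",
          OF prob_Qn H.prob_space_axioms _ _ char_Sn])
       (use Sm in \<open>auto simp: meas_Qn\<close>)
  obtain n1 where n1: "\<And>n. n \<ge> n1 \<Longrightarrow> \<bar>(\<integral>\<omega>. exp (- (real m * (norm (pr K (Sn n \<omega>)))\<^sup>2)) \<partial>Qn n) - H K\<bar> < \<epsilon> / 3"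
    using LIMSEQ_D[OF lim3, of "\<epsilon> / 3"] \<epsilon> by auto
  obtain n2 where n2: "\<And>n. n \<ge> n2 \<Longrightarrow> measure (sample n P0) {\<omega> \<in> space (sample n P0). norm (A n \<omega> - Sn n \<omega>) > a} < \<eta> / 4"
    using order_tendstoD(2)[OF lin[OF a(1)], of "\<eta> / 4"] \<eta> by (auto simp: eventually_sequentially)
  have "norm ((\<integral>\<omega>. exp (- (real m * (norm (A n \<omega>))\<^sup>2)) \<partial>Qn n) - Hinf) < \<epsilon>" if n: "n \<ge> max n0 (max n1 n2)" for n
  proof -
    \<comment> \<open>\<open>L\<close> is the Lipschitz constant of
      \<open>exp_square_lipschitz\<close>; the cap at 1 is legitimate because two numbers in [0,1]
      differ by at most 1. So \<open>F\<close> dominates the error pointwise and is admissible for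
      contiguity.\<close>
    define F where "F \<omega> = min 1 (L * (norm (A n \<omega> - Sn n \<omega>) + norm (Sn n \<omega> - pr K (Sn n \<omega>))))" for \<omega>
    have [measurable]: "A n \<in> borel_measurable (PiM {..<n} (\<lambda>_. borel))" "Sn n \<in> borel_measurable (PiM {..<n} (\<lambda>_. borel))"
      using Am Sm by auto
    have Fm: "F \<in> borel_measurable (PiM {..<n} (\<lambda>_. borel))" unfolding F_def[abs_def] by measurable
    have F01: "0 \<le> F \<omega> \<and> F \<omega> \<le> 1" for \<omega> using L by (simp add: F_def)
    interpret P: prob_space "sample n P0" by (rule prob_sample)
    interpret QQ: prob_space "Qn n" by (rule prob_Qn)
    define E where "E = {\<omega> \<in> space (sample n P0). norm (A n \<omega> - Sn n \<omega>) > a}"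
    have Em: "E \<in> sets (sample n P0)"
      unfolding E_def using Am[of n] Sm[of n] by (auto simp: meas_P0[symmetric])
    have FP: "(\<integral>\<omega>. F \<omega> \<partial>sample n P0) \<le> \<eta>"
    proof -
      let ?R = "\<lambda>\<omega>. (norm (Sn n \<omega> - pr K (Sn n \<omega>)))\<^sup>2"
      note R = Sn_tail[of n K, folded pr_def]
      have iF: "integrable (sample n P0) F"
        by (rule P.integrable_const_bound[where B=1]) (use Fm F01 in \<open>auto simp: meas_P0\<close>)
      have iE: "integrable (sample n P0) (indicator E :: _ \<Rightarrow> real)"
        by (rule integrable_real_indicator) (use Em in \<open>auto simp: P.emeasure_eq_measure\<close>)
      have "(\<integral>\<omega>. F \<omega> \<partial>sample n P0) \<le> (\<integral>\<omega>. indicator E \<omega> + L * a + (L * \<kappa> / 2 + L / (2 * \<kappa>) * ?R \<omega>) \<partial>sample n P0)"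
      proof (rule integral_mono[OF iF])
        fix \<omega> assume \<omega>: "\<omega> \<in> space (sample n P0)"
        let ?x = "norm (A n \<omega> - Sn n \<omega>)" and ?y = "norm (Sn n \<omega> - pr K (Sn n \<omega>))"
        \<comment> \<open>Trades the norm of the projection error for its square, whose mean is
          controlled by \<open>Sn_tail\<close>.\<close>
        have "?y \<le> \<kappa> / 2 + ?y\<^sup>2 / (2 * \<kappa>)"
        proof -
          have "0 \<le> (?y - \<kappa>)\<^sup>2 / (2 * \<kappa>)" using \<kappa> by simp
          also have "\<dots> = \<kappa> / 2 + ?y\<^sup>2 / (2 * \<kappa>) - ?y" using \<kappa>(1) by (simp add: power2_eq_square field_simps)
          finally show ?thesis by simp
        qed
        from mult_left_mono[OF this less_imp_le[OF L]]
        have y: "L * ?y \<le> L * \<kappa> / 2 + L / (2 * \<kappa>) * ?y\<^sup>2" by (simp add: distrib_left)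
        show "F \<omega> \<le> indicator E \<omega> + L * a + (L * \<kappa> / 2 + L / (2 * \<kappa>) * ?R \<omega>)"
        proof (cases "\<omega> \<in> E")
          case True
          have "0 \<le> L * a" "0 \<le> L * \<kappa> / 2" "0 \<le> L / (2 * \<kappa>) * ?R \<omega>" using L a(1) \<kappa>(1) by auto
          then show ?thesis using True F01[of \<omega>] by simp
        next
          case False
          then have "?x \<le> a" using \<omega> by (simp add: E_def)
          then have "L * ?x \<le> L * a" using L by simp
          moreover have "F \<omega> \<le> L * ?x + L * ?y" by (simp add: F_def distrib_left)
          ultimately show ?thesis using False y by simp
        qed
      qed (use iE R in auto)
      also have "\<dots> = measure (sample n P0) E + L * a + (L * \<kappa> / 2 + L / (2 * \<kappa>) * (\<integral>\<omega>. ?R \<omega> \<partial>sample n P0))"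
        using iE R Em by (simp add: P.prob_space)
      also have "L / (2 * \<kappa>) * (\<integral>\<omega>. ?R \<omega> \<partial>sample n P0) \<le> L / (2 * \<kappa>) * tail K"
        using R L \<kappa> by (intro mult_left_mono) auto
      finally show ?thesis using n2[of n] n a(2) \<kappa>(2) K(2) by (simp add: E_def)
    qed
    have FQ: "(\<integral>\<omega>. F \<omega> \<partial>Qn n) \<le> \<epsilon> / 3" by (rule n0[OF _ Fm F01 FP]) (use n in simp)
    have ie: "integrable (Qn n) (\<lambda>\<omega>. exp (- (real m * (norm (B \<omega>))\<^sup>2)))" if "B \<in> borel_measurable (PiM {..<n} (\<lambda>_. borel))" for B :: "_ \<Rightarrow> 'h"
      by (rule QQ.integrable_const_bound[where B=1]) (use that in \<open>auto simp: meas_Qn[symmetric]\<close>)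
    have iA: "integrable (Qn n) (\<lambda>\<omega>. exp (- (real m * (norm (A n \<omega>))\<^sup>2)))" by (rule ie) measurable
    have iS: "integrable (Qn n) (\<lambda>\<omega>. exp (- (real m * (norm (pr K (Sn n \<omega>)))\<^sup>2)))" by (rule ie) measurable
    have "\<bar>(\<integral>\<omega>. exp (- (real m * (norm (A n \<omega>))\<^sup>2)) \<partial>Qn n) - (\<integral>\<omega>. exp (- (real m * (norm (pr K (Sn n \<omega>)))\<^sup>2)) \<partial>Qn n)\<bar>
       = \<bar>\<integral>\<omega>. exp (- (real m * (norm (A n \<omega>))\<^sup>2)) - exp (- (real m * (norm (pr K (Sn n \<omega>)))\<^sup>2)) \<partial>Qn n\<bar>"
      using iA iS by simp
    also have "\<dots> \<le> (\<integral>\<omega>. \<bar>exp (- (real m * (norm (A n \<omega>))\<^sup>2)) - exp (- (real m * (norm (pr K (Sn n \<omega>)))\<^sup>2))\<bar> \<partial>Qn n)"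
      by (rule integral_abs_bound)
    also have "\<dots> \<le> (\<integral>\<omega>. F \<omega> \<partial>Qn n)"
    proof (rule integral_mono)
      show "integrable (Qn n) F"
        by (rule QQ.integrable_const_bound[where B=1]) (use Fm F01 in \<open>auto simp: meas_Qn\<close>)
      fix \<omega>
      let ?u = "exp (- (real m * (norm (A n \<omega>))\<^sup>2))" and ?v = "exp (- (real m * (norm (pr K (Sn n \<omega>)))\<^sup>2))"
      have "0 < ?u" "?u \<le> 1" "0 < ?v" "?v \<le> 1" by auto
      then have 1: "\<bar>?u - ?v\<bar> \<le> 1" by linarith
      have "\<bar>?u - ?v\<bar> \<le> L * \<bar>norm (A n \<omega>) - norm (pr K (Sn n \<omega>))\<bar>"
        unfolding L_def by (rule exp_square_lipschitz) simp
      also have "\<bar>norm (A n \<omega>) - norm (pr K (Sn n \<omega>))\<bar> \<le> norm (A n \<omega> - pr K (Sn n \<omega>))" by (rule norm_triangle_ineq3)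
      also have "\<dots> \<le> norm (A n \<omega> - Sn n \<omega>) + norm (Sn n \<omega> - pr K (Sn n \<omega>))"
        using norm_triangle_ineq[of "A n \<omega> - Sn n \<omega>" "Sn n \<omega> - pr K (Sn n \<omega>)"] by simp
      finally have 2: "\<bar>?u - ?v\<bar> \<le> L * (norm (A n \<omega> - Sn n \<omega>) + norm (Sn n \<omega> - pr K (Sn n \<omega>)))" using L by simp
      show "\<bar>?u - ?v\<bar> \<le> F \<omega>" using 1 2 by (simp add: F_def)
    qed (use iA iS in auto)
    finally have "\<bar>(\<integral>\<omega>. exp (- (real m * (norm (A n \<omega>))\<^sup>2)) \<partial>Qn n) - (\<integral>\<omega>. exp (- (real m * (norm (pr K (Sn n \<omega>)))\<^sup>2)) \<partial>Qn n)\<bar> \<le> \<epsilon> / 3"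
      using FQ by linarith
    then show ?thesis using n1[of n] n K(1) unfolding real_norm_def by linarith
  qed
  then show "\<exists>no. \<forall>n\<ge>no. norm ((\<integral>\<omega>. exp (- (real m * (norm (A n \<omega>))\<^sup>2)) \<partial>Qn n) - (\<integral>x. exp (- (real m * (norm (x + \<delta>))\<^sup>2)) \<partial>G)) < \<epsilon>"
    unfolding Hinf_def by blast
qed

lemma norm_shift_no_atom:
  assumes "D s \<noteq> 0" shows "measure G {x. (norm (x + a))\<^sup>2 = t} = 0"
proof -
  obtain e r where "norm e = 1" "0 < r" "Cov e = r *\<^sub>R e"
    using H.ex_unit_eigenvector[OF Cov_shift_nonzero[OF s assms]] .
  then show ?thesis by (rule H.norm_no_atom)
qed

lemma rejection_probability_limit:
  assumes Am: "\<And>n. A n \<in> borel_measurable (PiM {..<n} (\<lambda>_. borel))"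
    and lin: "\<And>e. e > 0 \<Longrightarrow> (\<lambda>n. measure (sample n P0) {\<omega> \<in> space (sample n P0). norm (A n \<omega> - Sn n \<omega>) > e}) \<longlonglongrightarrow> 0"
    and zm: "\<And>n. z n \<in> borel_measurable (PiM {..<n} (\<lambda>_. borel))"
    and zlim: "\<And>e. e > 0 \<Longrightarrow> (\<lambda>n. measure (sample n P0) {\<omega> \<in> space (sample n P0). \<bar>z n \<omega> - \<zeta>\<bar> > e}) \<longlonglongrightarrow> 0"
    and nz: "D s \<noteq> 0"
  shows "(\<lambda>n. measure (Qn n) {\<omega> \<in> space (Qn n). (norm (A n \<omega>))\<^sup>2 > z n \<omega>})
    \<longlonglongrightarrow> measure G {x \<in> space G. (norm (x + \<delta>))\<^sup>2 > \<zeta>}"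
proof (rule converging_cdf_random_threshold[OF prob_Qn H.prob_space_axioms])
  show "(\<lambda>\<omega>. (norm (A n \<omega>))\<^sup>2) \<in> borel_measurable (Qn n)" "z n \<in> borel_measurable (Qn n)" for n
    using Am[of n] zm[of n] by (auto simp: meas_Qn)
  show "(\<lambda>x. (norm (x + \<delta>))\<^sup>2) \<in> borel_measurable G" by measurable
  show "(\<lambda>n. \<integral>\<omega>. exp (- (real m * (norm (A n \<omega>))\<^sup>2)) \<partial>Qn n) \<longlonglongrightarrow> (\<integral>x. exp (- (real m * (norm (x + \<delta>))\<^sup>2)) \<partial>G)" for m
    by (rule laplace_asymptotically_linear[OF Am lin])
  show "measure G {x \<in> space G. (norm (x + \<delta>))\<^sup>2 = \<zeta>} = 0"
    using norm_shift_no_atom[OF nz] by (simp add: H.space_G)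
  fix e :: real assume e: "e > 0"
  have sp: "space (Qn n) = space (sample n P0)" for n
    by (rule sets_eq_imp_space_eq) (simp add: sets_Qn sets_sample[OF sets_P0])
  have "(\<lambda>n. measure (Qn n) {\<omega> \<in> space (sample n P0). \<bar>z n \<omega> - \<zeta>\<bar> > e}) \<longlonglongrightarrow> 0"
  proof (rule contiguous_events[OF _ zlim[OF e]])
    fix n
    have "{\<omega> \<in> space (sample n P0). \<bar>z n \<omega> - \<zeta>\<bar> > e} \<in> sets (sample n P0)"
      using zm[of n] by (auto simp: meas_P0[symmetric])
    then show "{\<omega> \<in> space (sample n P0). \<bar>z n \<omega> - \<zeta>\<bar> > e} \<in> sets (PiM {..<n} (\<lambda>_. borel))"
      by (simp only: sets_sample[OF sets_P0])
  qed
  then show "(\<lambda>n. measure (Qn n) {\<omega> \<in> space (Qn n). \<bar>z n \<omega> - \<zeta>\<bar> > e}) \<longlonglongrightarrow> 0" by (simp only: sp)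
qed auto

text \<open>Without atoms the centred ball at the quantile has probability exactly
  \<open>1 - \<alpha>\<close>. This is positive, as the strict comparison of balls requires, and the
  complement of the shifted ball then exceeds \<open>\<alpha>\<close>.\<close>

lemma power_above_level:
  assumes nz: "D s \<noteq> 0" and \<alpha>: "0 < \<alpha>" "\<alpha> < 1"
  shows "measure G {x \<in> space G. (norm (x + \<delta>))\<^sup>2 > quantile G (\<lambda>x. (norm x)\<^sup>2) (1 - \<alpha>)} > \<alpha>"
proof -
  let ?\<zeta> = "quantile G (\<lambda>x. (norm x)\<^sup>2) (1 - \<alpha>)"
  have C\<delta>: "Cov \<delta> \<noteq> 0" by (rule Cov_shift_nonzero[OF s nz])
  note atom = norm_shift_no_atom[OF nz]
  have "measure G {x \<in> space G. (norm x)\<^sup>2 \<le> ?\<zeta>} = 1 - \<alpha>"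
    by (rule measure_le_quantile[OF H.prob_space_axioms]) (use atom[of 0] \<alpha> in \<open>auto simp: H.space_G\<close>)
  then have F0: "H.ball_prob 0 ?\<zeta> = 1 - \<alpha>" by (simp add: H.ball_prob_def H.space_G)
  have "H.ball_prob \<delta> ?\<zeta> < H.ball_prob 0 ?\<zeta>"
    by (rule H.strict_Anderson_ball[OF C\<delta> shift_ker[OF s]]) (use F0 \<alpha> in auto)
  then have lt: "H.ball_prob \<delta> ?\<zeta> < 1 - \<alpha>" by (simp add: F0)
  have "{x \<in> space G. (norm (x + \<delta>))\<^sup>2 > ?\<zeta>} = space G - {x. (norm (x + \<delta>))\<^sup>2 \<le> ?\<zeta>}"
    by (auto simp: H.space_G)
  then have "measure G {x \<in> space G. (norm (x + \<delta>))\<^sup>2 > ?\<zeta>} = 1 - H.ball_prob \<delta> ?\<zeta>"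
    using H.prob_compl[of "{x. (norm (x + \<delta>))\<^sup>2 \<le> ?\<zeta>}"] by (simp add: H.ball_prob_def H.sets_G)
  then show ?thesis using lt by simp
qed

end

section \<open>Rate of the path and assembly\<close>

lemma tangent_set_subset_space: "s \<in> tangent_set lam Pm P \<Longrightarrow> s \<in> tangent_space lam Pm P"
proof -
  assume s: "s \<in> tangent_set lam Pm P"
  have "\<exists>(n::nat) (c::nat \<Rightarrow> real) f. (\<forall>i<n. f i \<in> tangent_set lam Pm P) \<and>
        L2_norm_P P (\<lambda>z. s z - (\<Sum>i<n. c i * f i z)) < e" if "e > 0" for e
    using that s by (intro exI[of _ 1] exI[of _ "\<lambda>_. 1"] exI[of _ "\<lambda>_. s"]) (simp add: L2_norm_P_def)
  then show ?thesis using s by (simp add: tangent_space_def tangent_set_def)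
qed

lemma pathwise_derivative_rate:
  assumes diff: "pathwise_derivative lam Pm \<nu> P D" and s: "s \<in> tangent_set lam Pm P" and path: "Pe \<in> submodels lam Pm P s"
  shows "(\<lambda>n. norm (\<nu> (Pe (1 / sqrt (real n))) - \<nu> P)) \<in> O(\<lambda>n. 1 / sqrt (real n))"
proof -
  have lim: "((\<lambda>\<epsilon>. norm (\<nu> (Pe \<epsilon>) - \<nu> P - \<epsilon> *\<^sub>R D s) / \<epsilon>) \<longlongrightarrow> 0) (at_right 0)"
    using diff s path by (simp add: pathwise_derivative_def)
  have sq0: "(\<lambda>n. 1 / sqrt (real n)) \<longlonglongrightarrow> 0"
    by (intro real_tendsto_divide_at_top[where F=sequentially, OF tendsto_const]
        filterlim_compose[OF sqrt_at_top filterlim_real_sequentially])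
  have fl: "filterlim (\<lambda>n. 1 / sqrt (real n)) (at_right 0) sequentially"
    unfolding filterlim_at using sq0 by (auto intro!: eventually_sequentiallyI[of 1])
  have ev: "eventually (\<lambda>n. norm (\<nu> (Pe (1 / sqrt (real n))) - \<nu> P - (1 / sqrt (real n)) *\<^sub>R D s) / (1 / sqrt (real n)) < 1) sequentially"
    using order_tendstoD(2)[OF filterlim_compose[OF lim fl], of 1] by simp
  have "eventually (\<lambda>n. norm (norm (\<nu> (Pe (1 / sqrt (real n))) - \<nu> P)) \<le> (norm (D s) + 1) * norm (1 / sqrt (real n))) sequentially"
    using ev eventually_ge_at_top[of 1]
  proof eventually_elim
    case (elim n)
    let ?e = "1 / sqrt (real n)" and ?d = "\<nu> (Pe (1 / sqrt (real n))) - \<nu> P"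
    have e: "?e > 0" using elim by simp
    have "norm (?d - ?e *\<^sub>R D s) \<le> ?e" using elim(1) unfolding pos_divide_less_eq[OF e] by simp
    moreover have "norm ?d \<le> norm (?d - ?e *\<^sub>R D s) + norm (?e *\<^sub>R D s)" using norm_triangle_ineq[of "?d - ?e *\<^sub>R D s" "?e *\<^sub>R D s"] by simp
    moreover have "norm (?e *\<^sub>R D s) = norm (D s) * ?e" using e by simp
    moreover have "(norm (D s) + 1) * ?e = norm (D s) * ?e + ?e" by (simp only: distrib_right mult_1)
    ultimately have "norm ?d \<le> (norm (D s) + 1) * ?e" by linarith
    then show ?case using e by simp
  qed
  then show ?thesis by (rule bigoI)
qed

theorem theorem6:
  fixes lam :: "'z::polish_space measure"
    and Pm :: "'z measure set"
    and \<nu> :: "'z measure \<Rightarrow> 'h::{real_inner, polish_space}"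
    and hb :: "nat \<Rightarrow> 'h"
    and \<beta> :: "nat \<Rightarrow> real"
    and P0 :: "'z measure" and h0 :: "'h" and \<alpha> :: real
    and D :: "('z \<Rightarrow> real) \<Rightarrow> 'h" and Dstar :: "'h \<Rightarrow> 'z \<Rightarrow> real"
    and G :: "'h measure"
    and est :: "nat \<Rightarrow> (nat \<Rightarrow> 'z) \<Rightarrow> 'h"
    and zeta_hat :: "nat \<Rightarrow> (nat \<Rightarrow> 'z) \<Rightarrow> real"
    and s :: "'z \<Rightarrow> real" and Pe :: "real \<Rightarrow> 'z measure"
  assumes model: "dominated_model lam Pm" and P0: "P0 \<in> Pm"
    and onb: "padded_onb hb"
    and beta: "\<forall>k. 0 < \<beta> k \<and> \<beta> k \<le> 1" "summable (\<lambda>k. (\<beta> k)\<^sup>2)"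
    and alpha: "0 < \<alpha>" "\<alpha> < 1"
    and diff: "pathwise_derivative lam Pm \<nu> P0 D"
    and adj: "is_adjoint lam Pm P0 D Dstar"
    and h0: "\<nu> P0 = h0"
    and G: "gaussian_law_of G P0 (phi_beta \<beta> hb Dstar)"
    and est_meas: "\<forall>n. est n \<in> borel_measurable (PiM {..<n} (\<lambda>_. borel))"
    and zeta_meas: "\<forall>n. zeta_hat n \<in> borel_measurable (PiM {..<n} (\<lambda>_. borel))"
    and asym_lin: "\<forall>e>0. (\<lambda>n. measure (sample n P0)
          {\<omega> \<in> space (sample n P0).
             sqrt (real n) * norm (est n \<omega> - Gamma \<beta> hb (\<nu> P0)
               - (1 / real n) *\<^sub>R (\<Sum>i<n. phi_beta \<beta> hb Dstar (\<omega> i))) > e})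
          \<longlonglongrightarrow> 0"
    and consistent: "\<forall>e>0. (\<lambda>n. measure (sample n P0)
          {\<omega> \<in> space (sample n P0).
             \<bar>zeta_hat n \<omega> - quantile G (\<lambda>x. (norm x)\<^sup>2) (1 - \<alpha>)\<bar> > e}) \<longlonglongrightarrow> 0"
    and s: "s \<in> tangent_set lam Pm P0"
    and path: "Pe \<in> submodels lam Pm P0 s"
    and nonzero: "norm (D s) > 0"
  shows "(\<lambda>n. measure (sample n (Pe (1 / sqrt (real n))))
            {\<omega> \<in> space (sample n (Pe (1 / sqrt (real n)))).
               h0 \<notin> {h. (norm (est n \<omega> - Gamma \<beta> hb h))\<^sup>2 \<le> zeta_hat n \<omega> / real n}})
         \<longlonglongrightarrow> measure G {x \<in> space G. (norm (x + Gamma \<beta> hb (D s)))\<^sup>2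
                                    > quantile G (\<lambda>x. (norm x)\<^sup>2) (1 - \<alpha>)}
    \<and> measure G {x \<in> space G. (norm (x + Gamma \<beta> hb (D s)))\<^sup>2
                   > quantile G (\<lambda>x. (norm x)\<^sup>2) (1 - \<alpha>)} > \<alpha>
    \<and> (\<lambda>n. norm (\<nu> (Pe (1 / sqrt (real n))) - h0)) \<in> O(\<lambda>n. 1 / sqrt (real n))"
proof -
  have sets_P0: "sets P0 = sets borel" using model P0 by (simp add: dominated_model_def)
  have sT: "s \<in> tangent_space lam Pm P0" by (rule tangent_set_subset_space[OF s])
  have sL2: "L2 P0 s" using s by (simp add: tangent_set_def)
  obtain C where C: "\<And>s. s \<in> tangent_space lam Pm P0 \<Longrightarrow> norm (D s) \<le> C * L2_norm_P P0 s"
    using diff unfolding pathwise_derivative_def by blast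
  \<comment> \<open>A constant valid for the norm bound might be negative; the later estimates
    multiply inequalities by it.\<close>
  define c where "c = max C 0"
  have bounded: "norm (D s) \<le> c * L2_norm_P P0 s" if "s \<in> tangent_space lam Pm P0" for s
  proof -
    have "C * L2_norm_P P0 s \<le> c * L2_norm_P P0 s" by (intro mult_right_mono) (auto simp: c_def L2_norm_P_def)
    then show ?thesis using C[OF that] by linarith
  qed
  obtain q where q: "qmd_sequence lam (dens lam P0) q s"
    and ev: "eventually (\<lambda>n. density lam (\<lambda>z. ennreal (q n z)) = Pe (1 / sqrt (real n))) sequentially"
    by (rule submodel_qmd_sequence[OF model P0 sL2 path])
  interpret A: pathwise_model lam Pm P0 D Dstar hb \<beta> c
    by unfold_locales (use model P0 onb beta bounded adj in \<open>auto simp: c_def\<close>)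
  interpret A: pathwise_alternative lam Pm P0 D Dstar hb \<beta> c q s G
    by (unfold pathwise_alternative_def pathwise_alternative_axioms_def, intro conjI A.pathwise_model_axioms q sT G)
  have nz: "D s \<noteq> 0" using nonzero by simp
  let ?\<zeta> = "quantile G (\<lambda>x. (norm x)\<^sup>2) (1 - \<alpha>)"
  \<comment> \<open>Scaled so that exclusion of \<open>h0\<close> from the confidence set becomes
    the event that the squared norm of \<open>T n\<close> exceeds the estimated quantile, and
    asymptotic linearity reads \<open>T n - Sn n \<rightarrow> 0\<close> in probability.\<close>
  define T where "T n \<omega> = sqrt (real n) *\<^sub>R (est n \<omega> - Gamma \<beta> hb h0)" for n \<omega>
  have norm_T_diff: "norm (T n \<omega> - A.Sn n \<omega>) = sqrt (real n) * norm (est n \<omega> - Gamma \<beta> hb (\<nu> P0)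
               - (1 / real n) *\<^sub>R (\<Sum>i<n. phi_beta \<beta> hb Dstar (\<omega> i)))" for n \<omega>
  proof -
    have "1 / sqrt (real n) = sqrt (real n) * (1 / real n)" by (cases "n = 0") (auto simp: field_simps)
    then have "T n \<omega> - A.Sn n \<omega> = sqrt (real n) *\<^sub>R (est n \<omega> - Gamma \<beta> hb (\<nu> P0)
               - (1 / real n) *\<^sub>R (\<Sum>i<n. phi_beta \<beta> hb Dstar (\<omega> i)))"
      by (simp only: T_def A.Sn_def h0 scaleR_diff_right scaleR_scaleR)
    then show ?thesis by simp
  qed
  have limit: "(\<lambda>n. measure (A.Qn n) {\<omega> \<in> space (A.Qn n). (norm (T n \<omega>))\<^sup>2 > zeta_hat n \<omega>})
    \<longlonglongrightarrow> measure G {x \<in> space G. (norm (x + Gamma \<beta> hb (D s)))\<^sup>2 > ?\<zeta>}"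
  proof (rule A.rejection_probability_limit[OF _ _ _ _ nz])
    show "T n \<in> borel_measurable (PiM {..<n} (\<lambda>_. borel))" for n
    proof -
      have [measurable]: "est n \<in> borel_measurable (PiM {..<n} (\<lambda>_. borel))" using est_meas by simp
      show ?thesis unfolding T_def[abs_def] by measurable
    qed
    show "zeta_hat n \<in> borel_measurable (PiM {..<n} (\<lambda>_. borel))" for n using zeta_meas by simp
    show "(\<lambda>n. measure (sample n P0) {\<omega> \<in> space (sample n P0). norm (T n \<omega> - A.Sn n \<omega>) > e}) \<longlonglongrightarrow> 0" if "e > 0" for e
      unfolding norm_T_diff using asym_lin that by blast
    show "(\<lambda>n. measure (sample n P0) {\<omega> \<in> space (sample n P0). \<bar>zeta_hat n \<omega> - ?\<zeta>\<bar> > e}) \<longlonglongrightarrow> 0" if "e > 0" for e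
      using consistent that by blast
  qed
  have "(\<lambda>n. measure (sample n (Pe (1 / sqrt (real n))))
            {\<omega> \<in> space (sample n (Pe (1 / sqrt (real n)))).
               h0 \<notin> {h. (norm (est n \<omega> - Gamma \<beta> hb h))\<^sup>2 \<le> zeta_hat n \<omega> / real n}})
         \<longlonglongrightarrow> measure G {x \<in> space G. (norm (x + Gamma \<beta> hb (D s)))\<^sup>2 > ?\<zeta>}"
  proof (rule Lim_transform_eventually[OF limit])
    show "eventually (\<lambda>n. measure (A.Qn n) {\<omega> \<in> space (A.Qn n). (norm (T n \<omega>))\<^sup>2 > zeta_hat n \<omega>}
      = measure (sample n (Pe (1 / sqrt (real n)))) {\<omega> \<in> space (sample n (Pe (1 / sqrt (real n)))).
               h0 \<notin> {h. (norm (est n \<omega> - Gamma \<beta> hb h))\<^sup>2 \<le> zeta_hat n \<omega> / real n}}) sequentially"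
      using ev eventually_ge_at_top[of 1]
    proof eventually_elim
      case (elim n)
      \<comment> \<open>The denominator \<open>n\<close> in the confidence set can be cleared since
        \<open>n \<ge> 1\<close>; the sample law agrees with \<open>A.Qn n\<close> only from some
        index on.\<close>
      then have "(norm (T n \<omega>))\<^sup>2 > zeta_hat n \<omega> \<longleftrightarrow> h0 \<notin> {h. (norm (est n \<omega> - Gamma \<beta> hb h))\<^sup>2 \<le> zeta_hat n \<omega> / real n}" for \<omega>
        by (simp add: T_def power_mult_distrib not_le pos_divide_less_eq mult.commute)
      then show ?case by (simp only: elim(1))
    qed
  qed
  moreover have "measure G {x \<in> space G. (norm (x + Gamma \<beta> hb (D s)))\<^sup>2 > ?\<zeta>} > \<alpha>"
    by (rule A.power_above_level[OF nz alpha])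
  moreover have "(\<lambda>n. norm (\<nu> (Pe (1 / sqrt (real n))) - h0)) \<in> O(\<lambda>n. 1 / sqrt (real n))"
    using pathwise_derivative_rate[OF diff s path] by (simp only: h0)
  ultimately show ?thesis by blast
qed

end
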